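(* Consider the Schrödinger equation $$\mathrm{i}\,\partial_t\psi=-\Delta_{\mathscr L}\psi+V(t,x)\psi,\qquad x\in\mathbb T^d,$$ with potential $V\in C^\infty(\mathbb R\times\mathbb T^d,\mathbb R)$ satisfying: for all $\ell\in\mathbb N$ and $\alpha\in\mathbb N^d$ there is a constant $C_{\ell,\alpha}$ with $$\sup_{(t,x)\in\mathbb R\times\mathbb T^d}|\partial_t^\ell\partial_x^\alpha V(t,x)|\le C_{\ell,\alpha}.$$ Then, for any $r>0$ and any $\epsilon>0$, there exists a constant $C_{r,\epsilon}>0$ such that each solution $\psi(t)$ of the equation with initial datum $\psi_0\in H^r$ (i.e. $\psi(0)=\psi_0$) fulfills $$\|\psi(t)\|_r\le C_{r,\epsilon}\,\langle t\rangle^\epsilon\,\|\psi_0\|_r .$$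
   Context: $\mathbb T^d=\mathbb R^d/(2\pi\mathbb Z)^d$. $\mathscr L=\{\sum_{i=1}^d m_i\mathbf v_i: m_i\in\mathbb Z\}$ is an arbitrary lattice of $\mathbb R^d$ with linearly independent generators $\mathbf v_1,\dots,\mathbf v_d\in\mathbb R^d$; $\mathbf V=(\mathbf v_1|\cdots|\mathbf v_d)$ and $W=\mathbf V^{-\top}$ (the transpose of $\mathbf V^{-1}$), an invertible real $d\times d$ matrix. The anisotropic Laplacian is the constant coefficient operator $\Delta_{\mathscr L}=\sum_{a,b=1}^d [W^\top W]_a^b\,\partial_{x_a}\partial_{x_b}$, so that $-\Delta_{\mathscr L}e^{\mathrm i j\cdot x}=\mu_j e^{\mathrm i j\cdot x}$ with $\mu_j=\|Wj\|^2$ for $j\in\mathbb Z^d$ ($\|\cdot\|$ the Euclidean norm). The Sobolev space is $H^r=\{\psi=\sum_{j\in\mathbb Z^d}\psi_je^{\mathrm i j\cdot x}\in L^2(\mathbb T^d,\mathbb C):\ \|\psi\|_r^2:=\sum_{j}\langle j\rangle^{2r}|\psi_j|^2<\infty\}$, with $\langle j\rangle=\sqrt{1+|j|^2}$ and likewise $\langle t\rangle=\sqrt{1+|t|^2}$. *)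

theory Defs
  imports "HOL-Analysis.Analysis"
begin

section \<open>Partial derivatives and smooth functions\<close>

definition partial_deriv ::
  "'a::real_normed_vector \<Rightarrow> ('a \<Rightarrow> 'b::real_normed_vector) \<Rightarrow> 'a \<Rightarrow> 'b" where
  "partial_deriv e f x = vector_derivative (\<lambda>h. f (x + h *\<^sub>R e)) (at 0)"

fun Ck :: "nat \<Rightarrow> ('a::euclidean_space \<Rightarrow> 'b::real_normed_vector) \<Rightarrow> bool" where
  "Ck 0 f \<longleftrightarrow> continuous_on UNIV f"
| "Ck (Suc n) f \<longleftrightarrow> continuous_on UNIV f \<and>
     (\<forall>e\<in>Basis. (\<forall>x. (\<lambda>h. f (x + h *\<^sub>R e)) differentiable (at 0)) \<and> Ck n (partial_deriv e f))"

definition smooth :: "('a::euclidean_space \<Rightarrow> 'b::real_normed_vector) \<Rightarrow> bool" where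
  "smooth f \<longleftrightarrow> (\<forall>n. Ck n f)"

text \<open>The mixed derivative \<open>\<partial>\<^sub>t\<^sup>l \<partial>\<^sub>x\<^sup>\<alpha>\<close> of a function of \<open>(t, x)\<close>. The finite index type carries no
  order, so the coordinates are processed in an arbitrary but fixed one; for smooth functions the
  result does not depend on it.\<close>

definition coords :: "'d::finite list" where
  "coords = (SOME is. distinct is \<and> set is = UNIV)"

definition mixed_deriv ::
  "nat \<Rightarrow> nat ^ 'd::finite \<Rightarrow> (real \<times> (real ^ 'd) \<Rightarrow> real) \<Rightarrow> real \<times> (real ^ 'd) \<Rightarrow> real" where
  "mixed_deriv l \<alpha> f =
     (partial_deriv (1, 0) ^^ l) (foldr (\<lambda>i. partial_deriv (0, axis i 1) ^^ (\<alpha> $ i)) coords f)"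


section \<open>Functions on the torus\<close>

text \<open>Functions on \<open>\<real>\<^sup>d / (2\<pi>\<int>)\<^sup>d\<close> are represented by \<open>2\<pi>\<close>-periodic functions on \<open>\<real>\<^sup>d\<close>, and
  integrated over the fundamental cell \<open>[0, 2\<pi>]\<^sup>d\<close>. Elements of \<open>L\<^sup>2\<close> are represented by
  individual functions, not by classes modulo null sets.\<close>

definition periodic :: "(real ^ 'd::finite \<Rightarrow> 'b) \<Rightarrow> bool" where
  "periodic f \<longleftrightarrow> (\<forall>x i. f (x + axis i (2 * pi)) = f x)"

definition torus :: "(real ^ 'd::finite) measure" where
  "torus = lebesgue_on (cbox 0 (\<chi> i. 2 * pi))"

definition L2 :: "(real ^ 'd::finite \<Rightarrow> complex) set" where
  "L2 = {f. periodic f \<and> f \<in> borel_measurable torus \<and> integrable torus (\<lambda>x. (cmod (f x))\<^sup>2)}"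

definition int_vec :: "int ^ 'd::finite \<Rightarrow> real ^ 'd" where
  "int_vec j = (\<chi> i. of_int (j $ i))"

definition fourier_coeff :: "(real ^ 'd::finite \<Rightarrow> complex) \<Rightarrow> int ^ 'd \<Rightarrow> complex" where
  "fourier_coeff f j =
     (LINT x|torus. f x * exp (- \<i> * of_real (int_vec j \<bullet> x))) / (2 * pi) ^ CARD('d)"

definition bracket :: "'a::real_normed_vector \<Rightarrow> real" where
  "bracket x = sqrt (1 + (norm x)\<^sup>2)"

definition sobolev :: "real \<Rightarrow> (real ^ 'd::finite \<Rightarrow> complex) set" where
  "sobolev r = {f \<in> L2.
     (\<lambda>j. bracket (int_vec j) powr (2 * r) * (cmod (fourier_coeff f j))\<^sup>2) summable_on UNIV}"

definition sobolev_norm :: "real \<Rightarrow> (real ^ 'd::finite \<Rightarrow> complex) \<Rightarrow> real" where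
  "sobolev_norm r f =
     sqrt (\<Sum>\<^sub>\<infinity>j. bracket (int_vec j) powr (2 * r) * (cmod (fourier_coeff f j))\<^sup>2)"


section \<open>The anisotropic Schroedinger equation\<close>

definition gen_matrix :: "('d::finite \<Rightarrow> real ^ 'd) \<Rightarrow> real ^ 'd ^ 'd" where
  "gen_matrix v = (\<chi> a i. v i $ a)"

definition dual_matrix :: "('d::finite \<Rightarrow> real ^ 'd) \<Rightarrow> real ^ 'd ^ 'd" where
  "dual_matrix v = transpose (matrix_inv (gen_matrix v))"

definition lattice_laplacian ::
  "('d::finite \<Rightarrow> real ^ 'd) \<Rightarrow> (real ^ 'd \<Rightarrow> complex) \<Rightarrow> real ^ 'd \<Rightarrow> complex" where
  "lattice_laplacian v f x =
     (\<Sum>a\<in>UNIV. \<Sum>b\<in>UNIV. (transpose (dual_matrix v) ** dual_matrix v) $ a $ b *\<^sub>R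
        partial_deriv (axis a 1) (partial_deriv (axis b 1) f) x)"

text \<open>Data in \<open>H\<^sup>r\<close> with small \<open>r\<close> have no classical second derivatives, so a solution is a
  continuous curve in \<open>L\<^sup>2\<close> satisfying the equation in the sense of distributions on the torus:
  it is paired (bilinearly) with an arbitrary smooth periodic \<open>\<phi>\<close>, and the symmetric operator
  \<open>\<Delta>\<close> acts on \<open>\<phi>\<close>.\<close>

definition schroedinger_solution ::
  "('d::finite \<Rightarrow> real ^ 'd) \<Rightarrow> (real \<times> (real ^ 'd) \<Rightarrow> real) \<Rightarrow> (real \<Rightarrow> real ^ 'd \<Rightarrow> complex) \<Rightarrow> bool"
  where
  "schroedinger_solution v V \<psi> \<longleftrightarrow>
     (\<forall>t. \<psi> t \<in> L2) \<and>
     (\<forall>t. ((\<lambda>s. LINT x|torus. (cmod (\<psi> s x - \<psi> t x))\<^sup>2) \<longlongrightarrow> 0) (at t)) \<and>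
     (\<forall>\<phi> t. smooth \<phi> \<longrightarrow> periodic \<phi> \<longrightarrow>
       (\<exists>D. ((\<lambda>s. LINT x|torus. \<psi> s x * \<phi> x) has_vector_derivative D) (at t) \<and>
            \<i> * D = - (LINT x|torus. \<psi> t x * lattice_laplacian v \<phi> x)
                    + (LINT x|torus. of_real (V (t, x)) * \<psi> t x * \<phi> x)))"

end

theory Submission
  imports Defs
begin

text \<open>On Fourier coefficients the equation reads \<open>i b\<^sub>j' = \<mu>\<^sub>j b\<^sub>j + \<Sum>k. v\<^sub>j\<^sub>-\<^sub>k b\<^sub>k\<close>, and it suffices to show
  that mass does not travel from frequencies \<open>|j| \<le> M\<close> to \<open>|j| > 2 M\<close> during times up to a fixed
  power of \<open>M\<close>, up to an error \<open>O(M\<^sup>-\<^sup>Q)\<close>: a dyadic sum over \<open>M \<ge> \<langle>t\<rangle>\<^sup>\<epsilon>\<^sup>/\<^sup>r\<close> then gives the bound in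
  \<open>H\<^sup>r\<close>, without interpolation and without using that solutions exist.

  A chain of lattice points with steps of length \<open>\<le> L = M\<^sup>\<delta>\<close>, along which \<open>\<mu>\<close> also changes by at most
  \<open>L\<close>, has only \<open>O(L\<^sup>a)\<close> distinct points. Hence the points which such chains connect to \<open>|j| \<ge> 7/4 M\<close>
  form a set \<open>A\<close> inside \<open>|j| \<ge> 3/2 M\<close>, and between neighbours inside and outside of \<open>A\<close> there is a
  gap \<open>|\<mu>\<^sub>j - \<mu>\<^sub>k| > L\<close>. Because of the gap, the Riccati equation for a graph over the components outside
  \<open>A\<close> that is invariant under the equation can be solved up to \<open>O(L\<^sup>-\<^sup>n)\<close>. Solutions on that graph
  vanish on \<open>|j| > 2 M\<close>. Since the mass is conserved, comparing with them through the inner product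
  alone controls the true solution.\<close>

section \<open>Chains of almost resonant lattice points\<close>

text \<open>No Diophantine condition restricts the lattice, so \<open>eig\<close> may have
  arbitrarily small nonzero differences, and no gap between single modes or between shells can be
  expected. Chains replace it: they are too short to cross a distance \<open>M / 4\<close>, hence
  some cut near \<open>|j| = 3/2 M\<close> is crossed by no almost resonant step. The exponent
  \<delta> that results is tiny, but each round of the Riccati iteration gains a factor
  \<open>1 / L\<close>, and smoothness of the potential in time allows as many rounds as desired.
  This pays for times up to \<open>M ^ E\<close> and for the polynomially many modes. Each round
  roughly doubles the range of the graph, so the potential is first truncated to range
  \<open>L / 2 ^ N\<close>; its rapid decay makes the rest harmless. Data in
  \<open>|j| \<le> M\<close> are so far from \<open>A\<close> that the graph adds nothing to them at
  time 0, and the approximate solution starts exactly from them. Thus the mass beyond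
  \<open>2 M\<close> at time \<open>T\<close> is at most the mass beyond \<open>M\<close> at time 0,
  up to a small multiple of the total mass; this one-sided form is what can be summed over dyadic
  \<open>M\<close>.\<close>

lemma abs_det_le:
  fixes A :: "real ^ 'd::finite ^ 'd"
  assumes "\<And>i j. \<bar>A $ i $ j\<bar> \<le> R"
  shows "\<bar>det A\<bar> \<le> fact CARD('d) * R ^ CARD('d)"
proof -
  have "\<bar>det A\<bar> \<le> (\<Sum>p | p permutes (UNIV::'d set). \<bar>of_int (sign p) * (\<Prod>i\<in>UNIV. A $ i $ p i)\<bar>)"
    unfolding det_def by (rule sum_abs)
  also have "\<dots> \<le> (\<Sum>p | p permutes (UNIV::'d set). R ^ CARD('d))"
  proof (rule sum_mono)
    fix p :: "'d \<Rightarrow> 'd"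
    have "\<bar>of_int (sign p) * (\<Prod>i\<in>UNIV. A $ i $ p i)\<bar> = (\<Prod>i\<in>UNIV. \<bar>A $ i $ p i\<bar>)"
      by (simp add: abs_mult abs_prod sign_def)
    also have "\<dots> \<le> (\<Prod>i\<in>(UNIV::'d set). R)"
      by (rule prod_mono) (use assms in auto)
    finally show "\<bar>of_int (sign p) * (\<Prod>i\<in>UNIV. A $ i $ p i)\<bar> \<le> R ^ CARD('d)" by simp
  qed
  also have "\<dots> = fact CARD('d) * R ^ CARD('d)"
    by (simp add: card_permutations[OF refl])
  finally show ?thesis .
qed

lemma det_Ints:
  fixes A :: "real ^ 'd::finite ^ 'd"
  assumes "\<And>i j. A $ i $ j \<in> \<int>"
  shows "det A \<in> \<int>"
  unfolding det_def by (intro Ints_sum Ints_mult Ints_prod) (use assms in auto)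

text \<open>By Cramer's rule: the coefficients of \<open>d\<close> in a basis of integer vectors are quotients of
  determinants, and the denominator is a nonzero integer.\<close>

lemma integer_span_functional_bound:
  fixes T :: "(real ^ 'd::finite) set"
  assumes T: "T \<subseteq> range int_vec" and R: "\<And>e. e \<in> T \<Longrightarrow> norm e \<le> R" "1 \<le> R"
    and \<phi>: "linear \<phi>" "\<And>e. e \<in> T \<Longrightarrow> \<bar>\<phi> e :: real\<bar> \<le> E" "0 \<le> E"
    and d: "d \<in> span T"
  shows "\<bar>\<phi> d\<bar> \<le> real CARD('d) * fact CARD('d) * R ^ CARD('d) * E * norm d"
proof -
  \<comment> \<open>With \<open>norm d \<le> 1\<close> the column that Cramer's rule substitutes
    still has entries bounded by \<open>R\<close>. The general case follows by homogeneity.\<close>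
  have unit: "\<bar>\<phi> d\<bar> \<le> real CARD('d) * fact CARD('d) * R ^ CARD('d) * E"
    if d: "d \<in> span T" and d1: "norm d \<le> 1" for d
  proof -
    obtain B0 where B0: "B0 \<subseteq> T" "independent B0" "T \<subseteq> span B0"
      using basis_exists[of T] by metis
    \<comment> \<open>Completing the basis by unit vectors gives a square integer system for the
      coordinates of \<open>d\<close>. Since \<open>d\<close> lies in \<open>span B0\<close>, the
      added vectors get coefficient 0, so nothing has to be known of \<phi> on them.\<close>
    obtain B where B: "B0 \<subseteq> B" "B \<subseteq> B0 \<union> Basis" "independent B" "B0 \<union> Basis \<subseteq> span B"
      using maximal_independent_subset_extend[of B0 "B0 \<union> Basis"] B0(2) by auto
    have finB: "finite B" using B(3) independent_bound by blast
    have "span B = UNIV"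
      using B(4) by (metis Un_subset_iff span_Basis span_mono span_span top.extremum_unique)
    have "card B = CARD('d)"
      using basis_card_eq_dim[of B UNIV] B(3) \<open>span B = UNIV\<close> by simp
    then obtain e where e: "bij_betw e (UNIV :: 'd set) B"
      by (metis finB finite_class.finite_UNIV finite_same_card_bij)
    have spB0: "d \<in> span B0"
      using d B0(3) by (metis span_mono span_span subsetD)
    have finB0: "finite B0" using finB B(1) finite_subset by blast
    then obtain u where u: "d = (\<Sum>v\<in>B0. u v *\<^sub>R v)"
      using spB0 span_finite[OF finB0] by auto
    define A :: "real ^ 'd ^ 'd" where "A = (\<chi> i k. e k $ i)"
    define x where "x = (\<chi> k. if e k \<in> B0 then u (e k) else 0)"
    have dx: "d = (\<Sum>k\<in>UNIV. x $ k *\<^sub>R e k)"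
    proof -
      have "(\<Sum>k\<in>UNIV. x $ k *\<^sub>R e k) = (\<Sum>b\<in>B. (if b \<in> B0 then u b else 0) *\<^sub>R b)"
        unfolding x_def using sum.reindex_bij_betw[OF e, of "\<lambda>b. (if b \<in> B0 then u b else 0) *\<^sub>R b"] by simp
      also have "\<dots> = (\<Sum>b\<in>B. if b \<in> B0 then u b *\<^sub>R b else 0)"
        by (rule sum.cong) auto
      also have "\<dots> = d" unfolding u using finB B(1)
        by (simp add: sum.inter_restrict[symmetric] Int_absorb1)
      finally show ?thesis by simp
    qed
    have Ax: "A *v x = d"
      by (subst dx) (simp add: vec_eq_iff A_def matrix_vector_mult_def mult.commute)
    have colA: "column k A = e k" for k
      by (simp add: A_def column_def vec_eq_iff)
    have "columns A = B"
      using e unfolding columns_def colA bij_betw_def by auto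
    then have "det A \<noteq> 0"
      using \<open>span B = UNIV\<close> matrix_right_invertible_span_columns[of A] invertible_det_nz[of A]
        invertible_right_inverse[of A] by (simp add: span_vec_eq)
    have inB: "e k \<in> B" for k using e by (auto simp: bij_betw_def)
    have entB: "b $ i \<in> \<int> \<and> \<bar>b $ i\<bar> \<le> R" if "b \<in> B" for b i
    proof (cases "b \<in> B0")
      case True
      then have "b \<in> range int_vec" "norm b \<le> R" using B0(1) T R by auto
      then show ?thesis using component_le_norm_cart[of b i] by (auto simp: int_vec_def)
    next
      case False
      then have "b \<in> Basis" using that B(2) by auto
      then obtain j where "b = axis j 1" by (auto simp: Basis_vec_def)
      then show ?thesis using R(2) by (auto simp: axis_def)
    qed
    have "det A \<in> \<int>" by (rule det_Ints) (use entB inB in \<open>auto simp: A_def\<close>)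
    then have det1: "1 \<le> \<bar>det A\<bar>" using \<open>det A \<noteq> 0\<close> by (rule Ints_nonzero_abs_ge1)
    have xk: "\<bar>x $ k\<bar> \<le> fact CARD('d) * R ^ CARD('d)" for k
    proof -
      have "\<bar>x $ k\<bar> \<le> \<bar>x $ k\<bar> * \<bar>det A\<bar>" using det1 by (simp add: mult_le_cancel_left1)
      also have "\<dots> = \<bar>det (\<chi> i j. if j = k then d $ i else A $ i $ j)\<bar>"
        unfolding cramer_lemma[of k A x, unfolded Ax] by (rule abs_mult[symmetric])
      also have "\<dots> \<le> fact CARD('d) * R ^ CARD('d)"
      proof (rule abs_det_le)
        fix i j
        have "\<bar>d $ i\<bar> \<le> R" using component_le_norm_cart[of d i] d1 R(2) by linarith
        then show "\<bar>(\<chi> i j. if j = k then d $ i else A $ i $ j) $ i $ j\<bar> \<le> R"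
          using entB[OF inB] by (auto simp: A_def)
      qed
      finally show ?thesis .
    qed
    have "\<phi> d = (\<Sum>k\<in>UNIV. x $ k * \<phi> (e k))"
      by (subst dx) (simp add: linear_sum[OF \<phi>(1)] linear_cmul[OF \<phi>(1)])
    also have "\<bar>\<dots>\<bar> \<le> (\<Sum>k\<in>UNIV. \<bar>x $ k * \<phi> (e k)\<bar>)" by (rule sum_abs)
    also have "\<dots> \<le> (\<Sum>k\<in>(UNIV::'d set). fact CARD('d) * R ^ CARD('d) * E)"
    proof (rule sum_mono)
      fix k
      show "\<bar>x $ k * \<phi> (e k)\<bar> \<le> fact CARD('d) * R ^ CARD('d) * E"
      proof (cases "e k \<in> B0")
        case True
        then show ?thesis unfolding abs_mult
          by (intro mult_mono xk) (use \<phi> B0 R in auto)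
      next
        case False
        then show ?thesis using \<phi>(3) R(2) by (simp add: x_def)
      qed
    qed
    finally show ?thesis by simp
  qed
  show ?thesis
  proof (cases "d = 0")
    case True
    then show ?thesis using linear_0[OF \<phi>(1)] by simp
  next
    case False
    have "\<bar>\<phi> ((1 / norm d) *\<^sub>R d)\<bar> \<le> real CARD('d) * fact CARD('d) * R ^ CARD('d) * E"
      by (rule unit) (use d False in \<open>auto intro: span_scale\<close>)
    then show ?thesis using False
      by (simp add: linear_cmul[OF \<phi>(1)] abs_mult field_simps)
  qed
qed

text \<open>For \<open>W = dual_matrix v\<close> these are the eigenvalues of minus the lattice
  Laplacian, see \<open>lattice_laplacian_ech\<close>.\<close>

definition eig :: "real ^ 'd::finite ^ 'd \<Rightarrow> int ^ 'd \<Rightarrow> real" where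
  "eig W j = (norm (W *v int_vec j))\<^sup>2"

text \<open>Injectivity is what makes a length bound possible, since a revisited point would permit
  endless chains. The number \<open>n\<close> counts steps, not points.\<close>

definition res_chain :: "real ^ 'd::finite ^ 'd \<Rightarrow> real \<Rightarrow> nat \<Rightarrow> (nat \<Rightarrow> int ^ 'd) \<Rightarrow> bool" where
  "res_chain W L n f \<longleftrightarrow> inj_on f {..n} \<and>
     (\<forall>i<n. norm (int_vec (f (Suc i)) - int_vec (f i)) \<le> L \<and> \<bar>eig W (f (Suc i)) - eig W (f i)\<bar> \<le> L)"

lemma int_vec_diff: "int_vec (a - b) = int_vec a - int_vec b"
  by (simp add: int_vec_def vec_eq_iff)

lemma int_vec_add: "int_vec (a + b) = int_vec a + int_vec b"
  by (simp add: int_vec_def vec_eq_iff)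

lemma int_vec_minus: "int_vec (- a) = - int_vec a"
  by (simp add: int_vec_def vec_eq_iff)

lemma int_vec_zero [simp]: "int_vec 0 = 0"
  by (simp add: int_vec_def vec_eq_iff)

lemma inj_int_vec: "inj int_vec"
  by (auto simp: inj_on_def int_vec_def vec_eq_iff)

lemma int_ball_card:
  fixes S :: "(int ^ 'd::finite) set"
  assumes "\<And>j. j \<in> S \<Longrightarrow> norm (int_vec j) \<le> R" "0 \<le> R"
  shows "finite S" "real (card S) \<le> (2 * R + 1) ^ CARD('d)"
proof -
  define n where "n = \<lfloor>R\<rfloor>"
  have n: "0 \<le> n" "real_of_int n \<le> R" using assms(2) by (auto simp: n_def)
  have sub: "vec_nth ` S \<subseteq> (\<Pi>\<^sub>E i\<in>UNIV. {-n..n})"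
  proof clarify
    fix j assume "j \<in> S"
    then have "norm (int_vec j) \<le> R" using assms by blast
    then have "\<bar>real_of_int (j $ i)\<bar> \<le> R" for i
      using component_le_norm_cart[of "int_vec j" i] by (simp add: int_vec_def)
    then have "\<bar>j $ i\<bar> \<le> n" for i unfolding n_def by (metis le_floor_iff of_int_abs)
    then show "vec_nth j \<in> (\<Pi>\<^sub>E i\<in>UNIV. {-n..n})" by (auto simp: abs_le_iff minus_le_iff)
  qed
  have inj: "inj_on vec_nth S" by (auto simp: inj_on_def vec_eq_iff)
  have fin: "finite (\<Pi>\<^sub>E i\<in>(UNIV::'d set). {-n..n})" by (intro finite_PiE) auto
  then show "finite S" using sub inj by (meson finite_imageD finite_subset)
  have "card S \<le> card (\<Pi>\<^sub>E i\<in>(UNIV::'d set). {-n..n})"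
    using card_inj_on_le[OF inj sub fin] .
  also have "\<dots> = nat (2 * n + 1) ^ CARD('d)"
    using n by (simp add: card_PiE)
  finally have "real (card S) \<le> real (nat (2 * n + 1)) ^ CARD('d)"
    by (metis of_nat_le_iff of_nat_power)
  also have "\<dots> \<le> (2 * R + 1) ^ CARD('d)"
    by (rule power_mono) (use n in auto)
  finally show "real (card S) \<le> (2 * R + 1) ^ CARD('d)" .
qed

lemma res_chain_dist:
  assumes "res_chain W L n f" "q + i \<le> n"
  shows "norm (int_vec (f (q + i)) - int_vec (f q)) \<le> real i * L \<and> \<bar>eig W (f (q + i)) - eig W (f q)\<bar> \<le> real i * L"
  using assms(2)
proof (induction i)
  case 0
  then show ?case by simp
next
  case (Suc i)
  have s: "norm (int_vec (f (Suc (q + i))) - int_vec (f (q + i))) \<le> L"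
     "\<bar>eig W (f (Suc (q + i))) - eig W (f (q + i))\<bar> \<le> L"
    using assms(1) Suc.prems by (auto simp: res_chain_def)
  have "norm (int_vec (f (Suc (q + i))) - int_vec (f q)) \<le>
     norm (int_vec (f (Suc (q + i))) - int_vec (f (q + i))) + norm (int_vec (f (q + i)) - int_vec (f q))"
    by (metis diff_add_cancel add_diff_eq norm_triangle_ineq)
  moreover have "norm (int_vec (f (q + i)) - int_vec (f q)) \<le> real i * L"
     "\<bar>eig W (f (q + i)) - eig W (f q)\<bar> \<le> real i * L"
    using Suc by auto
  ultimately show ?case using s by (simp add: algebra_simps)
qed

lemma res_chain_sub:
  assumes "res_chain W L n f" "q + J \<le> n"
  shows "res_chain W L J (\<lambda>i. f (q + i))"
proof -
  have "inj_on (\<lambda>i. f (q + i)) {..J}"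
  proof (rule inj_onI)
    fix x y assume xy: "x \<in> {..J}" "y \<in> {..J}" "f (q + x) = f (q + y)"
    have "q + x = q + y"
      by (rule inj_onD[of f "{..n}"]) (use assms xy in \<open>auto simp: res_chain_def\<close>)
    then show "x = y" by simp
  qed
  then show ?thesis using assms unfolding res_chain_def by auto
qed

lemma eig_increment:
  "eig W b - eig W a = 2 * ((W *v int_vec a) \<bullet> (W *v (int_vec b - int_vec a))) + (norm (W *v (int_vec b - int_vec a)))\<^sup>2"
  unfolding eig_def matrix_vector_mult_diff_distrib power2_norm_eq_inner
  by (simp add: algebra_simps inner_commute)

text \<open>By \<open>eig_increment\<close>, a displacement \<open>e\<close> within the window along
  which \<open>eig\<close> changes little has a small inner product with \<open>f q\<close> after
  applying \<open>W\<close>; the quadratic remainder is at most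
  \<open>K\<^sup>2 * (J * L)\<^sup>2\<close>. So a linear functional is small on generators of the
  span, and \<open>integer_span_functional_bound\<close> extends this to the whole span at
  polynomial cost.\<close>

lemma window_functional_bound:
  fixes W :: "real ^ 'd::finite ^ 'd"
  assumes ch: "res_chain W L n f" and q: "q + J \<le> n" "1 \<le> J" and L: "1 \<le> L"
    and K: "1 \<le> K" "\<And>x. norm (W *v x) \<le> K * norm x"
    and d: "d \<in> span ((\<lambda>i. int_vec (f (q + i)) - int_vec (f q)) ` {..J})"
  shows "\<bar>(W *v int_vec (f q)) \<bullet> (W *v d)\<bar>
    \<le> real CARD('d) * fact CARD('d) * K\<^sup>2 * (real J * L) ^ (CARD('d) + 2) * norm d"
proof -
  let ?R = "real J * L"
  have R1: "1 \<le> ?R" using q L by (metis mult_mono' mult_1 of_nat_1 of_nat_le_iff zero_le_one order_trans)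
  have "\<bar>(W *v int_vec (f q)) \<bullet> (W *v d)\<bar> \<le> real CARD('d) * fact CARD('d) * ?R ^ CARD('d) * (K\<^sup>2 * ?R\<^sup>2) * norm d"
  proof (rule integer_span_functional_bound[OF _ _ R1 _ _ _ d])
    show "(\<lambda>i. int_vec (f (q + i)) - int_vec (f q)) ` {..J} \<subseteq> range int_vec"
      by (auto simp: int_vec_diff[symmetric])
    show "linear (\<lambda>d. (W *v int_vec (f q)) \<bullet> (W *v d))"
      by (rule linearI) (simp_all add: matrix_vector_right_distrib matrix_vector_mult_scaleR inner_add_right)
    show "0 \<le> K\<^sup>2 * ?R\<^sup>2" by simp
  next
    fix e assume "e \<in> (\<lambda>i. int_vec (f (q + i)) - int_vec (f q)) ` {..J}"
    then obtain i where i: "i \<le> J" "e = int_vec (f (q + i)) - int_vec (f q)" by auto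
    have iJ: "real i * L \<le> ?R" using i L by (intro mult_right_mono) auto
    have e: "norm e \<le> ?R" "\<bar>eig W (f (q + i)) - eig W (f q)\<bar> \<le> ?R"
      using res_chain_dist[OF ch, of q i] i q iJ by auto
    then show "norm e \<le> ?R" by blast
    have We: "(norm (W *v e))\<^sup>2 \<le> K\<^sup>2 * ?R\<^sup>2"
    proof -
      have "norm (W *v e) \<le> K * ?R" using K(2)[of e] e(1) K(1) by (meson mult_left_mono order_trans zero_le_one)
      then show ?thesis by (metis norm_ge_zero power_mono power_mult_distrib)
    qed
    have "?R \<le> ?R\<^sup>2" using R1 by (simp add: self_le_power)
    also have "\<dots> \<le> K\<^sup>2 * ?R\<^sup>2" using K(1) by (simp add: mult_le_cancel_right1)
    finally have RR: "?R \<le> K\<^sup>2 * ?R\<^sup>2" .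
    have "2 * ((W *v int_vec (f q)) \<bullet> (W *v e)) = eig W (f (q + i)) - eig W (f q) - (norm (W *v e))\<^sup>2"
      using eig_increment[of W "f (q + i)" "f q"] i by simp
    then show "\<bar>(W *v int_vec (f q)) \<bullet> (W *v e)\<bar> \<le> K\<^sup>2 * ?R\<^sup>2"
      using We e(2) RR zero_le_power2[of "norm (W *v e)"] unfolding abs_le_iff by linarith
  qed
  then show ?thesis by (simp add: power_add algebra_simps power2_eq_square)
qed

text \<open>If every window of length \<open>J\<close> spans the whole space of differences, then each difference
  \<open>d = f q - f 0\<close> is almost orthogonal to both \<open>f q\<close> and \<open>f 0\<close>, hence to itself.\<close>

lemma res_chain_length:
  fixes W :: "real ^ 'd::finite ^ 'd"
  assumes W: "invertible W"
  shows "\<exists>C a. 1 \<le> C \<and> (\<forall>L n f. 1 \<le> L \<longrightarrow> res_chain W L n f \<longrightarrow> real n \<le> C * L ^ a)"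
proof -
  let ?D = "CARD('d)"
  have lin: "linear ((*v) W)" by simp
  have "inj ((*v) W)" using W by (rule inj_matrix_vector_mult)
  then obtain c where c: "c > 0" "\<And>x. norm x * c \<le> norm (W *v x)"
    using linear_inj_bounded_below_pos[OF lin] by (metis mult.commute)
  obtain K0 where K0: "\<And>x. norm (W *v x) \<le> K0 * norm x"
    using linear_bounded[OF lin] by blast
  define K where "K = max 1 K0"
  have K: "1 \<le> K" "\<And>x. norm (W *v x) \<le> K * norm x"
    unfolding K_def using order_trans[OF K0 mult_right_mono[OF max.cobounded2[of K0 1] norm_ge_zero]]
    by auto
  \<comment> \<open>Induction on the rank of the differences along the chain. The bound for rank
    \<open>g\<close> fixes the window length that is used for rank \<open>g + 1\<close>.\<close>
  have "\<exists>C a. 1 \<le> C \<and> (\<forall>L n f. 1 \<le> L \<longrightarrow> res_chain W L n f \<longrightarrow>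
      dim ((\<lambda>q. int_vec (f q) - int_vec (f 0)) ` {..n}) \<le> g \<longrightarrow> real n \<le> C * L ^ a)" for g
  proof (induction g)
    case 0
    have "n = 0" if "res_chain W L n f" "dim ((\<lambda>q. int_vec (f q) - int_vec (f 0)) ` {..n}) = 0" for L n f
    proof (rule ccontr)
      assume "n \<noteq> 0"
      then have "int_vec (f 1) - int_vec (f 0) \<in> (\<lambda>q. int_vec (f q) - int_vec (f 0)) ` {..n}" by auto
      then have "int_vec (f 1) - int_vec (f 0) = 0"
        using that(2) by (metis (no_types, lifting) dim_eq_0 singletonD subsetD)
      then have "f 1 = f 0" using inj_int_vec by (auto dest: injD)
      then show False using that(1) \<open>n \<noteq> 0\<close> by (auto simp: res_chain_def inj_on_def)
    qed
    then show ?case by (intro exI[of _ 1] exI[of _ 0]) auto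
  next
    case (Suc g)
    then obtain C a where C: "1 \<le> C" and IH: "\<And>L n f. 1 \<le> L \<Longrightarrow> res_chain W L n f \<Longrightarrow>
      dim ((\<lambda>q. int_vec (f q) - int_vec (f 0)) ` {..n}) \<le> g \<Longrightarrow> real n \<le> C * L ^ a" by metis
    define B where "B = real ?D * fact ?D * K\<^sup>2"
    have B: "B \<ge> 0" by (simp add: B_def)
    \<comment> \<open>\<open>C1 * L ^ b\<close> will bound the distance of \<open>f q\<close> from
      \<open>f 0\<close>: it is \<open>2 * B / c\<^sup>2 * (J * L) ^ (?D + 2)\<close> with
      \<open>J\<close> replaced by its upper bound \<open>2 * C * L ^ a\<close>.\<close>
    define C1 where "C1 = 2 * B / c\<^sup>2 * (2 * C) ^ (?D + 2)"
    define b where "b = (a + 1) * (?D + 2)"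
    have C1: "C1 \<ge> 0" using B C by (simp add: C1_def)
    have main: "real n \<le> (2 * C + (2 * C1 + 1) ^ ?D) * L ^ (a + b * ?D)"
      if L: "1 \<le> L" and ch: "res_chain W L n f"
        and dm: "dim ((\<lambda>q. int_vec (f q) - int_vec (f 0)) ` {..n}) \<le> Suc g" for L n f
    proof -
      have Lp: "L ^ i \<le> L ^ j" if "i \<le> j" for i j using L that by (rule power_increasing[rotated])
      \<comment> \<open>Exceeds the bound for rank \<open>g\<close>, so that no window of this
        length has rank at most \<open>g\<close> and every window spans all differences.\<close>
      define J where "J = nat \<lfloor>C * L ^ a\<rfloor> + 1"
      have CL: "1 \<le> C * L ^ a" using C L by (metis mult_mono' mult_1 one_le_power zero_le_one)
      have J: "C * L ^ a < J" "real J \<le> 2 * C * L ^ a" "1 \<le> J"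
        using CL by (auto simp: J_def) linarith+
      have X: "L ^ a \<le> L ^ (a + b * ?D)" by (rule Lp) simp
      have Y: "(2 * C1 * L ^ b + 1) ^ ?D \<le> (2 * C1 + 1) ^ ?D * L ^ (a + b * ?D)"
      proof -
        have "(2 * C1 * L ^ b + 1) ^ ?D \<le> ((2 * C1 + 1) * L ^ b) ^ ?D"
          by (rule power_mono) (use C1 L in \<open>auto simp: algebra_simps\<close>)
        also have "\<dots> = (2 * C1 + 1) ^ ?D * L ^ (b * ?D)"
          by (simp add: power_mult_distrib power_mult)
        also have "\<dots> \<le> (2 * C1 + 1) ^ ?D * L ^ (a + b * ?D)"
          by (intro mult_left_mono Lp) (use C1 in auto)
        finally show ?thesis .
      qed
      show ?thesis
      proof (cases "n < J")
        case True
        then have "real n \<le> 2 * C * L ^ a" using J by linarith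
        also have "\<dots> \<le> 2 * C * L ^ (a + b * ?D)" using X C by (intro mult_left_mono) auto
        also have "\<dots> \<le> (2 * C + (2 * C1 + 1) ^ ?D) * L ^ (a + b * ?D)"
          using C1 L by (intro mult_right_mono) auto
        finally show ?thesis .
      next
        case False
        let ?S = "(\<lambda>q. int_vec (f q) - int_vec (f 0)) ` {..n}"
        let ?T = "\<lambda>q. (\<lambda>i. int_vec (f (q + i)) - int_vec (f q)) ` {..J}"
        have span: "span (?T q) = span ?S" if q: "q + J \<le> n" for q
        proof (rule subspace_dim_equal)
          have "int_vec (f (q + i)) - int_vec (f q) \<in> span ?S" if "i \<le> J" for i
          proof -
            have "int_vec (f (q + i)) - int_vec (f 0) - (int_vec (f q) - int_vec (f 0)) \<in> span ?S"
              by (rule span_diff; rule span_base) (use q that in auto)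
            then show ?thesis by simp
          qed
          then show "span (?T q) \<subseteq> span ?S" by (intro span_minimal) auto
          have "\<not> dim (?T q) \<le> g"
          proof
            assume "dim (?T q) \<le> g"
            then have "real J \<le> C * L ^ a" using IH[OF L res_chain_sub[OF ch q]] by simp
            then show False using J by simp
          qed
          then show "dim (span ?S) \<le> dim (span (?T q))" using dm by simp
        qed auto
        have dist: "norm (int_vec (f q - f 0)) \<le> C1 * L ^ b" if q: "q + J \<le> n" for q
        proof -
          define d where "d = int_vec (f q) - int_vec (f 0)"
          have dS: "d \<in> span ?S" unfolding d_def by (rule span_base) (use q in auto)
          have 1: "\<bar>(W *v int_vec (f q)) \<bullet> (W *v d)\<bar> \<le> B * (real J * L) ^ (?D + 2) * norm d"
            unfolding B_def by (rule window_functional_bound[OF ch q J(3) L K]) (use dS span[OF q] in auto)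
          have 2: "\<bar>(W *v int_vec (f 0)) \<bullet> (W *v d)\<bar> \<le> B * (real J * L) ^ (?D + 2) * norm d"
            unfolding B_def using window_functional_bound[OF ch, of 0 J K d] J(3) L K dS span[of 0] q by auto
          have "(norm d * c)\<^sup>2 \<le> (norm (W *v d))\<^sup>2" using c by (intro power_mono) auto
          also have "\<dots> = (W *v int_vec (f q)) \<bullet> (W *v d) - (W *v int_vec (f 0)) \<bullet> (W *v d)"
            unfolding power2_norm_eq_inner by (simp add: d_def matrix_vector_mult_diff_distrib inner_diff_left)
          also have "\<dots> \<le> 2 * (B * (real J * L) ^ (?D + 2)) * norm d" using 1 2 unfolding abs_le_iff by linarith
          finally have 3: "(norm d * c)\<^sup>2 \<le> 2 * (B * (real J * L) ^ (?D + 2)) * norm d" .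
          have "norm d \<le> 2 * B / c\<^sup>2 * (real J * L) ^ (?D + 2)"
          proof (cases "d = 0")
            case True
            then show ?thesis using B L by simp
          next
            case False
            then have "norm d * (norm d * c\<^sup>2) \<le> norm d * (2 * B * (real J * L) ^ (?D + 2))"
              using 3 by (simp add: power2_eq_square algebra_simps)
            then have "norm d * c\<^sup>2 \<le> 2 * B * (real J * L) ^ (?D + 2)"
              by (rule mult_left_le_imp_le) (use False in simp)
            then show ?thesis using c by (simp add: field_simps)
          qed
          also have "\<dots> \<le> 2 * B / c\<^sup>2 * (2 * C * L ^ a * L) ^ (?D + 2)"
            by (intro mult_left_mono power_mono mult_right_mono) (use J L B in auto)
          also have "\<dots> = C1 * L ^ b"
            by (simp add: C1_def b_def power_mult_distrib power_mult[symmetric] power_add[symmetric] algebra_simps)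
          finally show ?thesis by (simp add: d_def int_vec_diff)
        qed
        have injd: "inj_on (\<lambda>q. f q - f 0) {..n - J}"
          using ch unfolding res_chain_def inj_on_def by auto
        \<comment> \<open>The starting points of the windows are distinct lattice points in a ball
          of radius \<open>C1 * L ^ b\<close>, so counting lattice points bounds
          \<open>n - J\<close>.\<close>
        have "real (n - J + 1) = real (card ((\<lambda>q. f q - f 0) ` {..n - J}))"
          by (simp add: card_image[OF injd])
        also have "\<dots> \<le> (2 * (C1 * L ^ b) + 1) ^ ?D"
          by (rule int_ball_card(2)) (use dist False C1 L in auto)
        finally have "real n \<le> real J + (2 * C1 * L ^ b + 1) ^ ?D" using False by (simp add: mult.assoc)
        also have "\<dots> \<le> 2 * C * L ^ (a + b * ?D) + (2 * C1 + 1) ^ ?D * L ^ (a + b * ?D)"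
          using J(2) X Y C by (intro add_mono) (auto intro: order_trans mult_left_mono)
        finally show ?thesis by (simp add: algebra_simps)
      qed
    qed
    have "1 \<le> 2 * C + (2 * C1 + 1) ^ ?D" using C C1 by (simp add: add_increasing2)
    with main show ?case by blast
  qed
  then obtain C a where "1 \<le> C" "\<And>L n f. 1 \<le> L \<Longrightarrow> res_chain W L n f \<Longrightarrow>
      dim ((\<lambda>q. int_vec (f q) - int_vec (f 0)) ` {..n}) \<le> ?D \<Longrightarrow> real n \<le> C * L ^ a" by metis
  moreover have "dim ((\<lambda>q. int_vec (f q) - int_vec (f 0)) ` {..n}) \<le> ?D" for n and f :: "nat \<Rightarrow> int ^ 'd"
    by (metis DIM_cart DIM_real dim_subset_UNIV mult_1_right)
  ultimately show ?thesis by blast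
qed

text \<open>A path of least length visits no point twice, because a loop could be cut out.\<close>

lemma rtrancl_injective_path:
  assumes "(a, b) \<in> R\<^sup>*"
  shows "\<exists>n f. f 0 = a \<and> f n = b \<and> (\<forall>i<n. (f i, f (Suc i)) \<in> R) \<and> inj_on f {..n}"
proof -
  define n where "n = (LEAST n. (a, b) \<in> R ^^ n)"
  have ex: "\<exists>n. (a, b) \<in> R ^^ n" using assms by (rule rtrancl_imp_relpow)
  have n: "(a, b) \<in> R ^^ n" unfolding n_def using ex by (rule LeastI_ex)
  have min: "n \<le> m" if "(a, b) \<in> R ^^ m" for m unfolding n_def using that by (rule Least_le)
  obtain f where f: "f 0 = a" "f n = b" "\<forall>i<n. (f i, f (Suc i)) \<in> R"
    using n unfolding relpow_fun_conv by blast
  have no_loop: False if "x < y" "y \<le> n" "f x = f y" for x y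
  proof -
    have "(a, f x) \<in> R ^^ x"
      unfolding relpow_fun_conv by (rule exI[of _ f]) (use f that in auto)
    moreover have "(f y, b) \<in> R ^^ (n - y)"
      unfolding relpow_fun_conv by (rule exI[of _ "\<lambda>i. f (y + i)"]) (use f that in auto)
    ultimately have "(a, b) \<in> R ^^ (x + (n - y))"
      unfolding relpow_add using that(3) by auto
    from min[OF this] show False using that by simp
  qed
  have "inj_on f {..n}"
  proof (rule inj_onI)
    fix x y assume "x \<in> {..n}" "y \<in> {..n}" "f x = f y"
    then show "x = y" using no_loop[of x y] no_loop[of y x] by (cases x y rule: linorder_cases) auto
  qed
  with f show ?thesis by blast
qed

lemma resonance_free_region:
  fixes W :: "real ^ 'd::finite ^ 'd"
  assumes "invertible W"
  shows "\<exists>\<delta> M0. 0 < \<delta> \<and> 1 \<le> M0 \<and> (\<forall>M\<ge>M0. M powr \<delta> \<le> M / 4 \<and> (\<exists>A.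
     (\<forall>j. 7 / 4 * M \<le> norm (int_vec j) \<longrightarrow> j \<in> A) \<and>
     (\<forall>j\<in>A. 3 / 2 * M \<le> norm (int_vec j)) \<and>
     (\<forall>j\<in>A. \<forall>k. k \<notin> A \<longrightarrow> norm (int_vec j - int_vec k) \<le> M powr \<delta> \<longrightarrow>
         M powr \<delta> < \<bar>eig W j - eig W k\<bar>)))"
proof -
  obtain C a where C: "1 \<le> C" and chain: "\<And>L n f. 1 \<le> L \<Longrightarrow> res_chain W L n f \<Longrightarrow> real n \<le> C * L ^ a"
    using res_chain_length[OF assms] by metis
  \<comment> \<open>This choice makes \<open>L ^ (a + 1) = sqrt M\<close>, and \<open>M0\<close>
    ensures \<open>4 * C \<le> sqrt M\<close>. A whole chain then covers a distance of at most
    \<open>C * L ^ a * L \<le> M / 4\<close>.\<close>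
  define \<delta> where "\<delta> = 1 / (2 * (real a + 1))"
  define M0 where "M0 = 16 * C\<^sup>2"
  have d0: "0 < \<delta>" "\<delta> \<le> 1/2" by (auto simp: \<delta>_def field_simps)
  have M01: "1 \<le> M0" unfolding M0_def using one_le_power[OF C, of 2] by simp
  have "M powr \<delta> \<le> M / 4 \<and> (\<exists>A.
     (\<forall>j. 7 / 4 * M \<le> norm (int_vec j) \<longrightarrow> j \<in> A) \<and>
     (\<forall>j\<in>A. 3 / 2 * M \<le> norm (int_vec j)) \<and>
     (\<forall>j\<in>A. \<forall>k. k \<notin> A \<longrightarrow> norm (int_vec j - int_vec k) \<le> M powr \<delta> \<longrightarrow>
         M powr \<delta> < \<bar>eig W j - eig W k\<bar>))" if M: "M0 \<le> M" for M
  proof (intro conjI)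
    define L where "L = M powr \<delta>"
    have M1: "1 \<le> M" using M M01 by linarith
    have L1: "1 \<le> L" unfolding L_def using M1 d0 by (simp add: ge_one_powr_ge_zero)
    have LM: "C * L ^ (a + 1) \<le> M / 4"
    proof -
      have "L ^ (a + 1) = M powr (1/2)"
        proof -
        have e: "\<delta> * real (a + 1) = 1/2" by (simp add: \<delta>_def field_simps)
        have "L ^ (a + 1) = L powr real (a + 1)" using L1 by (intro powr_realpow[symmetric]) simp
        also have "\<dots> = M powr (\<delta> * real (a + 1))" unfolding L_def by (rule powr_powr)
        finally show ?thesis unfolding e .
      qed
      also have "\<dots> = sqrt M" using M1 by (simp add: powr_half_sqrt)
      finally have 1: "L ^ (a + 1) = sqrt M" .
      have "4 * C = sqrt (16 * C\<^sup>2)" using C by (simp add: real_sqrt_mult)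
      also have "\<dots> \<le> sqrt M" using M by (simp add: M0_def)
      finally have "4 * C * sqrt M \<le> sqrt M * sqrt M" by (rule mult_right_mono) (use M1 in simp)
      then show ?thesis using 1 M1 by simp
    qed
    have "L \<le> L ^ (a + 1)" using L1 by (simp add: self_le_power)
    also have "\<dots> \<le> C * L ^ (a + 1)" using C L1 by simp
    finally show "M powr \<delta> \<le> M / 4" using LM by (simp add: L_def)
    define R where "R = {(j, k). norm (int_vec k - int_vec j) \<le> L \<and> \<bar>eig W k - eig W j\<bar> \<le> L}"
    define A where "A = {k. \<exists>j. 7 / 4 * M \<le> norm (int_vec j) \<and> (j, k) \<in> R\<^sup>*}"
    show "\<exists>A. (\<forall>j. 7 / 4 * M \<le> norm (int_vec j) \<longrightarrow> j \<in> A) \<and>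
     (\<forall>j\<in>A. 3 / 2 * M \<le> norm (int_vec j)) \<and>
     (\<forall>j\<in>A. \<forall>k. k \<notin> A \<longrightarrow> norm (int_vec j - int_vec k) \<le> M powr \<delta> \<longrightarrow>
         M powr \<delta> < \<bar>eig W j - eig W k\<bar>)"
    proof (intro exI[of _ A] conjI allI impI ballI)
      fix j :: "int ^ 'd" assume "7 / 4 * M \<le> norm (int_vec j)"
      then show "j \<in> A" by (auto simp: A_def)
    next
      fix k assume "k \<in> A"
      then obtain j where j: "7 / 4 * M \<le> norm (int_vec j)" "(j, k) \<in> R\<^sup>*" by (auto simp: A_def)
      then obtain n f where f: "f 0 = j" "f n = k" "\<forall>i<n. (f i, f (Suc i)) \<in> R" "inj_on f {..n}"
        using rtrancl_injective_path by metis
      have ch: "res_chain W L n f" using f by (auto simp: res_chain_def R_def)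
      have "norm (int_vec k - int_vec j) \<le> real n * L"
        using res_chain_dist[OF ch, of 0 n] f by simp
      also have "\<dots> \<le> C * L ^ a * L" by (rule mult_right_mono) (use chain[OF L1 ch] L1 in auto)
      also have "\<dots> \<le> M / 4" using LM by (simp add: algebra_simps)
      finally have "norm (int_vec j - int_vec k) \<le> M / 4" by (simp add: norm_minus_commute)
      then show "3 / 2 * M \<le> norm (int_vec k)"
        using j(1) norm_triangle_ineq2[of "int_vec j" "int_vec k"] by linarith
    next
      fix j k assume *: "j \<in> A" "k \<notin> A" "norm (int_vec j - int_vec k) \<le> M powr \<delta>"
      then have "(j, k) \<notin> R" by (auto simp: A_def intro: rtrancl_into_rtrancl)
      then show "M powr \<delta> < \<bar>eig W j - eig W k\<bar>"
        using *(3) by (auto simp: R_def L_def[symmetric] norm_minus_commute abs_minus_commute)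
    qed
  qed
  with d0 M01 show ?thesis by blast
qed

section \<open>The Riccati equation of an invariant graph\<close>

definition mmul :: "('p \<Rightarrow> 'i set) \<Rightarrow> ('p \<Rightarrow> real \<Rightarrow> 'i \<Rightarrow> 'i \<Rightarrow> complex) \<Rightarrow> ('p \<Rightarrow> real \<Rightarrow> 'i \<Rightarrow> 'i \<Rightarrow> complex)
    \<Rightarrow> 'p \<Rightarrow> real \<Rightarrow> 'i \<Rightarrow> 'i \<Rightarrow> complex" where
  "mmul F X Y p t j k = (\<Sum>i\<in>F p. X p t j i * Y p t i k)"

definition dmat :: "('p \<Rightarrow> real \<Rightarrow> 'i \<Rightarrow> 'i \<Rightarrow> complex) \<Rightarrow> 'p \<Rightarrow> real \<Rightarrow> 'i \<Rightarrow> 'i \<Rightarrow> complex" where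
  "dmat X p t j k = vector_derivative (\<lambda>s. X p s j k) (at t)"

text \<open>A symbol calculus: \<open>p\<close> is the frequency scale, \<open>lam p\<close> the size of the spectral gap at that
  scale, and \<open>smb n X\<close> says that all time derivatives of \<open>X\<close> are \<open>O(lam\<^sup>-\<^sup>n)\<close> in the row-sum norm.\<close>

locale scales =
  fixes F :: "'p \<Rightarrow> 'i set" and lam :: "'p \<Rightarrow> real"
  assumes finF [simp]: "\<And>p. finite (F p)" and lam1: "\<And>p. 1 \<le> lam p"
begin

text \<open>\<open>bnd l n\<close> controls the derivatives of orders 0 to \<open>l\<close>. The
  derivative is existentially quantified instead of being \<open>dmat X\<close>, so that
  differentiability is a part of the predicate.\<close>

fun bnd :: "nat \<Rightarrow> nat \<Rightarrow> ('p \<Rightarrow> real \<Rightarrow> 'i \<Rightarrow> 'i \<Rightarrow> complex) \<Rightarrow> bool" where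
  "bnd 0 n X \<longleftrightarrow> (\<exists>C\<ge>0. \<forall>p t j. (\<Sum>k\<in>F p. cmod (X p t j k)) \<le> C / lam p ^ n)"
| "bnd (Suc l) n X \<longleftrightarrow> bnd 0 n X \<and>
     (\<exists>X'. (\<forall>p t j k. ((\<lambda>s. X p s j k) has_vector_derivative X' p t j k) (at t)) \<and> bnd l n X')"

definition smb :: "nat \<Rightarrow> ('p \<Rightarrow> real \<Rightarrow> 'i \<Rightarrow> 'i \<Rightarrow> complex) \<Rightarrow> bool" where
  "smb n X \<longleftrightarrow> (\<forall>l. bnd l n X)"

lemma lam_pos: "0 < lam p ^ n" using lam1[of p] by simp

lemma bnd_SucI:
  assumes "bnd 0 n X" "bnd l n X'" "\<And>p t j k. ((\<lambda>s. X p s j k) has_vector_derivative X' p t j k) (at t)"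
  shows "bnd (Suc l) n X"
proof -
  have "\<forall>p t j k. ((\<lambda>s. X p s j k) has_vector_derivative X' p t j k) (at t)"
    using assms(3) by (intro allI)
  with assms(1,2) show ?thesis unfolding bnd.simps(2) by (intro conjI exI[of _ X'])
qed

lemma bnd_SucD: "bnd (Suc l) n X \<Longrightarrow> bnd l n X"
proof (induction l arbitrary: X)
  case 0
  then show ?case by (simp del: bnd.simps add: bnd.simps(2))
next
  case (Suc l)
  then show ?case by (metis bnd.simps(2))
qed

lemma bnd_0I: "bnd l n X \<Longrightarrow> bnd 0 n X"
  by (cases l) auto

lemma bnd_add: "bnd l n X \<Longrightarrow> bnd l n Y \<Longrightarrow> bnd l n (\<lambda>p t j k. X p t j k + Y p t j k)"
proof (induction l arbitrary: X Y)
  case 0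
  obtain C1 where C1: "C1 \<ge> 0" "\<And>p t j. (\<Sum>k\<in>F p. cmod (X p t j k)) \<le> C1 / lam p ^ n" using 0(1) by auto
  obtain C2 where C2: "C2 \<ge> 0" "\<And>p t j. (\<Sum>k\<in>F p. cmod (Y p t j k)) \<le> C2 / lam p ^ n" using 0(2) by auto
  have "(\<Sum>k\<in>F p. cmod (X p t j k + Y p t j k)) \<le> (C1 + C2) / lam p ^ n" for p t j
  proof -
    have "(\<Sum>k\<in>F p. cmod (X p t j k + Y p t j k)) \<le> (\<Sum>k\<in>F p. cmod (X p t j k)) + (\<Sum>k\<in>F p. cmod (Y p t j k))"
      unfolding sum.distrib[symmetric] by (rule sum_mono) (rule norm_triangle_ineq)
    then show ?thesis using C1(2)[where p=p and t=t and j=j] C2(2)[where p=p and t=t and j=j] by (simp add: add_divide_distrib)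
  qed
  then show ?case using C1(1) C2(1) by (auto intro!: exI[of _ "C1 + C2"])
next
  case (Suc l)
  obtain X' where X': "\<And>p t j k. ((\<lambda>s. X p s j k) has_vector_derivative X' p t j k) (at t)" "bnd l n X'"
    using Suc.prems(1) by auto
  obtain Y' where Y': "\<And>p t j k. ((\<lambda>s. Y p s j k) has_vector_derivative Y' p t j k) (at t)" "bnd l n Y'"
    using Suc.prems(2) by auto
  have "bnd 0 n (\<lambda>p t j k. X p t j k + Y p t j k)"
    by (rule bnd_0I, rule Suc.IH) (use Suc.prems bnd_SucD in blast)+
  moreover have "bnd l n (\<lambda>p t j k. X' p t j k + Y' p t j k)" by (rule Suc.IH[OF X'(2) Y'(2)])
  moreover have "((\<lambda>s. X p s j k + Y p s j k) has_vector_derivative X' p t j k + Y' p t j k) (at t)" for p t j k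
    by (intro has_vector_derivative_add X' Y')
  ultimately show ?case by (rule bnd_SucI)
qed

lemma bnd_mmul: "bnd l m X \<Longrightarrow> bnd l n Y \<Longrightarrow> bnd l (m + n) (mmul F X Y)"
proof (induction l arbitrary: X Y)
  case 0
  obtain C1 where C1: "C1 \<ge> 0" "\<And>p t j. (\<Sum>k\<in>F p. cmod (X p t j k)) \<le> C1 / lam p ^ m" using 0(1) by auto
  obtain C2 where C2: "C2 \<ge> 0" "\<And>p t j. (\<Sum>k\<in>F p. cmod (Y p t j k)) \<le> C2 / lam p ^ n" using 0(2) by auto
  have "(\<Sum>k\<in>F p. cmod (mmul F X Y p t j k)) \<le> (C1 * C2) / lam p ^ (m + n)" for p t j
  proof -
    have "(\<Sum>k\<in>F p. cmod (mmul F X Y p t j k)) \<le> (\<Sum>k\<in>F p. \<Sum>i\<in>F p. cmod (X p t j i) * cmod (Y p t i k))"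
      unfolding mmul_def by (rule sum_mono) (rule order_trans[OF norm_sum], simp add: norm_mult)
    also have "\<dots> = (\<Sum>i\<in>F p. cmod (X p t j i) * (\<Sum>k\<in>F p. cmod (Y p t i k)))"
      by (subst sum.swap) (simp add: sum_distrib_left)
    also have "\<dots> \<le> (\<Sum>i\<in>F p. cmod (X p t j i) * (C2 / lam p ^ n))"
      by (intro sum_mono mult_left_mono C2) auto
    also have "\<dots> \<le> C1 / lam p ^ m * (C2 / lam p ^ n)"
      unfolding sum_distrib_right[symmetric] by (intro mult_right_mono C1) (use C2 lam_pos[of p n] in auto)
    finally show ?thesis by (simp add: power_add)
  qed
  then show ?case using C1(1) C2(1) by (auto intro!: exI[of _ "C1 * C2"])
next
  case (Suc l)
  obtain X' where X': "\<And>p t j k. ((\<lambda>s. X p s j k) has_vector_derivative X' p t j k) (at t)" "bnd l m X'"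
    using Suc.prems(1) by auto
  obtain Y' where Y': "\<And>p t j k. ((\<lambda>s. Y p s j k) has_vector_derivative Y' p t j k) (at t)" "bnd l n Y'"
    using Suc.prems(2) by auto
  have "bnd 0 (m + n) (mmul F X Y)"
    by (rule bnd_0I, rule Suc.IH) (use Suc.prems bnd_SucD in blast)+
  moreover have "bnd l (m + n) (\<lambda>p t j k. mmul F X Y' p t j k + mmul F X' Y p t j k)"
    by (intro bnd_add Suc.IH) (use Suc.prems bnd_SucD X' Y' in blast)+
  moreover have "((\<lambda>s. mmul F X Y p s j k) has_vector_derivative mmul F X Y' p t j k + mmul F X' Y p t j k) (at t)" for p t j k
    unfolding mmul_def sum.distrib[symmetric]
    by (intro has_vector_derivative_sum has_vector_derivative_mult X' Y')
  ultimately show ?case by (rule bnd_SucI)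
qed

text \<open>Such entrywise weights cover the block cut-offs (\<open>m = 0\<close>) and the division
  by eigenvalue differences (\<open>m = 1\<close>). Being independent of time, they pass through the
  derivative.\<close>

lemma bnd_weight:
  assumes c: "\<And>p j k. cmod (c p j k) \<le> B / lam p ^ m" "0 \<le> B"
  shows "bnd l n X \<Longrightarrow> bnd l (n + m) (\<lambda>p t j k. c p j k * X p t j k)"
proof (induction l arbitrary: X)
  case 0
  obtain C1 where C1: "C1 \<ge> 0" "\<And>p t j. (\<Sum>k\<in>F p. cmod (X p t j k)) \<le> C1 / lam p ^ n" using 0(1) by auto
  have "(\<Sum>k\<in>F p. cmod (c p j k * X p t j k)) \<le> (B * C1) / lam p ^ (n + m)" for p t j
  proof -
    have "(\<Sum>k\<in>F p. cmod (c p j k * X p t j k)) \<le> (\<Sum>k\<in>F p. B / lam p ^ m * cmod (X p t j k))"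
      unfolding norm_mult by (intro sum_mono mult_right_mono c) auto
    also have "\<dots> \<le> B / lam p ^ m * (C1 / lam p ^ n)"
      unfolding sum_distrib_left[symmetric] by (intro mult_left_mono C1) (use c lam_pos[of p m] in auto)
    finally show ?thesis by (simp add: power_add mult.commute)
  qed
  then show ?case using C1(1) c by (auto intro!: exI[of _ "B * C1"])
next
  case (Suc l)
  obtain X' where X': "\<And>p t j k. ((\<lambda>s. X p s j k) has_vector_derivative X' p t j k) (at t)" "bnd l n X'"
    using Suc.prems(1) by auto
  have "bnd 0 (n + m) (\<lambda>p t j k. c p j k * X p t j k)"
    by (rule bnd_0I, rule Suc.IH) (use Suc.prems bnd_SucD in blast)
  moreover have "bnd l (n + m) (\<lambda>p t j k. c p j k * X' p t j k)"
    by (rule Suc.IH[OF X'(2)])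
  moreover have "((\<lambda>s. c p j k * X p s j k) has_vector_derivative c p j k * X' p t j k) (at t)" for p t j k
    using has_vector_derivative_mult[OF has_vector_derivative_const X'(1)] by simp
  ultimately show ?case by (rule bnd_SucI)
qed

lemma smb_add: "smb n X \<Longrightarrow> smb n Y \<Longrightarrow> smb n (\<lambda>p t j k. X p t j k + Y p t j k)"
  unfolding smb_def using bnd_add by blast

lemma smb_mmul: "smb m X \<Longrightarrow> smb n Y \<Longrightarrow> smb (m + n) (mmul F X Y)"
  unfolding smb_def using bnd_mmul by blast

lemma smb_weight:
  assumes "\<And>p j k. cmod (c p j k) \<le> B / lam p ^ m" "0 \<le> B" "smb n X"
  shows "smb (n + m) (\<lambda>p t j k. c p j k * X p t j k)"
  using assms(3) unfolding smb_def by (intro allI bnd_weight[where B = B] assms(1,2)) simp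

lemma smb_scale: "smb n X \<Longrightarrow> smb n (\<lambda>p t j k. c * X p t j k)"
  using smb_weight[of "\<lambda>_ _ _. c" "cmod c" 0 n X] by simp

lemma smb_diff: "smb n X \<Longrightarrow> smb n Y \<Longrightarrow> smb n (\<lambda>p t j k. X p t j k - Y p t j k)"
  using smb_add[of n X "\<lambda>p t j k. - 1 * Y p t j k"] smb_scale[of n Y "- 1"] by simp

lemma smb_zero: "smb n (\<lambda>p t j k. 0)"
proof -
  have "bnd l n (\<lambda>p t j k. 0)" for l
  proof (induction l)
    case (Suc l)
    then show ?case by (auto intro!: exI[of _ "\<lambda>p t j k. 0"] exI[of _ 0])
  qed auto
  then show ?thesis by (simp add: smb_def)
qed

lemma smb_mono:
  assumes "smb n X" "m \<le> n"
  shows "smb m X"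
proof -
  have "bnd l n X \<Longrightarrow> bnd l m X" for l X
  proof (induction l arbitrary: X)
    case 0
    then obtain C where C: "C \<ge> 0" "\<And>p t j. (\<Sum>k\<in>F p. cmod (X p t j k)) \<le> C / lam p ^ n" by auto
    have le: "C / lam p ^ n \<le> C / lam p ^ m" for p
      using C(1) lam1[of p] lam_pos[of p] assms(2) by (intro divide_left_mono power_increasing mult_pos_pos) auto
    then have "\<forall>p t j. (\<Sum>k\<in>F p. cmod (X p t j k)) \<le> C / lam p ^ m" by (intro allI order_trans[OF C(2) le])
    then show ?case using C(1) by auto
  next
    case (Suc l)
    obtain X' where X': "\<And>p t j k. ((\<lambda>s. X p s j k) has_vector_derivative X' p t j k) (at t)" "bnd l n X'"
      using Suc.prems by auto
    have "bnd 0 m X" by (rule bnd_0I, rule Suc.IH, rule bnd_SucD, rule Suc.prems)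
    then show ?case using Suc.IH[OF X'(2)] X'(1) by (rule bnd_SucI)
  qed
  then show ?thesis using assms(1) unfolding smb_def by blast
qed

lemma smb_has_deriv:
  assumes "smb n X"
  shows "((\<lambda>s. X p s j k) has_vector_derivative dmat X p t j k) (at t)"
proof -
  have "bnd (Suc 0) n X" using assms by (simp add: smb_def del: bnd.simps)
  then obtain X' where "((\<lambda>s. X p s j k) has_vector_derivative X' p t j k) (at t)"
    unfolding bnd.simps(2) by blast
  then show ?thesis unfolding dmat_def by (simp add: vector_derivative_at)
qed

text \<open>Differentiation in time costs no power of \<open>lam\<close>. For this reason
  \<open>\<i> * dmat G\<close> counts as a perturbation in the iteration, next to the
  potential.\<close>

lemma smb_dmat:
  assumes "smb n X"
  shows "smb n (dmat X)"
  unfolding smb_def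
proof
  fix l
  have "bnd (Suc l) n X" using assms by (simp add: smb_def del: bnd.simps)
  then obtain X' where X': "\<And>p t j k. ((\<lambda>s. X p s j k) has_vector_derivative X' p t j k) (at t)" "bnd l n X'"
    by auto
  have "dmat X = X'" by (intro ext) (simp add: dmat_def vector_derivative_at[OF X'(1)])
  then show "bnd l n (dmat X)" using X' by simp
qed

lemma smb_bound:
  assumes "smb n X"
  shows "\<exists>C\<ge>0. \<forall>p t j. (\<Sum>k\<in>F p. cmod (X p t j k)) \<le> C / lam p ^ n"
proof -
  have "bnd 0 n X" using assms unfolding smb_def by (rule spec)
  then show ?thesis unfolding bnd.simps(1) .
qed

end

lemma mmul_diff_left: "mmul F (\<lambda>p t j k. X p t j k - X' p t j k) Y p t j k = mmul F X Y p t j k - mmul F X' Y p t j k"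
  by (simp add: mmul_def left_diff_distrib sum_subtractf)

lemma mmul_diff_right: "mmul F X (\<lambda>p t j k. Y p t j k - Y' p t j k) p t j k = mmul F X Y p t j k - mmul F X Y' p t j k"
  by (simp add: mmul_def right_diff_distrib sum_subtractf)

lemma mmul_nonzeroE:
  assumes "mmul F X Y p t j k \<noteq> 0"
  obtains i where "X p t j i \<noteq> 0" "Y p t i k \<noteq> 0"
proof -
  have "\<exists>i\<in>F p. X p t j i * Y p t i k \<noteq> 0"
    using assms unfolding mmul_def by (metis (mono_tags, lifting) sum.neutral)
  then show ?thesis using that by auto
qed

definition blk :: "('p \<Rightarrow> 'i set) \<Rightarrow> ('p \<Rightarrow> 'i set) \<Rightarrow> ('p \<Rightarrow> real \<Rightarrow> 'i \<Rightarrow> 'i \<Rightarrow> complex) \<Rightarrow> 'p \<Rightarrow> real \<Rightarrow> 'i \<Rightarrow> 'i \<Rightarrow> complex" where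
  "blk P Q X p t j k = of_bool (j \<in> P p \<and> k \<in> Q p) * X p t j k"

text \<open>The graph of \<open>G\<close>, mapping the components outside \<open>A\<close> to those in \<open>A\<close>, is invariant under
  \<open>i d/dt - diag mu - V\<close> when \<open>G\<close> solves the Riccati equation
  \<open>i G' = [diag mu, G] + V11 G - G V22 + V12 - G V21 G\<close>. As the commutator with \<open>diag mu\<close> is
  divisible by the gap \<open>lam\<close>, the equation can be solved approximately by iteration.\<close>

locale riccati = scales F lam
  for F :: "'p \<Rightarrow> 'i set" and lam :: "'p \<Rightarrow> real" +
  fixes mu :: "'i \<Rightarrow> real" and A :: "'p \<Rightarrow> 'i set" and V :: "'p \<Rightarrow> real \<Rightarrow> 'i \<Rightarrow> 'i \<Rightarrow> complex"
    and dst :: "'i \<Rightarrow> 'i \<Rightarrow> real" and ell :: "'p \<Rightarrow> real"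
  assumes smbV: "smb 0 V"
    and suppV: "\<And>p t j k. V p t j k \<noteq> 0 \<Longrightarrow> j \<in> F p \<and> k \<in> F p \<and> dst j k \<le> ell p"
    and dst_tri: "\<And>i j k. dst i k \<le> dst i j + dst j k"
    and ell0: "\<And>p. 0 \<le> ell p"
begin

abbreviation mm (infixl "\<star>" 70) where "mm \<equiv> mmul F"

abbreviation "V11 \<equiv> blk A A V"
abbreviation "V12 \<equiv> blk A (\<lambda>p. - A p) V"
abbreviation "V21 \<equiv> blk (\<lambda>p. - A p) A V"
abbreviation "V22 \<equiv> blk (\<lambda>p. - A p) (\<lambda>p. - A p) V"

text \<open>The Riccati equation solved for its commutator term: it reads
  \<open>(mu j - mu k) * G j k = rhs G j k\<close>.\<close>

definition rhs where
  "rhs G p t j k = \<i> * dmat G p t j k - (V11 \<star> G) p t j k + (G \<star> V22) p t j k - V12 p t j k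
      + (G \<star> V21 \<star> G) p t j k"

text \<open>The inverse of the commutator with \<open>diag mu\<close> wherever the gap exceeds
  \<open>lam\<close>. The default 0 elsewhere makes it bounded on all matrices; under the gap
  hypothesis of \<open>Gs_commutator\<close> it does no harm, since the matrices in question vanish
  there.\<close>

definition adi where
  "adi X p t j k = (if lam p < \<bar>mu j - mu k\<bar> then 1 / of_real (mu j - mu k) else 0) * (X p t j k :: complex)"

primrec Gs where
  "Gs 0 = (\<lambda>p t j k. 0)"
| "Gs (Suc n) = adi (rhs (Gs n))"

lemma smb_blk: "smb n X \<Longrightarrow> smb n (blk P Q X)"
  unfolding blk_def
  using smb_weight[of "\<lambda>p j k. of_bool (j \<in> P p \<and> k \<in> Q p)" 1 0 n X] by simp

lemmas smb_V = smb_blk[OF smbV]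

lemma smb_mm: "smb 0 X \<Longrightarrow> smb n Y \<Longrightarrow> smb n (X \<star> Y)" "smb n X \<Longrightarrow> smb 0 Y \<Longrightarrow> smb n (X \<star> Y)"
  using smb_mmul[of 0 X n Y] smb_mmul[of n X 0 Y] by auto

lemma smb_rhs: "smb 0 G \<Longrightarrow> smb 0 (rhs G)"
  unfolding rhs_def by (intro smb_add smb_diff smb_scale smb_mm smb_V smb_dmat)

lemma smb_adi:
  assumes "smb n X"
  shows "smb (Suc n) (adi X)"
proof -
  have "cmod (if lam p < \<bar>mu j - mu k\<bar> then 1 / of_real (mu j - mu k) else 0) \<le> 1 / lam p ^ 1" for p j k
    using lam1[of p] by (auto simp: norm_divide divide_simps simp flip: of_real_diff)
  from smb_weight[OF this _ assms] show ?thesis unfolding adi_def by simp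
qed

lemma smb_Gs: "smb 0 (Gs n)"
  by (induction n) (auto intro: smb_zero smb_rhs smb_mono[OF smb_adi])

lemma smb_rhs_diff:
  assumes "smb 0 G" "smb 0 G'" "smb n (\<lambda>p t j k. G' p t j k - G p t j k)"
  shows "smb n (\<lambda>p t j k. rhs G' p t j k - rhs G p t j k)"
proof -
  define E where "E = (\<lambda>p t j k. G' p t j k - G p t j k)"
  have E: "smb n E" using assms(3) by (simp add: E_def)
  have dE: "dmat E p t j k = dmat G' p t j k - dmat G p t j k" for p t j k
    using has_vector_derivative_diff[OF smb_has_deriv[OF assms(2)] smb_has_deriv[OF assms(1)]]
    unfolding E_def dmat_def[of "\<lambda>p t j k. G' p t j k - G p t j k"] by (rule vector_derivative_at)
  \<comment> \<open>The quadratic term is split as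
    \<open>G' V21 G' - G V21 G = E V21 G' + G V21 E\<close>, so every summand contains the
    difference \<open>E\<close> exactly once.\<close>
  have eq: "rhs G' p t j k - rhs G p t j k = \<i> * dmat E p t j k - (V11 \<star> E) p t j k + (E \<star> V22) p t j k
      + ((E \<star> V21 \<star> G') p t j k + (G \<star> V21 \<star> E) p t j k)" for p t j k
  proof -
    have 1: "E \<star> V21 = (\<lambda>p t j k. (G' \<star> V21) p t j k - (G \<star> V21) p t j k)"
      by (intro ext) (simp add: E_def mmul_diff_left)
    show ?thesis unfolding 1 mmul_diff_left unfolding rhs_def dE unfolding E_def mmul_diff_left mmul_diff_right
      by (simp add: algebra_simps)
  qed
  show ?thesis unfolding eq
    by (intro smb_add smb_diff smb_scale smb_dmat E smb_mm(1)[OF smb_V E] smb_mm(2)[OF E smb_V]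
        smb_mm(2)[OF smb_mm(2)[OF E smb_V]] smb_mm(1)[OF smb_mm(1)[OF _ smb_V]] assms(1,2))
qed

text \<open>\<open>rhs\<close> preserves the order of a difference and \<open>adi\<close> raises it
  by one, so consecutive iterates come closer by one power of \<open>lam\<close> per round.\<close>

lemma smb_Gs_diff: "smb n (\<lambda>p t j k. Gs (Suc n) p t j k - Gs n p t j k)"
proof (induction n)
  case 0
  show ?case by (intro smb_diff smb_Gs)
next
  case (Suc n)
  have "smb (Suc n) (adi (\<lambda>p t j k. rhs (Gs (Suc n)) p t j k - rhs (Gs n) p t j k))"
    by (intro smb_adi smb_rhs_diff smb_Gs Suc)
  moreover have "(\<lambda>p t j k. Gs (Suc (Suc n)) p t j k - Gs (Suc n) p t j k) =
      adi (\<lambda>p t j k. rhs (Gs (Suc n)) p t j k - rhs (Gs n) p t j k)"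
    by (intro ext) (simp only: Gs.simps(2) adi_def right_diff_distrib)
  ultimately show ?case by simp
qed

text \<open>The quadratic term joins two ranges of \<open>G\<close> and one of \<open>V\<close>, so
  a range \<open>r\<close> becomes \<open>2 * r + ell p\<close>; this is the recursion of
  \<open>(2 ^ n - 1) * ell p\<close>. The two claims are proved together because the support of the
  next iterate is contained in that of \<open>rhs\<close>.\<close>

lemma Gs_supp:
  "Gs n p t j k \<noteq> 0 \<Longrightarrow> j \<in> A p \<and> k \<notin> A p \<and> j \<in> F p \<and> k \<in> F p \<and> dst j k \<le> (2 ^ n - 1) * ell p"
  and rhs_supp: "rhs (Gs n) p t j k \<noteq> 0 \<Longrightarrow> j \<in> A p \<and> k \<notin> A p \<and> j \<in> F p \<and> k \<in> F p \<and> dst j k \<le> (2 ^ Suc n - 1) * ell p"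
proof (induction n arbitrary: t j k)
  let ?S = "\<lambda>n j k. j \<in> A p \<and> k \<notin> A p \<and> j \<in> F p \<and> k \<in> F p \<and> dst j k \<le> (2 ^ n - 1) * ell p"
  have mono: "dst j k \<le> x * ell p \<Longrightarrow> x \<le> y \<Longrightarrow> dst j k \<le> y * ell p" for j k x y
    using ell0[of p] by (meson mult_right_mono order_trans)
  have step: "?S (Suc n) j k"
    if G: "\<And>t j k. Gs n p t j k \<noteq> 0 \<Longrightarrow> ?S n j k" and nz: "rhs (Gs n) p t j k \<noteq> 0" for n t j k
  proof -
    have one: "(1::real) \<le> 2 ^ n" by simp
    consider "dmat (Gs n) p t j k \<noteq> 0" | "(V11 \<star> Gs n) p t j k \<noteq> 0" | "(Gs n \<star> V22) p t j k \<noteq> 0"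
      | "V12 p t j k \<noteq> 0" | "(Gs n \<star> V21 \<star> Gs n) p t j k \<noteq> 0"
      using nz unfolding rhs_def by (metis add.right_neutral diff_zero mult_zero_right)
    then show ?thesis
    proof cases
      case 1
      \<comment> \<open>The derivative may be nonzero at a time where the entry itself is 0. Only an
        entry that vanishes at all times is excluded, hence the support bounds hold uniformly in
        \<open>t\<close>.\<close>
      have "\<exists>s. Gs n p s j k \<noteq> 0"
        using 1 by (rule contrapos_np) (simp add: dmat_def vector_derivative_const_at)
      then have "?S n j k" using G by blast
      then show ?thesis using mono[of j k "2 ^ n - 1" "2 ^ Suc n - 1"] one by simp
    next
      case 2
      then obtain i where i: "V11 p t j i \<noteq> 0" "Gs n p t i k \<noteq> 0"
        by (rule mmul_nonzeroE)
      then have v: "j \<in> A p" "V p t j i \<noteq> 0" by (auto simp: blk_def)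
      have "dst j k \<le> ell p + (2 ^ n - 1) * ell p"
        using dst_tri[of j k i] suppV[OF v(2)] G[OF i(2)] by simp
      then have "dst j k \<le> 2 ^ n * ell p" by (simp add: algebra_simps)
      then show ?thesis using v suppV[OF v(2)] G[OF i(2)] mono[of j k "2 ^ n" "2 ^ Suc n - 1"] one by simp
    next
      case 3
      then obtain i where i: "Gs n p t j i \<noteq> 0" "V22 p t i k \<noteq> 0"
        by (rule mmul_nonzeroE)
      then have v: "k \<notin> A p" "V p t i k \<noteq> 0" by (auto simp: blk_def)
      have "dst j k \<le> (2 ^ n - 1) * ell p + ell p"
        using dst_tri[of j k i] suppV[OF v(2)] G[OF i(1)] by simp
      then have "dst j k \<le> 2 ^ n * ell p" by (simp add: algebra_simps)
      then show ?thesis using v suppV[OF v(2)] G[OF i(1)] mono[of j k "2 ^ n" "2 ^ Suc n - 1"] one by simp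
    next
      case 4
      then have v: "j \<in> A p" "k \<notin> A p" "V p t j k \<noteq> 0" by (auto simp: blk_def)
      then show ?thesis using suppV[OF v(3)] mono[of j k "1" "2 ^ Suc n - 1"] one by simp
    next
      case 5
      then obtain i where i: "(Gs n \<star> V21) p t j i \<noteq> 0" "Gs n p t i k \<noteq> 0"
        by (rule mmul_nonzeroE)
      from i(1) obtain l where l: "Gs n p t j l \<noteq> 0" "V21 p t l i \<noteq> 0"
        by (rule mmul_nonzeroE)
      then have v: "V p t l i \<noteq> 0" by (auto simp: blk_def)
      have "dst j k \<le> (2 ^ n - 1) * ell p + (ell p + (2 ^ n - 1) * ell p)"
      proof -
        have "dst l i \<le> ell p" "dst i k \<le> (2 ^ n - 1) * ell p" "dst j l \<le> (2 ^ n - 1) * ell p"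
          using suppV[OF v] G[OF i(2)] G[OF l(1)] by blast+
        then show ?thesis using dst_tri[of j k l] dst_tri[of l k i] by linarith
      qed
      then have "dst j k \<le> (2 ^ Suc n - 1) * ell p" by (simp add: algebra_simps)
      then show ?thesis using G[OF i(2)] G[OF l(1)] by simp
    qed
  qed
  {
    case 0
    {
      case 1
      then show ?case by simp
    next
      case 2
      then show ?case using step[of 0 t j k] by simp
    }
  next
    case (Suc n)
    have G: "Gs (Suc n) p t j k \<noteq> 0 \<Longrightarrow> ?S (Suc n) j k" for t j k
      using Suc(2)[of t j k] by (auto simp: adi_def simp del: power_Suc)
    {
      case 1
      then show ?case using G by blast
    next
      case 2
      then show ?case using step[of "Suc n" t j k] G by blast
    }
  }
qed

lemma Gs_commutator:
  assumes gap: "\<And>j k. j \<in> A p \<Longrightarrow> k \<notin> A p \<Longrightarrow> dst j k \<le> 2 ^ N * ell p \<Longrightarrow> lam p < \<bar>mu j - mu k\<bar>"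
    and n: "Suc n \<le> N"
  shows "of_real (mu j - mu k) * Gs (Suc n) p t j k = rhs (Gs n) p t j k"
proof (cases "rhs (Gs n) p t j k = 0")
  case True
  then show ?thesis by (simp add: adi_def)
next
  case False
  have "(2 ^ Suc n - 1) * ell p \<le> 2 ^ N * ell p"
    using ell0[of p] power_increasing[OF n, of "2::real"] by (intro mult_right_mono) auto
  then have g: "lam p < \<bar>mu j - mu k\<bar>" using gap rhs_supp[OF False] by force
  then have "mu j - mu k \<noteq> 0" using lam1[of p] by auto
  then show ?thesis using g by (simp add: adi_def flip: of_real_diff)
qed

text \<open>The iterate \<open>Gs (Suc n)\<close> inverts the commutator with right side
  \<open>rhs (Gs n)\<close> instead of \<open>rhs (Gs (Suc n))\<close>. Its defect in the Riccati
  equation is therefore this difference.\<close>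

definition Res where "Res n p t j k = rhs (Gs (Suc n)) p t j k - rhs (Gs n) p t j k"

lemma smb_Res: "smb n (Res n)"
  unfolding Res_def[abs_def] by (intro smb_rhs_diff smb_Gs smb_Gs_diff)

lemma Gs_riccati:
  assumes "\<And>j k. j \<in> A p \<Longrightarrow> k \<notin> A p \<Longrightarrow> dst j k \<le> 2 ^ N * ell p \<Longrightarrow> lam p < \<bar>mu j - mu k\<bar>"
    and "Suc n \<le> N"
  shows "\<i> * dmat (Gs (Suc n)) p t j k = of_real (mu j - mu k) * Gs (Suc n) p t j k
     + (V11 \<star> Gs (Suc n)) p t j k - (Gs (Suc n) \<star> V22) p t j k + V12 p t j k
     - (Gs (Suc n) \<star> V21 \<star> Gs (Suc n)) p t j k + Res n p t j k"
  using Gs_commutator[OF assms, where t = t and j = j and k = k]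
  unfolding Res_def rhs_def[of "Gs (Suc n)"] by (simp add: algebra_simps del: Gs.simps)

end

section \<open>Approximate solutions and comparison in energy\<close>

lemma vector_derivative_increment_bound:
  fixes f :: "real \<Rightarrow> 'a::real_normed_vector"
  assumes f: "\<And>t. t \<in> {0..T} \<Longrightarrow> (f has_vector_derivative f' t) (at t within {0..T})"
    and B: "\<And>t. t \<in> {0..T} \<Longrightarrow> norm (f' t) \<le> B" and s: "s \<in> {0..T}"
  shows "norm (f s - f 0) \<le> B * s"
proof -
  have "norm (f s - f 0) \<le> B * norm (s - 0)"
  proof (rule differentiable_bound[of "{0..T}" f "\<lambda>t h. h *\<^sub>R f' t"])
    fix x assume x: "x \<in> {0..T}"
    show "(f has_derivative (\<lambda>h. h *\<^sub>R f' x)) (at x within {0..T})"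
      using f[OF x] by (simp add: has_vector_derivative_def)
    show "onorm (\<lambda>h. h *\<^sub>R f' x) \<le> B"
      by (rule onorm_le) (use mult_left_mono[OF B[OF x] abs_ge_zero] in \<open>simp add: mult.commute\<close>)
  qed (use s in auto)
  then show ?thesis using s by simp
qed

text \<open>The error of the \<open>n\<close>-th Picard iterate becomes arbitrarily small, so no limit is needed.\<close>

lemma approx_linear_ode:
  fixes a :: "'i \<Rightarrow> 'i \<Rightarrow> real \<Rightarrow> complex" and c :: "'i \<Rightarrow> complex"
  assumes F: "finite F" and T: "0 \<le> T" and \<eta>: "0 < \<eta>"
    and a: "\<And>j k. j \<in> F \<Longrightarrow> k \<in> F \<Longrightarrow> continuous_on {0..T} (a j k)"
  shows "\<exists>w w'. (\<forall>j\<in>F. w j 0 = c j) \<and> (\<forall>j\<in>F. \<forall>t\<in>{0..T}.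
      (w j has_vector_derivative w' j t) (at t within {0..T}) \<and>
      cmod (w' j t - (\<Sum>k\<in>F. a j k t * w k t)) \<le> \<eta>)"
proof -
  define P where "P = rec_nat (\<lambda>j t. c j) (\<lambda>n P j t. c j + integral {0..t} (\<lambda>s. \<Sum>k\<in>F. a j k s * P k s))"
  have P0: "P 0 j t = c j" for j t by (simp add: P_def)
  have PS: "P (Suc n) j t = c j + integral {0..t} (\<lambda>s. \<Sum>k\<in>F. a j k s * P n k s)" for n j t
    by (simp add: P_def)
  have cont: "j \<in> F \<Longrightarrow> continuous_on {0..T} (P n j)" for n j
  proof (induction n arbitrary: j)
    case 0
    then show ?case by (simp add: P0[abs_def])
  next
    case (Suc n)
    have "continuous_on {0..T} (\<lambda>s. \<Sum>k\<in>F. a j k s * P n k s)"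
      by (intro continuous_intros Suc a)
    then show ?case unfolding PS[abs_def]
      by (intro continuous_on_add continuous_on_const indefinite_integral_continuous_1 integrable_continuous_real)
  qed
  have contS: "j \<in> F \<Longrightarrow> continuous_on {0..T} (\<lambda>s. \<Sum>k\<in>F. a j k s * P n k s)" for n j
    by (intro continuous_intros cont a)
  have deriv: "(P (Suc n) j has_vector_derivative (\<Sum>k\<in>F. a j k t * P n k t)) (at t within {0..T})"
    if "j \<in> F" "t \<in> {0..T}" for n j t
  proof -
    have "((\<lambda>t. integral {0..t} (\<lambda>s. \<Sum>k\<in>F. a j k s * P n k s)) has_vector_derivative
        (\<Sum>k\<in>F. a j k t * P n k t)) (at t within {0..T})"
      by (rule integral_has_vector_derivative[OF contS[OF that(1)] that(2)])
    from has_vector_derivative_add[OF has_vector_derivative_const[of "c j"] this]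
    show ?thesis unfolding PS[abs_def] by simp
  qed
  have "\<exists>K. \<forall>j\<in>F. \<forall>k\<in>F. \<forall>t\<in>{0..T}. cmod (a j k t) \<le> K"
  proof -
    have "\<exists>K. \<forall>t\<in>{0..T}. cmod (a j k t) \<le> K" if "j \<in> F" "k \<in> F" for j k
      using compact_imp_bounded[OF compact_continuous_image[OF a[OF that] compact_Icc]]
      by (auto simp: bounded_iff)
    then obtain K where K: "\<And>j k t. j \<in> F \<Longrightarrow> k \<in> F \<Longrightarrow> t \<in> {0..T} \<Longrightarrow> cmod (a j k t) \<le> K j k" by metis
    have "cmod (a j k t) \<le> (\<Sum>j\<in>F. \<Sum>k\<in>F. \<bar>K j k\<bar>)" if "j \<in> F" "k \<in> F" "t \<in> {0..T}" for j k t
    proof -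
      have "cmod (a j k t) \<le> \<bar>K j k\<bar>" using K[OF that] by linarith
      also have "\<dots> \<le> (\<Sum>k\<in>F. \<bar>K j k\<bar>)" by (rule member_le_sum) (use that F in auto)
      also have "\<dots> \<le> (\<Sum>j\<in>F. \<Sum>k\<in>F. \<bar>K j k\<bar>)"
        by (rule member_le_sum[of j F "\<lambda>j. \<Sum>k\<in>F. \<bar>K j k\<bar>"]) (use that F in \<open>auto intro: sum_nonneg\<close>)
      finally show ?thesis .
    qed
    then show ?thesis by blast
  qed
  then obtain K0 where K0: "\<And>j k t. j \<in> F \<Longrightarrow> k \<in> F \<Longrightarrow> t \<in> {0..T} \<Longrightarrow> cmod (a j k t) \<le> K0" by metis
  define K where "K = real (card F) * \<bar>K0\<bar> + 1"
  have K: "0 < K" by (simp add: K_def add_nonneg_pos)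
  have asum: "cmod (\<Sum>k\<in>F. a j k t * x k) \<le> K * B"
    if "j \<in> F" "t \<in> {0..T}" and x: "\<And>k. k \<in> F \<Longrightarrow> cmod (x k) \<le> B" and B: "0 \<le> B" for j t x B
  proof -
    have "cmod (\<Sum>k\<in>F. a j k t * x k) \<le> (\<Sum>k\<in>F. \<bar>K0\<bar> * B)"
      by (rule order_trans[OF norm_sum sum_mono], unfold norm_mult, rule mult_mono)
        (use x B that order_trans[OF K0 abs_ge_self] in auto)
    also have "\<dots> \<le> K * B" using B by (simp add: K_def algebra_simps)
    finally show ?thesis .
  qed
  define c0 where "c0 = (\<Sum>k\<in>F. cmod (c k))"
  have c0: "0 \<le> c0" "\<And>k. k \<in> F \<Longrightarrow> cmod (c k) \<le> c0"
    using F by (auto simp: c0_def intro: sum_nonneg member_le_sum)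
  define B0 where "B0 = K * c0 * T"
  have B0: "0 \<le> B0" using K c0 T by (simp add: B0_def)
  \<comment> \<open>The weight \<open>exp (2 * K * s)\<close> makes each integration against
    \<open>K\<close> gain a factor 1/2, so the iterates converge geometrically on all of
    \<open>{0..T}\<close>, however large \<open>K * T\<close> is.\<close>
  have intexp: "((\<lambda>s. K * (B0 * (1/2) ^ n * exp (2 * K * s))) has_integral
      (B0 * (1/2) ^ Suc n * exp (2 * K * t) - B0 * (1/2) ^ Suc n * exp (2 * K * 0))) {0..t}" if "0 \<le> t" for n t
    by (rule fundamental_theorem_of_calculus[OF that])
      (auto intro!: derivative_eq_intros simp: has_real_derivative_iff_has_vector_derivative[symmetric])
  have diff: "j \<in> F \<Longrightarrow> t \<in> {0..T} \<Longrightarrow> cmod (P (Suc n) j t - P n j t) \<le> B0 * (1/2) ^ n * exp (2 * K * t)" for n j t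
  proof (induction n arbitrary: j t)
    case 0
    have "cmod (P (Suc 0) j t - P (Suc 0) j 0) \<le> K * c0 * t"
      by (rule vector_derivative_increment_bound[OF deriv[OF 0(1)] _ 0(2)])
        (auto intro!: asum 0 c0 simp: P0)
    also have "\<dots> \<le> B0" unfolding B0_def using 0 K c0 by (intro mult_left_mono) auto
    also have "\<dots> \<le> B0 * exp (2 * K * t)" using 0 K B0 by (simp add: mult_le_cancel_left1)
    finally show ?case by (simp add: PS[of 0 j 0] P0)
  next
    case (Suc n)
    have sub: "{0..t} \<subseteq> {0..T}" using Suc.prems by auto
    have i1: "(\<lambda>s. \<Sum>k\<in>F. a j k s * P m k s) integrable_on {0..t}" for m
      by (rule integrable_continuous_real, rule continuous_on_subset[OF contS sub], rule Suc.prems)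
    have "P (Suc (Suc n)) j t - P (Suc n) j t
        = integral {0..t} (\<lambda>s. \<Sum>k\<in>F. a j k s * (P (Suc n) k s - P n k s))"
      unfolding PS[of "Suc n"] PS[of n j] right_diff_distrib sum_subtractf
      by (subst integral_diff[OF i1 i1]) simp
    also have "cmod \<dots> \<le> integral {0..t} (\<lambda>s. K * (B0 * (1/2) ^ n * exp (2 * K * s)))"
    proof (rule integral_norm_bound_integral)
      show "(\<lambda>s. \<Sum>k\<in>F. a j k s * (P (Suc n) k s - P n k s)) integrable_on {0..t}"
        unfolding right_diff_distrib sum_subtractf by (intro integrable_diff i1)
      show "(\<lambda>s. K * (B0 * (1/2) ^ n * exp (2 * K * s))) integrable_on {0..t}"
        using intexp[of t n] Suc.prems by (auto simp: integrable_on_def)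
      show "\<And>s. s \<in> {0..t} \<Longrightarrow> cmod (\<Sum>k\<in>F. a j k s * (P (Suc n) k s - P n k s)) \<le> K * (B0 * (1/2) ^ n * exp (2 * K * s))"
        by (rule asum) (use Suc sub B0 in auto)
    qed
    also have "\<dots> = B0 * (1/2) ^ Suc n * exp (2 * K * t) - B0 * (1/2) ^ Suc n * exp (2 * K * 0)"
      by (rule integral_unique[OF intexp]) (use Suc.prems in auto)
    also have "\<dots> \<le> B0 * (1/2) ^ Suc n * exp (2 * K * t)" using B0 by simp
    finally show ?case .
  qed
  have "(\<lambda>n. K * (B0 * (1/2) ^ n * exp (2 * K * T))) \<longlonglongrightarrow> K * (B0 * 0 * exp (2 * K * T))"
    by (intro tendsto_intros LIMSEQ_realpow_zero) auto
  then have "eventually (\<lambda>n. K * (B0 * (1/2) ^ n * exp (2 * K * T)) < \<eta>) sequentially"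
    by (rule order_tendstoD) (use \<eta> in simp)
  then obtain n where n: "K * (B0 * (1/2) ^ n * exp (2 * K * T)) < \<eta>"
    by (auto simp: eventually_sequentially)
  show ?thesis
  \<comment> \<open>The derivative of an iterate is the linear field evaluated at the previous
    iterate, so the defect is the field applied to the difference of two consecutive
    iterates.\<close>
  proof (rule exI[of _ "P (Suc n)"], rule exI[of _ "\<lambda>j t. \<Sum>k\<in>F. a j k t * P n k t"], intro conjI ballI)
    fix j t assume j: "j \<in> F" and t: "t \<in> {0..T}"
    show "(P (Suc n) j has_vector_derivative (\<Sum>k\<in>F. a j k t * P n k t)) (at t within {0..T})"
      by (rule deriv[OF j t])
    have "(\<Sum>k\<in>F. a j k t * P n k t) - (\<Sum>k\<in>F. a j k t * P (Suc n) k t)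
       = - (\<Sum>k\<in>F. a j k t * (P (Suc n) k t - P n k t))"
      by (simp add: right_diff_distrib sum_subtractf)
    also have "cmod \<dots> \<le> K * (B0 * (1/2) ^ n * exp (2 * K * t))"
      unfolding norm_minus_cancel by (rule asum[OF j t diff]) (use t B0 in auto)
    also have "\<dots> \<le> K * (B0 * (1/2) ^ n * exp (2 * K * T))"
      using K B0 t by (intro mult_left_mono) auto
    finally show "cmod ((\<Sum>k\<in>F. a j k t * P n k t) - (\<Sum>k\<in>F. a j k t * P (Suc n) k t)) \<le> \<eta>"
      using n by simp
  qed (simp add: PS)
qed

lemma Im_hermitian_form_zero:
  assumes "\<And>j k. j \<in> F \<Longrightarrow> k \<in> F \<Longrightarrow> cnj (V j k) = V k j"
  shows "Im (\<Sum>j\<in>F. cnj (x j) * (\<Sum>k\<in>F. V j k * x k)) = 0"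
proof -
  let ?s = "\<Sum>j\<in>F. cnj (x j) * (\<Sum>k\<in>F. V j k * x k)"
  have "cnj ?s = (\<Sum>j\<in>F. \<Sum>k\<in>F. x j * (V k j * cnj (x k)))"
    using assms by (simp add: sum_distrib_left)
  also have "\<dots> = ?s"
    by (subst sum.swap) (simp add: sum_distrib_left mult_ac)
  finally show ?thesis by (metis Reals_cnj_iff complex_is_Real_iff)
qed

lemma hermitian_form_swap:
  assumes "\<And>j k. j \<in> F \<Longrightarrow> k \<in> F \<Longrightarrow> cnj (V j k) = V k j"
  shows "(\<Sum>j\<in>F. x j * cnj (\<Sum>k\<in>F. V j k * y k)) = (\<Sum>j\<in>F. cnj (y j) * (\<Sum>k\<in>F. V j k * x k))"
proof -
  have "(\<Sum>j\<in>F. x j * cnj (\<Sum>k\<in>F. V j k * y k)) = (\<Sum>j\<in>F. \<Sum>k\<in>F. x j * (V k j * cnj (y k)))"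
    using assms by (simp add: sum_distrib_left)
  also have "\<dots> = (\<Sum>j\<in>F. cnj (y j) * (\<Sum>k\<in>F. V j k * x k))"
    by (subst sum.swap) (simp add: sum_distrib_left mult_ac)
  finally show ?thesis .
qed

text \<open>Only \<rho> changes the mass, because \<open>V\<close> is Hermitian and
  \<open>mu\<close> is real. As \<rho> is bounded in terms of the mass itself, the estimate is made
  at a time of maximal mass, where smallness of \<open>T * card F * \<kappa>\<close> absorbs that
  term.\<close>

lemma approx_energy_bound:
  fixes \<phi> \<phi>' \<rho> :: "'i \<Rightarrow> real \<Rightarrow> complex"
  assumes F: "finite F" and T: "0 \<le> T"
    and d\<phi>: "\<And>j t. j \<in> F \<Longrightarrow> t \<in> {0..T} \<Longrightarrow> (\<phi> j has_vector_derivative \<phi>' j t) (at t within {0..T})"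
    and eq: "\<And>j t. j \<in> F \<Longrightarrow> t \<in> {0..T} \<Longrightarrow> \<i> * \<phi>' j t = of_real (mu j) * \<phi> j t + (\<Sum>k\<in>F. V t j k * \<phi> k t) + \<rho> j t"
    and herm: "\<And>t j k. cnj (V t j k) = V t k j"
    and \<rho>: "\<And>j t. j \<in> F \<Longrightarrow> t \<in> {0..T} \<Longrightarrow> cmod (\<rho> j t) \<le> \<kappa> * sqrt (\<Sum>k\<in>F. (cmod (\<phi> k t))\<^sup>2) + \<kappa> * m"
    and \<kappa>: "0 \<le> \<kappa>" "8 * T * real (card F) * \<kappa> \<le> 1" and m: "0 \<le> m" "(\<Sum>k\<in>F. (cmod (\<phi> k 0))\<^sup>2) \<le> m\<^sup>2"
    and t: "t \<in> {0..T}"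
  shows "sqrt (\<Sum>k\<in>F. (cmod (\<phi> k t))\<^sup>2) \<le> 2 * m"
    and "\<bar>(\<Sum>k\<in>F. (cmod (\<phi> k t))\<^sup>2) - (\<Sum>k\<in>F. (cmod (\<phi> k 0))\<^sup>2)\<bar> \<le> 12 * real (card F) * \<kappa> * m\<^sup>2 * T"
proof -
  let ?n = "real (card F)"
  define y where "y t = (\<Sum>k\<in>F. (cmod (\<phi> k t))\<^sup>2)" for t
  define y' where "y' t = 2 * Im (\<Sum>k\<in>F. cnj (\<phi> k t) * \<rho> k t)" for t
  have y0: "0 \<le> y t" for t by (simp add: y_def sum_nonneg)
  have le_y: "cmod (\<phi> j t) \<le> sqrt (y t)" if "j \<in> F" for j t
    by (rule real_le_rsqrt) (use member_le_sum[of j F "\<lambda>k. (cmod (\<phi> k t))\<^sup>2"] that F in \<open>simp add: y_def\<close>)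
  have dy: "(y has_vector_derivative y' t) (at t within {0..T})" if t: "t \<in> {0..T}" for t
  proof -
    have "((\<lambda>t. (cmod (\<phi> j t))\<^sup>2) has_vector_derivative 2 * Re (cnj (\<phi> j t) * \<phi>' j t)) (at t within {0..T})" if "j \<in> F" for j
    proof -
      have "((\<lambda>t. Re (\<phi> j t * cnj (\<phi> j t))) has_vector_derivative
          Re (\<phi> j t * cnj (\<phi>' j t) + \<phi>' j t * cnj (\<phi> j t))) (at t within {0..T})"
        by (intro bounded_linear.has_vector_derivative[OF bounded_linear_Re] has_vector_derivative_mult
            bounded_linear.has_vector_derivative[OF bounded_linear_cnj] d\<phi> that t)
      then show ?thesis by (simp add: complex_mult_cnj cmod_power2 algebra_simps)
    qed
    then have "(y has_vector_derivative (\<Sum>j\<in>F. 2 * Re (cnj (\<phi> j t) * \<phi>' j t))) (at t within {0..T})"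
      unfolding y_def[abs_def] by (intro has_vector_derivative_sum)
    also have "(\<Sum>j\<in>F. 2 * Re (cnj (\<phi> j t) * \<phi>' j t)) = (\<Sum>j\<in>F. 2 * Im (cnj (\<phi> j t) * (\<i> * \<phi>' j t)))"
      by (intro sum.cong refl) (simp add: algebra_simps)
    also have "\<dots> = 2 * Im (\<Sum>j\<in>F. cnj (\<phi> j t) * (of_real (mu j) * \<phi> j t + (\<Sum>k\<in>F. V t j k * \<phi> k t) + \<rho> j t))"
      using eq t by (simp add: sum_distrib_left)
    also have "\<dots> = 2 * Im ((\<Sum>j\<in>F. of_real (mu j) * (cnj (\<phi> j t) * \<phi> j t)) + (\<Sum>j\<in>F. cnj (\<phi> j t) * (\<Sum>k\<in>F. V t j k * \<phi> k t)) + (\<Sum>j\<in>F. cnj (\<phi> j t) * \<rho> j t))"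
      by (simp add: ring_distribs sum.distrib mult_ac)
    also have "\<dots> = y' t"
      using Im_hermitian_form_zero[of F "V t" "\<lambda>j. \<phi> j t"] herm
      by (simp add: y'_def)
    finally show ?thesis .
  qed
  have y'b: "\<bar>y' t\<bar> \<le> 2 * (?n * (sqrt (y t) * (\<kappa> * sqrt (y t) + \<kappa> * m)))" if t: "t \<in> {0..T}" for t
  proof -
    have "\<bar>y' t\<bar> \<le> 2 * cmod (\<Sum>k\<in>F. cnj (\<phi> k t) * \<rho> k t)"
      unfolding y'_def abs_mult by (intro mult_mono abs_Im_le_cmod) auto
    also have "cmod (\<Sum>k\<in>F. cnj (\<phi> k t) * \<rho> k t) \<le> (\<Sum>k\<in>F. sqrt (y t) * (\<kappa> * sqrt (y t) + \<kappa> * m))"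
      by (rule order_trans[OF norm_sum sum_mono], unfold norm_mult, rule mult_mono)
        (use le_y \<rho> t y0 in \<open>auto simp: y_def\<close>)
    finally show ?thesis by simp
  qed
  have "continuous_on {0..T} y"
    unfolding continuous_on_eq_continuous_within
    using dy has_vector_derivative_continuous by blast
  then obtain t0 where t0: "t0 \<in> {0..T}" "\<And>t. t \<in> {0..T} \<Longrightarrow> y t \<le> y t0"
    using continuous_attains_sup[of "{0..T}" y] T by auto
  have sq: "sqrt (y t) \<le> sqrt (y t0)" if "t \<in> {0..T}" for t using t0 that by simp
  have b1: "norm (y' t) \<le> 2 * (?n * (sqrt (y t0) * (\<kappa> * sqrt (y t0) + \<kappa> * m)))" if t: "t \<in> {0..T}" for t
    unfolding real_norm_def
    by (rule order_trans[OF y'b[OF t]], intro mult_left_mono mult_mono add_mono sq t) (use y0 \<kappa> m in auto)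
  define Y where "Y = y t0"
  have "norm (y t0 - y 0) \<le> 2 * (?n * (sqrt Y * (\<kappa> * sqrt Y + \<kappa> * m))) * t0"
    unfolding Y_def by (rule vector_derivative_increment_bound[OF dy b1 t0(1)])
  also have "\<dots> \<le> 2 * (?n * (sqrt Y * (\<kappa> * sqrt Y + \<kappa> * m))) * T"
    by (rule mult_left_mono) (use t0 y0 \<kappa> m in \<open>auto simp: Y_def\<close>)
  also have "\<dots> = 2 * T * ?n * \<kappa> * (Y + sqrt Y * m)"
    using y0[of t0] by (simp add: Y_def algebra_simps)
  also have "\<dots> \<le> 1/4 * (Y + sqrt Y * m)"
    by (rule mult_right_mono) (use \<kappa> y0 m in \<open>auto simp: Y_def\<close>)
  also have "sqrt Y * m \<le> Y + m\<^sup>2"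
  proof -
    have "0 \<le> (sqrt Y - m)\<^sup>2" by simp
    then have "2 * (sqrt Y * m) \<le> Y + m\<^sup>2"
      using y0[of t0] by (simp add: power2_diff Y_def)
    moreover have "0 \<le> Y + m\<^sup>2" using y0[of t0] by (simp add: Y_def)
    ultimately show ?thesis by linarith
  qed
  finally have "norm (y t0 - y 0) \<le> 1/4 * (Y + (Y + m\<^sup>2))" by simp
  then have "Y - y 0 \<le> 1/4 * (Y + (Y + m\<^sup>2))" unfolding Y_def real_norm_def by linarith
  moreover have "y 0 \<le> m\<^sup>2" using m by (simp add: y_def)
  moreover have "a \<le> 4 * M" if "a - c \<le> 1/4 * (a + (a + M))" "c \<le> M" "0 \<le> M" for a c M :: real
    using that by (simp add: field_simps)
  ultimately have "Y \<le> 4 * m\<^sup>2" by (meson zero_le_power2)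
  then have "Y \<le> (2 * m)\<^sup>2" by (simp add: power_mult_distrib)
  then have Y2: "sqrt Y \<le> 2 * m" using m by (simp add: real_le_lsqrt)
  then show "sqrt (\<Sum>k\<in>F. (cmod (\<phi> k t))\<^sup>2) \<le> 2 * m" using order_trans[OF sq[OF t, folded Y_def] Y2] by (simp add: y_def)
  \<comment> \<open>The constant arises from \<open>2 * (2 * m) * (3 * \<kappa> * m)\<close> once
    the root of the mass is known to be at most \<open>2 * m\<close>.\<close>
  have b2: "norm (y' t) \<le> 12 * ?n * \<kappa> * m\<^sup>2" if t: "t \<in> {0..T}" for t
  proof -
    have "norm (y' t) \<le> 2 * (?n * ((2 * m) * (\<kappa> * (2 * m) + \<kappa> * m)))"
      by (rule order_trans[OF b1[OF t]], intro mult_left_mono mult_mono add_mono Y2[unfolded Y_def])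
        (use y0 \<kappa> m in auto)
    then show ?thesis by (simp add: power2_eq_square algebra_simps)
  qed
  have "norm (y t - y 0) \<le> 12 * ?n * \<kappa> * m\<^sup>2 * t"
    by (rule vector_derivative_increment_bound[OF dy b2 t])
  also have "\<dots> \<le> 12 * ?n * \<kappa> * m\<^sup>2 * T"
    by (rule mult_left_mono) (use t \<kappa> m in auto)
  finally show "\<bar>(\<Sum>k\<in>F. (cmod (\<phi> k t))\<^sup>2) - (\<Sum>k\<in>F. (cmod (\<phi> k 0))\<^sup>2)\<bar> \<le> 12 * real (card F) * \<kappa> * m\<^sup>2 * T"
    by (simp add: y_def)
qed

text \<open>The estimate comes from expanding \<open>\<Sum>j. |b j - \<phi> j|\<^sup>2\<close> and differentiating only the pairing
  of \<open>b\<close> with \<open>\<phi>\<close>, which is a finite sum.\<close>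

lemma approx_solution_compare:
  fixes \<phi> \<phi>' \<rho> b b' S :: "'i \<Rightarrow> real \<Rightarrow> complex"
  assumes F: "finite F" and T: "0 \<le> T"
    and d\<phi>: "\<And>j t. j \<in> F \<Longrightarrow> t \<in> {0..T} \<Longrightarrow> (\<phi> j has_vector_derivative \<phi>' j t) (at t within {0..T})"
    and eq: "\<And>j t. j \<in> F \<Longrightarrow> t \<in> {0..T} \<Longrightarrow> \<i> * \<phi>' j t = of_real (mu j) * \<phi> j t + (\<Sum>k\<in>F. V t j k * \<phi> k t) + \<rho> j t"
    and herm: "\<And>t j k. cnj (V t j k) = V t k j"
    and \<rho>: "\<And>j t. j \<in> F \<Longrightarrow> t \<in> {0..T} \<Longrightarrow> cmod (\<rho> j t) \<le> \<kappa> * sqrt (\<Sum>k\<in>F. (cmod (\<phi> k t))\<^sup>2) + \<kappa> * m"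
    and \<kappa>: "0 \<le> \<kappa>" "8 * T * real (card F) * \<kappa> \<le> 1" and m: "0 \<le> m"
    and db: "\<And>j t. j \<in> F \<Longrightarrow> t \<in> {0..T} \<Longrightarrow> (b j has_vector_derivative b' j t) (at t within {0..T})"
    and eqb: "\<And>j t. j \<in> F \<Longrightarrow> t \<in> {0..T} \<Longrightarrow> \<i> * b' j t = of_real (mu j) * b j t + S j t"
    and S: "\<And>j t. j \<in> F \<Longrightarrow> t \<in> {0..T} \<Longrightarrow> \<phi> j t \<noteq> 0 \<Longrightarrow> cmod (S j t - (\<Sum>k\<in>F. V t j k * b k t)) \<le> \<tau> * m"
    and bm: "\<And>X t. finite X \<Longrightarrow> t \<in> {0..T} \<Longrightarrow> (\<Sum>k\<in>X. (cmod (b k t))\<^sup>2) \<le> m\<^sup>2"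
    and init: "\<And>j. j \<in> F \<Longrightarrow> \<phi> j 0 = 0 \<or> \<phi> j 0 = b j 0"
    and \<tau>: "0 \<le> \<tau>" and t: "t \<in> {0..T}"
    and Z: "finite Z" "\<And>j. j \<in> Z \<Longrightarrow> j \<in> F \<Longrightarrow> \<phi> j t = 0"
  shows "(\<Sum>j\<in>Z. (cmod (b j t))\<^sup>2) \<le> m\<^sup>2 - (\<Sum>k\<in>F. (cmod (\<phi> k 0))\<^sup>2) + T * real (card F) * (4 * \<tau> + 18 * \<kappa>) * m\<^sup>2"
proof -
  let ?n = "real (card F)"
  define q where "q = (\<Sum>k\<in>F. (cmod (\<phi> k 0))\<^sup>2)"
  have T0: "0 \<in> {0..T}" using T by simp
  have "q \<le> (\<Sum>k\<in>F. (cmod (b k 0))\<^sup>2)"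
    unfolding q_def by (rule sum_mono) (use init in fastforce)
  then have qm: "q \<le> m\<^sup>2" using bm[OF F T0] by linarith
  have \<phi>2: "sqrt (\<Sum>k\<in>F. (cmod (\<phi> k t))\<^sup>2) \<le> 2 * m" if "t \<in> {0..T}" for t
    by (rule approx_energy_bound(1)[OF F T d\<phi> eq herm \<rho> \<kappa> m _ that]) (use qm in \<open>auto simp: q_def\<close>)
  have \<phi>q: "\<bar>(\<Sum>k\<in>F. (cmod (\<phi> k t))\<^sup>2) - q\<bar> \<le> 12 * ?n * \<kappa> * m\<^sup>2 * T"
    unfolding q_def by (rule approx_energy_bound(2)[OF F T d\<phi> eq herm \<rho> \<kappa> m _ t]) (use qm in \<open>auto simp: q_def\<close>)
  have \<phi>m: "cmod (\<phi> j t) \<le> 2 * m" if "j \<in> F" "t \<in> {0..T}" for j t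
  proof -
    have "cmod (\<phi> j t) \<le> sqrt (\<Sum>k\<in>F. (cmod (\<phi> k t))\<^sup>2)"
      by (rule real_le_rsqrt) (use member_le_sum[of j F "\<lambda>k. (cmod (\<phi> k t))\<^sup>2"] that F in simp)
    then show ?thesis using \<phi>2[OF that(2)] by linarith
  qed
  have bbm: "cmod (b j t) \<le> m" if "t \<in> {0..T}" for j t
    using bm[of "{j}" t] that m by (simp add: power2_le_iff_abs_le)
  define z where "z t = (\<Sum>j\<in>F. b j t * cnj (\<phi> j t))" for t
  define z' where "z' t = (\<Sum>j\<in>F. b j t * cnj (\<phi>' j t) + b' j t * cnj (\<phi> j t))" for t
  have dz: "(z has_vector_derivative z' t) (at t within {0..T})" if "t \<in> {0..T}" for t
    unfolding z_def[abs_def] z'_def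
    by (intro has_vector_derivative_sum has_vector_derivative_mult
            bounded_linear.has_vector_derivative[OF bounded_linear_cnj] d\<phi> db that)
  have z'b: "norm (z' t) \<le> ?n * (2 * \<tau> + 3 * \<kappa>) * m\<^sup>2" if t: "t \<in> {0..T}" for t
  proof -
    have "\<i> * z' t = (\<Sum>j\<in>F. (\<i> * b' j t) * cnj (\<phi> j t) - b j t * cnj (\<i> * \<phi>' j t))"
      unfolding z'_def sum_distrib_left by (intro sum.cong) (auto simp: algebra_simps)
    also have "\<dots> = (\<Sum>j\<in>F. (S j t * cnj (\<phi> j t) - b j t * cnj (\<Sum>k\<in>F. V t j k * \<phi> k t)) - b j t * cnj (\<rho> j t))"
      by (intro sum.cong refl, subst eq, assumption, rule t, subst eqb, assumption, rule t) (simp add: algebra_simps del: cnj_sum)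
    also have "\<dots> = (\<Sum>j\<in>F. (S j t - (\<Sum>k\<in>F. V t j k * b k t)) * cnj (\<phi> j t)) - (\<Sum>j\<in>F. b j t * cnj (\<rho> j t))"
      unfolding sum_subtractf using hermitian_form_swap[of F "V t" "\<lambda>j. b j t" "\<lambda>j. \<phi> j t"] herm
      by (simp add: algebra_simps sum_subtractf del: cnj_sum)
    also have "cmod \<dots> \<le> (\<Sum>j\<in>F. (\<tau> * m) * (2 * m)) + (\<Sum>j\<in>F. m * (\<kappa> * (2 * m) + \<kappa> * m))"
    proof (rule order_trans[OF norm_triangle_ineq4 add_mono]; rule order_trans[OF norm_sum sum_mono])
      fix j assume j: "j \<in> F"
      show "cmod ((S j t - (\<Sum>k\<in>F. V t j k * b k t)) * cnj (\<phi> j t)) \<le> (\<tau> * m) * (2 * m)"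
      proof (cases "\<phi> j t = 0")
        case True
        then show ?thesis using \<tau> m by simp
      next
        case False
        show ?thesis unfolding norm_mult
          by (rule mult_mono) (use S[OF j t False] \<phi>m[OF j t] \<tau> m in auto)
      qed
      show "cmod (b j t * cnj (\<rho> j t)) \<le> m * (\<kappa> * (2 * m) + \<kappa> * m)"
      proof -
        have "cmod (\<rho> j t) \<le> \<kappa> * (2 * m) + \<kappa> * m"
          by (rule order_trans[OF \<rho>[OF j t]]) (use mult_left_mono[OF \<phi>2[OF t] \<kappa>(1)] in simp)
        then show ?thesis unfolding norm_mult complex_mod_cnj
          by (intro mult_mono bbm t) (use m in auto)
      qed
    qed
    finally have "norm (\<i> * z' t) \<le> ?n * (2 * \<tau> + 3 * \<kappa>) * m\<^sup>2"
      by (simp add: power2_eq_square algebra_simps)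
    then show ?thesis by (simp add: norm_mult)
  qed
  have "norm (z t - z 0) \<le> ?n * (2 * \<tau> + 3 * \<kappa>) * m\<^sup>2 * t"
    by (rule vector_derivative_increment_bound[OF dz z'b t])
  also have "\<dots> \<le> ?n * (2 * \<tau> + 3 * \<kappa>) * m\<^sup>2 * T"
    by (rule mult_left_mono) (use t \<kappa> \<tau> in auto)
  finally have "\<bar>Re (z t) - Re (z 0)\<bar> \<le> ?n * (2 * \<tau> + 3 * \<kappa>) * m\<^sup>2 * T"
    using abs_Re_le_cmod[of "z t - z 0"] by simp
  moreover have "Re (z 0) = q"
  proof -
    have "z 0 = (\<Sum>j\<in>F. of_real ((cmod (\<phi> j 0))\<^sup>2))"
      unfolding z_def
    proof (rule sum.cong[OF refl])
      fix j assume "j \<in> F"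
      then show "b j 0 * cnj (\<phi> j 0) = of_real ((cmod (\<phi> j 0))\<^sup>2)"
        using init[of j] complex_norm_square[of "b j 0"] by auto
    qed
    then show ?thesis by (simp add: q_def)
  qed
  ultimately have zq: "q - Re (z t) \<le> ?n * (2 * \<tau> + 3 * \<kappa>) * m\<^sup>2 * T" by linarith
  \<comment> \<open>\<phi> vanishes on \<open>Z\<close>, so the mass of \<open>b\<close> in
    \<open>Z\<close> is a part of the squared distance of \<open>b\<close> and \<phi>. That distance
    is at most \<open>m\<^sup>2 - 2 * q + q\<close> up to errors; twice the drift of
    \<open>z\<close> and the drift of the mass of \<phi> give
    \<open>4 * \<tau> + 6 * \<kappa> + 12 * \<kappa>\<close>.\<close>
  define \<phi>0 where "\<phi>0 j = (if j \<in> F then \<phi> j t else 0)" for j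
  have "(\<Sum>j\<in>Z. (cmod (b j t))\<^sup>2) = (\<Sum>j\<in>Z. (cmod (b j t - \<phi>0 j))\<^sup>2)"
    by (intro sum.cong) (use Z in \<open>auto simp: \<phi>0_def\<close>)
  also have "\<dots> \<le> (\<Sum>j\<in>Z \<union> F. (cmod (b j t - \<phi>0 j))\<^sup>2)"
    by (rule sum_mono2) (use Z F in auto)
  also have "\<dots> = (\<Sum>j\<in>Z \<union> F. (cmod (b j t))\<^sup>2) - 2 * (\<Sum>j\<in>Z \<union> F. Re (b j t * cnj (\<phi>0 j))) + (\<Sum>j\<in>Z \<union> F. (cmod (\<phi>0 j))\<^sup>2)"
    unfolding sum_distrib_left sum_subtractf[symmetric] sum.distrib[symmetric]
    by (intro sum.cong refl, unfold cmod_power2) (simp add: power2_eq_square algebra_simps)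
  also have "(\<Sum>j\<in>Z \<union> F. Re (b j t * cnj (\<phi>0 j))) = Re (z t)"
    unfolding z_def Re_sum using Z F
    by (intro sum.mono_neutral_cong_right) (auto simp: \<phi>0_def)
  also have "(\<Sum>j\<in>Z \<union> F. (cmod (\<phi>0 j))\<^sup>2) = (\<Sum>j\<in>F. (cmod (\<phi> j t))\<^sup>2)"
    using Z F by (intro sum.mono_neutral_cong_right) (auto simp: \<phi>0_def)
  also have "(\<Sum>j\<in>Z \<union> F. (cmod (b j t))\<^sup>2) \<le> m\<^sup>2" by (rule bm) (use Z F t in auto)
  finally show ?thesis using zq \<phi>q unfolding q_def[symmetric] abs_le_iff
    by (simp add: algebra_simps)
qed

context riccati
begin

lemma smb_cont:
  assumes "smb n X"
  shows "continuous_on S (\<lambda>t. X p t j k)"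
proof -
  have "isCont (\<lambda>t. X p t j k) t" for t
    by (rule has_vector_derivative_continuous[OF smb_has_deriv[OF assms]])
  then show ?thesis by (simp add: continuous_at_imp_continuous_on)
qed

lemma mmul_vec: "(\<Sum>k\<in>F p. (X \<star> Y) p t j k * x k) = (\<Sum>i\<in>F p. X p t j i * (\<Sum>k\<in>F p. Y p t i k * x k))"
  unfolding mmul_def sum_distrib_right sum_distrib_left by (subst sum.swap) (simp add: mult.assoc)

lemma mmul_assoc3: "(\<Sum>k\<in>F p. (X \<star> Y \<star> Z) p t j k * x k) = (\<Sum>i\<in>F p. X p t j i * (\<Sum>k\<in>F p. (Y \<star> Z) p t i k * x k))"
  by (simp add: mmul_vec)

text \<open>A reduced system is solved for the components \<open>x\<close> outside \<open>A\<close>,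
  and \<phi> is \<open>x + G x\<close>. Inserting this into the full equation, all terms cancel by
  the Riccati equation except \<open>Res\<close> applied to \<open>x\<close> and the defect
  \<open>e\<close> of the Picard iterate together with its image under \<open>G\<close>.\<close>

lemma approx_solution:
  assumes gap: "\<And>j k. j \<in> A p \<Longrightarrow> k \<notin> A p \<Longrightarrow> dst j k \<le> 2 ^ N * ell p \<Longrightarrow> lam p < \<bar>mu j - mu k\<bar>"
    and n: "Suc n \<le> N" and T: "0 \<le> T" and \<eta>: "0 < \<eta>"
    and c: "\<And>k. c k \<noteq> 0 \<Longrightarrow> k \<in> F p \<and> k \<notin> A p"
    and \<kappa>: "\<And>t j. (\<Sum>k\<in>F p. cmod (Res n p t j k)) \<le> \<kappa>"
    and g: "\<And>t j. (\<Sum>k\<in>F p. cmod (Gs (Suc n) p t j k)) \<le> g"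
  shows "\<exists>\<phi> \<phi>' \<rho>. (\<forall>j. \<forall>t\<in>{0..T}. (\<phi> j has_vector_derivative \<phi>' j t) (at t within {0..T}) \<and>
        \<i> * \<phi>' j t = of_real (mu j) * \<phi> j t + (\<Sum>k\<in>F p. V p t j k * \<phi> k t) + \<rho> j t \<and>
        cmod (\<rho> j t) \<le> \<kappa> * sqrt (\<Sum>k\<in>F p. (cmod (\<phi> k t))\<^sup>2) + (1 + g) * \<eta>) \<and>
      (\<forall>j t. \<phi> j t \<noteq> 0 \<longrightarrow> j \<in> F p \<and> (\<exists>k. k \<notin> A p \<and> (j = k \<or> dst j k \<le> 2 ^ N * ell p))) \<and>
      (\<forall>j. \<phi> j 0 = c j + (\<Sum>k\<in>F p. Gs (Suc n) p 0 j k * c k))"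
proof -
  define G where "G = Gs (Suc n)"
  define K where "K = F p - A p"
  have sG: "smb 0 G" unfolding G_def by (rule smb_Gs)
  have G0: "G p t j k = 0" if "j \<notin> A p \<or> k \<in> A p \<or> j \<notin> F p \<or> k \<notin> F p" for t j k
    using Gs_supp[of "Suc n" p t j k] that unfolding G_def by blast
  have finK: "finite K" by (simp add: K_def)
  \<comment> \<open>The generator of the reduced system: \<open>V21 \<star> G\<close> feeds the part
    in \<open>A\<close>, which is slaved to \<open>x\<close>, back into the components outside
    \<open>A\<close>.\<close>
  define a where "a j k t = - \<i> * (of_real (mu j) * of_bool (j = k) + V22 p t j k + (V21 \<star> G) p t j k)" for j k t
  have conta: "continuous_on {0..T} (a j k)" for j k
    unfolding a_def[abs_def]
    by (intro continuous_on_mult continuous_on_add continuous_on_const smb_cont[OF smb_V] smb_cont[OF smb_mm(2)[OF smb_V sG]])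
  have "\<exists>w w'. (\<forall>j\<in>K. w j 0 = c j) \<and> (\<forall>j\<in>K. \<forall>t\<in>{0..T}.
      (w j has_vector_derivative w' j t) (at t within {0..T}) \<and>
      cmod (w' j t - (\<Sum>k\<in>K. a j k t * w k t)) \<le> \<eta>)"
    by (rule approx_linear_ode[OF finK T \<eta> conta])
  then obtain w w' where ww: "\<forall>j\<in>K. w j 0 = c j" "\<forall>j\<in>K. \<forall>t\<in>{0..T}.
      (w j has_vector_derivative w' j t) (at t within {0..T}) \<and>
      cmod (w' j t - (\<Sum>k\<in>K. a j k t * w k t)) \<le> \<eta>" by blast
  have w0: "w j 0 = c j" if "j \<in> K" for j using ww(1) that by blast
  have dw: "(w j has_vector_derivative w' j t) (at t within {0..T})"
    and we: "cmod (w' j t - (\<Sum>k\<in>K. a j k t * w k t)) \<le> \<eta>" if "j \<in> K" "t \<in> {0..T}" for j t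
    using ww(2) that by blast+
  define x where "x j t = (if j \<in> K then w j t else 0)" for j t
  define x' where "x' j t = (if j \<in> K then w' j t else 0)" for j t
  have dx: "(x j has_vector_derivative x' j t) (at t within {0..T})" if "t \<in> {0..T}" for j t
    unfolding x_def[abs_def] x'_def using dw[of j t] that by (cases "j \<in> K") auto
  have x0: "x k t = 0" if "k \<in> A p \<or> k \<notin> F p" for k t using that by (auto simp: x_def K_def)
  define e where "e j t = \<i> * x' j t - (of_real (mu j) * x j t + (\<Sum>k\<in>F p. V22 p t j k * x k t)
      + (\<Sum>k\<in>F p. (V21 \<star> G) p t j k * x k t))" for j t
  have e: "cmod (e j t) \<le> \<eta>" if t: "t \<in> {0..T}" for j t
  proof (cases "j \<in> K")
    case True
    have "(\<Sum>k\<in>K. a j k t * w k t) = (\<Sum>k\<in>F p. a j k t * x k t)"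
      by (rule sum.mono_neutral_cong_left) (auto simp: K_def x_def)
    also have "\<dots> = - \<i> * ((\<Sum>k\<in>F p. of_real (mu j) * (of_bool (j = k) * x k t)) + (\<Sum>k\<in>F p. V22 p t j k * x k t)
        + (\<Sum>k\<in>F p. (V21 \<star> G) p t j k * x k t))"
      unfolding a_def sum_distrib_left sum.distrib[symmetric] by (intro sum.cong refl) (simp add: algebra_simps)
    also have "(\<Sum>k\<in>F p. of_real (mu j) * (of_bool (j = k) * x k t)) = of_real (mu j) * x j t"
      using True by (simp add: K_def of_bool_def if_distrib[of "\<lambda>b. b * _"] if_distrib[of "\<lambda>b. _ * b"] cong: if_cong)
    finally have aw: "(\<Sum>k\<in>K. a j k t * w k t) = - \<i> * (of_real (mu j) * x j t + (\<Sum>k\<in>F p. V22 p t j k * x k t)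
        + (\<Sum>k\<in>F p. (V21 \<star> G) p t j k * x k t))" .
    have ii: "\<i> * (- \<i> * y) = y" for y by (simp add: mult.assoc[symmetric])
    have "e j t = \<i> * (w' j t - (\<Sum>k\<in>K. a j k t * w k t))"
      unfolding aw right_diff_distrib ii using True by (simp add: e_def x'_def)
    then show ?thesis using we[OF True t] by (simp add: norm_mult)
  next
    case False
    have V0: "V p t j k = 0" if "j \<notin> F p" for k using suppV[of p t j k] that by blast
    have "V22 p t j k = 0" "V21 p t j k = 0" for k
      using False V0[of k] by (auto simp: blk_def K_def)
    then have "e j t = 0" using False by (simp add: e_def x_def x'_def mmul_def)
    then show ?thesis using \<eta> by simp
  qed
  define u where "u j t = (\<Sum>k\<in>F p. G p t j k * x k t)" for j t
  have u0: "u j t = 0" if "j \<notin> A p \<or> j \<notin> F p" for j t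
    using G0[of j _ t] that by (auto simp: u_def)
  define \<phi> where "\<phi> j t = x j t + u j t" for j t
  define \<phi>' where "\<phi>' j t = x' j t + (\<Sum>k\<in>F p. G p t j k * x' k t + dmat G p t j k * x k t)" for j t
  define \<rho> where "\<rho> j t = e j t + (\<Sum>k\<in>F p. G p t j k * e k t) + (\<Sum>k\<in>F p. Res n p t j k * x k t)" for j t
  have "(\<phi> j has_vector_derivative \<phi>' j t) (at t within {0..T})" if "t \<in> {0..T}" for j t
    unfolding \<phi>_def[abs_def] \<phi>'_def u_def
    by (intro has_vector_derivative_add has_vector_derivative_sum has_vector_derivative_mult dx that
        has_vector_derivative_at_within[OF smb_has_deriv[OF sG]])
  moreover have "\<i> * \<phi>' j t = of_real (mu j) * \<phi> j t + (\<Sum>k\<in>F p. V p t j k * \<phi> k t) + \<rho> j t" for j t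
  proof -
    have ix': "\<i> * x' k t = of_real (mu k) * x k t + (\<Sum>l\<in>F p. V22 p t k l * x l t)
      + (\<Sum>l\<in>F p. (V21 \<star> G) p t k l * x l t) + e k t" for k
      by (simp add: e_def)
    have ric: "\<i> * dmat G p t j k = of_real (mu j - mu k) * G p t j k + (V11 \<star> G) p t j k - (G \<star> V22) p t j k
        + V12 p t j k - (G \<star> V21 \<star> G) p t j k + Res n p t j k" for k
      unfolding G_def by (rule Gs_riccati[OF gap n])
    have 1: "(\<Sum>k\<in>F p. V p t j k * x k t) = (\<Sum>k\<in>F p. V22 p t j k * x k t) + (\<Sum>k\<in>F p. V12 p t j k * x k t)"
      unfolding sum.distrib[symmetric] by (intro sum.cong refl) (use x0 in \<open>auto simp: blk_def\<close>)
    have 2: "(\<Sum>k\<in>F p. V p t j k * u k t) = (\<Sum>k\<in>F p. V21 p t j k * u k t) + (\<Sum>k\<in>F p. V11 p t j k * u k t)"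
      unfolding sum.distrib[symmetric] by (intro sum.cong refl) (use u0 in \<open>auto simp: blk_def\<close>)
    have "\<i> * \<phi>' j t = \<i> * x' j t + (\<Sum>k\<in>F p. G p t j k * (\<i> * x' k t)) + (\<Sum>k\<in>F p. (\<i> * dmat G p t j k) * x k t)"
      by (simp add: \<phi>'_def ring_distribs sum_distrib_left sum.distrib mult_ac)
    also have "(\<Sum>k\<in>F p. G p t j k * (\<i> * x' k t)) = (\<Sum>k\<in>F p. of_real (mu k) * G p t j k * x k t)
        + (\<Sum>k\<in>F p. (G \<star> V22) p t j k * x k t) + (\<Sum>k\<in>F p. (G \<star> V21 \<star> G) p t j k * x k t) + (\<Sum>k\<in>F p. G p t j k * e k t)"
      unfolding ix' mmul_assoc3 mmul_vec[where X = G and Y = V22] by (simp add: ring_distribs sum.distrib mult_ac)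
    also have "(\<Sum>k\<in>F p. (\<i> * dmat G p t j k) * x k t) = of_real (mu j) * u j t - (\<Sum>k\<in>F p. of_real (mu k) * G p t j k * x k t)
        + (\<Sum>k\<in>F p. (V11 \<star> G) p t j k * x k t) - (\<Sum>k\<in>F p. (G \<star> V22) p t j k * x k t)
        + (\<Sum>k\<in>F p. V12 p t j k * x k t) - (\<Sum>k\<in>F p. (G \<star> V21 \<star> G) p t j k * x k t) + (\<Sum>k\<in>F p. Res n p t j k * x k t)"
      unfolding ric u_def sum_distrib_left sum.distrib[symmetric] sum_subtractf[symmetric]
      by (intro sum.cong refl) (simp add: algebra_simps)
    also have "(\<Sum>k\<in>F p. (V11 \<star> G) p t j k * x k t) = (\<Sum>k\<in>F p. V11 p t j k * u k t)"
      unfolding mmul_vec u_def ..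
    finally have "\<i> * \<phi>' j t = \<i> * x' j t + of_real (mu j) * u j t + (\<Sum>k\<in>F p. V11 p t j k * u k t)
        + (\<Sum>k\<in>F p. V12 p t j k * x k t) + (\<Sum>k\<in>F p. G p t j k * e k t) + (\<Sum>k\<in>F p. Res n p t j k * x k t)"
      by (simp add: algebra_simps)
    also have "\<i> * x' j t = of_real (mu j) * x j t + (\<Sum>l\<in>F p. V22 p t j l * x l t) + (\<Sum>k\<in>F p. V21 p t j k * u k t) + e j t"
      unfolding ix'[of j] mmul_vec u_def ..
    finally show ?thesis
      unfolding \<phi>_def \<rho>_def ring_distribs sum.distrib 1 2 by (simp add: algebra_simps)
  qed
  moreover have "cmod (\<rho> j t) \<le> \<kappa> * sqrt (\<Sum>k\<in>F p. (cmod (\<phi> k t))\<^sup>2) + (1 + g) * \<eta>" if t: "t \<in> {0..T}" for j t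
  proof -
    let ?y = "sqrt (\<Sum>k\<in>F p. (cmod (\<phi> k t))\<^sup>2)"
    \<comment> \<open>\<open>x\<close> and \<open>u\<close> have disjoint supports, outside and
      inside \<open>A\<close>, so the mass of \<phi> controls \<open>x\<close>.\<close>
    have xy: "cmod (x k t) \<le> ?y" for k
    proof (cases "k \<in> K")
      case True
      then have "\<phi> k t = x k t" using u0[of k t] by (simp add: \<phi>_def K_def)
      moreover have "cmod (\<phi> k t) \<le> ?y"
        by (rule real_le_rsqrt) (use member_le_sum[of k "F p" "\<lambda>k. (cmod (\<phi> k t))\<^sup>2"] True in \<open>simp add: K_def\<close>)
      ultimately show ?thesis by simp
    next
      case False
      then show ?thesis by (simp add: x_def sum_nonneg)
    qed
    have "cmod (\<Sum>k\<in>F p. Res n p t j k * x k t) \<le> (\<Sum>k\<in>F p. cmod (Res n p t j k) * ?y)"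
      by (rule order_trans[OF norm_sum sum_mono]) (simp add: norm_mult mult_left_mono xy)
    also have "\<dots> \<le> \<kappa> * ?y"
      unfolding sum_distrib_right[symmetric] by (rule mult_right_mono[OF \<kappa>]) (simp add: sum_nonneg)
    finally have 1: "cmod (\<Sum>k\<in>F p. Res n p t j k * x k t) \<le> \<kappa> * ?y" .
    have "cmod (\<Sum>k\<in>F p. G p t j k * e k t) \<le> (\<Sum>k\<in>F p. cmod (G p t j k) * \<eta>)"
      by (rule order_trans[OF norm_sum sum_mono]) (simp add: norm_mult mult_left_mono e[OF t])
    also have "\<dots> \<le> g * \<eta>"
      unfolding sum_distrib_right[symmetric] G_def by (rule mult_right_mono[OF g]) (use \<eta> in simp)
    finally have 2: "cmod (\<Sum>k\<in>F p. G p t j k * e k t) \<le> g * \<eta>" .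
    have "cmod (\<rho> j t) \<le> cmod (e j t) + cmod (\<Sum>k\<in>F p. G p t j k * e k t) + cmod (\<Sum>k\<in>F p. Res n p t j k * x k t)"
      unfolding \<rho>_def by (intro order_trans[OF norm_triangle_ineq] add_mono order_refl norm_triangle_ineq)
    then show ?thesis using 1 2 e[OF t, of j] by (simp add: algebra_simps)
  qed
  moreover have "j \<in> F p \<and> (\<exists>k. k \<notin> A p \<and> (j = k \<or> dst j k \<le> 2 ^ N * ell p))" if "\<phi> j t \<noteq> 0" for j t
  proof (cases "x j t = 0")
    case False
    then show ?thesis using x0[of j t] by auto
  next
    case True
    then have "\<exists>k\<in>F p. G p t j k * x k t \<noteq> 0"
      using that unfolding \<phi>_def u_def by (metis (mono_tags, lifting) add_0 sum.neutral)
    then obtain k where "G p t j k \<noteq> 0" by auto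
    then have k: "j \<in> F p" "k \<notin> A p" "dst j k \<le> (2 ^ Suc n - 1) * ell p"
      using Gs_supp[of "Suc n" p t j k] by (auto simp: G_def)
    have "(2 ^ Suc n - 1) * ell p \<le> 2 ^ N * ell p"
      using ell0[of p] power_increasing[OF n, of "2::real"] by (intro mult_right_mono) auto
    then show ?thesis using k by force
  qed
  moreover have "\<phi> j 0 = c j + (\<Sum>k\<in>F p. Gs (Suc n) p 0 j k * c k)" for j
  proof -
    have "x k 0 = c k" for k using w0[of k] c[of k] by (auto simp: x_def K_def)
    then show ?thesis by (simp add: \<phi>_def u_def G_def)
  qed
  ultimately show ?thesis by blast
qed

end

section \<open>Equations for sequences with rapidly decaying potential\<close>

text \<open>The correction \<open>2 / (n + 1)\<close> strengthens the bound 4 so that the induction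
  closes by the telescoping estimate of \<open>1 / (n + 2)\<^sup>2\<close>.\<close>

lemma sum_inverse_square_int: "(\<Sum>a\<in>{- int n..int n}. 1 / (1 + \<bar>real_of_int a\<bar>)\<^sup>2) \<le> 4 - 2 / (real n + 1)"
proof (induction n)
  case 0
  then show ?case by simp
next
  case (Suc n)
  have "{- int (Suc n)..int (Suc n)} = insert (- int (Suc n)) (insert (int (Suc n)) {- int n..int n})"
    by auto
  then have "(\<Sum>a\<in>{- int (Suc n)..int (Suc n)}. 1 / (1 + \<bar>real_of_int a\<bar>)\<^sup>2)
      = 2 * (1 / (real n + 2)\<^sup>2) + (\<Sum>a\<in>{- int n..int n}. 1 / (1 + \<bar>real_of_int a\<bar>)\<^sup>2)"
    by (simp add: add_ac)
  also have "\<dots> \<le> 2 * (1 / (real n + 2)\<^sup>2) + (4 - 2 / (real n + 1))" using Suc by simp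
  also have "1 / (real n + 2)\<^sup>2 \<le> 1 / (real n + 1) - 1 / (real n + 2)"
  proof -
    have "1 / (real n + 2)\<^sup>2 \<le> 1 / ((real n + 1) * (real n + 2))"
      by (rule divide_left_mono) (auto simp: power2_eq_square)
    also have "\<dots> = 1 / (real n + 1) - 1 / (real n + 2)" by (simp add: field_simps)
    finally show ?thesis .
  qed
  finally show ?case by (simp add: add_ac)
qed

text \<open>Every coordinate is bounded by the norm, so the summand is dominated by a product of
  one-dimensional terms, and the sum over an enclosing box factorises.\<close>

lemma lattice_sum_bound:
  fixes S :: "(int ^ 'd::finite) set"
  assumes "finite S"
  shows "(\<Sum>m\<in>S. 1 / (1 + norm (int_vec m)) ^ (2 * CARD('d))) \<le> 4 ^ CARD('d)"
proof -
  define f where "f a = 1 / (1 + \<bar>real_of_int a\<bar>)\<^sup>2" for a :: int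
  define n where "n = Max (insert 0 ((\<lambda>(m, i). nat \<bar>m $ i\<bar>) ` (S \<times> UNIV)))"
  have n: "\<bar>m $ i\<bar> \<le> int n" if "m \<in> S" for m i
  proof -
    have "nat \<bar>m $ i\<bar> \<le> n" unfolding n_def by (rule Max_ge) (use assms that in force)+
    then show ?thesis by simp
  qed
  have sub: "vec_nth ` S \<subseteq> (\<Pi>\<^sub>E i\<in>UNIV. {- int n..int n})"
    using n by (force simp: abs_le_iff)
  have inj: "inj_on vec_nth S" by (auto simp: inj_on_def vec_eq_iff)
  have "(\<Sum>m\<in>S. 1 / (1 + norm (int_vec m)) ^ (2 * CARD('d))) \<le> (\<Sum>m\<in>S. \<Prod>i\<in>UNIV. f (m $ i))"
  proof (rule sum_mono)
    fix m :: "int ^ 'd"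
    have "(\<Prod>i\<in>(UNIV :: 'd set). 1 / (1 + norm (int_vec m))\<^sup>2) \<le> (\<Prod>i\<in>UNIV. f (m $ i))"
    proof (rule prod_mono)
      fix i
      have "\<bar>real_of_int (m $ i)\<bar> \<le> norm (int_vec m)"
        using component_le_norm_cart[of "int_vec m" i] by (simp add: int_vec_def)
      then have "(1 + \<bar>real_of_int (m $ i)\<bar>)\<^sup>2 \<le> (1 + norm (int_vec m))\<^sup>2"
        by (intro power_mono) auto
      then show "0 \<le> 1 / (1 + norm (int_vec m))\<^sup>2 \<and> 1 / (1 + norm (int_vec m))\<^sup>2 \<le> f (m $ i)"
        unfolding f_def by (auto intro!: divide_left_mono mult_pos_pos zero_less_power add_pos_nonneg)
    qed
    then show "1 / (1 + norm (int_vec m)) ^ (2 * CARD('d)) \<le> (\<Prod>i\<in>UNIV. f (m $ i))"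
      by (simp add: power_mult power_one_over)
  qed
  also have "\<dots> = (\<Sum>g\<in>vec_nth ` S. \<Prod>i\<in>UNIV. f (g i))"
    by (simp add: sum.reindex[OF inj])
  also have "\<dots> \<le> (\<Sum>g\<in>(\<Pi>\<^sub>E i\<in>(UNIV :: 'd set). {- int n..int n}). \<Prod>i\<in>UNIV. f (g i))"
  proof (rule sum_mono2)
    show "vec_nth ` S \<subseteq> (\<Pi>\<^sub>E i\<in>(UNIV :: 'd set). {- int n..int n})" by (rule sub)
    show "finite (\<Pi>\<^sub>E i\<in>(UNIV :: 'd set). {- int n..int n})" by (intro finite_PiE) auto
    show "0 \<le> (\<Prod>i\<in>(UNIV :: 'd set). f (g i))" for g by (rule prod_nonneg) (simp add: f_def)
  qed
  also have "\<dots> = (\<Prod>i\<in>(UNIV :: 'd set). \<Sum>a\<in>{- int n..int n}. f a)"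
    by (rule prod_sum_PiE[symmetric]) auto
  also have "\<dots> \<le> (\<Prod>i\<in>(UNIV :: 'd set). 4)"
  proof (rule prod_mono)
    fix i :: 'd
    have "4 - 2 / (real n + 1) \<le> 4" by simp
    then show "0 \<le> (\<Sum>a\<in>{- int n..int n}. f a) \<and> (\<Sum>a\<in>{- int n..int n}. f a) \<le> 4"
      unfolding f_def by (intro conjI sum_nonneg order_trans[OF sum_inverse_square_int]) auto
  qed
  finally show ?thesis by simp
qed

text \<open>\<open>v l t m\<close> stands for the \<open>l\<close>-th time derivative of the \<open>m\<close>-th Fourier coefficient of the
  potential.\<close>

locale fourier_potential =
  fixes W :: "real ^ 'd::finite ^ 'd" and v :: "nat \<Rightarrow> real \<Rightarrow> int ^ 'd \<Rightarrow> complex"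
  assumes invW: "invertible W"
    and v_deriv: "\<And>l t m. ((\<lambda>t. v l t m) has_vector_derivative v (Suc l) t m) (at t)"
    and v_decay: "\<And>l N. \<exists>C. \<forall>t m. (1 + norm (int_vec m)) ^ N * cmod (v l t m) \<le> C"
    and v_sym: "\<And>t m. v 0 t (- m) = cnj (v 0 t m)"
begin

text \<open>The equation is stated through \<open>has_sum\<close>, so that convergence of the
  convolution is a part of it. Boundedness of the mass is not included and appears as a separate
  hypothesis where it is used.\<close>

definition seq_solution :: "(int ^ 'd \<Rightarrow> real \<Rightarrow> complex) \<Rightarrow> (int ^ 'd \<Rightarrow> real \<Rightarrow> complex) \<Rightarrow> bool" where
  "seq_solution b b' \<longleftrightarrow> (\<forall>j t. (b j has_vector_derivative b' j t) (at t) \<and>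
     ((\<lambda>k. v 0 t (j - k) * b k t) has_sum (\<i> * b' j t - of_real (eig W j) * b j t)) UNIV)"

lemma v_tail: "\<exists>C\<ge>0. \<forall>t S R. finite S \<longrightarrow> 0 \<le> R \<longrightarrow> (\<forall>m\<in>S. R \<le> norm (int_vec m)) \<longrightarrow>
    (\<Sum>m\<in>S. cmod (v l t m)) \<le> C / (1 + R) ^ N"
proof -
  obtain C where C: "\<And>t m. (1 + norm (int_vec m)) ^ (N + 2 * CARD('d)) * cmod (v l t m) \<le> C"
    using v_decay by blast
  have C0: "0 \<le> C" using order_trans[OF _ C[of 0 0]] by simp
  have "(\<Sum>m\<in>S. cmod (v l t m)) \<le> (C * 4 ^ CARD('d)) / (1 + R) ^ N"
    if S: "finite S" "\<forall>m\<in>S. R \<le> norm (int_vec m)" and R: "0 \<le> R" for t S R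
  proof -
    have "(\<Sum>m\<in>S. cmod (v l t m)) \<le> (\<Sum>m\<in>S. C / (1 + R) ^ N * (1 / (1 + norm (int_vec m)) ^ (2 * CARD('d))))"
    proof (rule sum_mono)
      fix m assume m: "m \<in> S"
      let ?x = "1 + norm (int_vec m)"
      have x: "0 < ?x" by (simp add: add_pos_nonneg)
      have "cmod (v l t m) \<le> C / ?x ^ (N + 2 * CARD('d))"
        using C[of m t] x by (simp add: pos_le_divide_eq mult.commute)
      also have "\<dots> = C / ?x ^ N * (1 / ?x ^ (2 * CARD('d)))" by (simp add: power_add)
      also have "\<dots> \<le> C / (1 + R) ^ N * (1 / ?x ^ (2 * CARD('d)))"
        by (intro mult_right_mono divide_left_mono power_mono mult_pos_pos zero_less_power) (use S m R C0 x in auto)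
      finally show "cmod (v l t m) \<le> C / (1 + R) ^ N * (1 / ?x ^ (2 * CARD('d)))" .
    qed
    also have "\<dots> \<le> C / (1 + R) ^ N * 4 ^ CARD('d)"
      unfolding sum_distrib_left[symmetric] by (intro mult_left_mono lattice_sum_bound S) (use C0 R in auto)
    finally show ?thesis by simp
  qed
  then show ?thesis using C0 by (intro exI[of _ "C * 4 ^ CARD('d)"]) auto
qed

lemma v_sum: "\<exists>C\<ge>0. \<forall>t S. finite S \<longrightarrow> (\<Sum>m\<in>S. cmod (v l t m)) \<le> C"
proof -
  from v_tail[of l 0] obtain C where C: "0 \<le> C" "\<And>t S R. finite S \<Longrightarrow> 0 \<le> R \<Longrightarrow> (\<forall>m\<in>S. R \<le> norm (int_vec m)) \<Longrightarrow>
    (\<Sum>m\<in>S. cmod (v l t m)) \<le> C / (1 + R) ^ 0" by blast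
  then have "(\<Sum>m\<in>S. cmod (v l t m)) \<le> C" if "finite S" for t S
    using C(2)[OF that, of 0] by simp
  then show ?thesis using C(1) by blast
qed

end

text \<open>This compares the infinite convolution with its truncation to a finite matrix: a bound
  for all finite partial sums passes to the limit.\<close>

lemma has_sum_diff_norm_le:
  fixes f g :: "'a \<Rightarrow> complex"
  assumes f: "(f has_sum s) UNIV" and F: "finite F" "\<And>k. k \<notin> F \<Longrightarrow> g k = 0"
    and B: "\<And>X. finite X \<Longrightarrow> (\<Sum>k\<in>X. cmod (f k - g k)) \<le> B"
  shows "cmod (s - (\<Sum>k\<in>F. g k)) \<le> B"
proof -
  have "(g has_sum (\<Sum>k\<in>F. g k)) UNIV"
    using has_sum_finite[OF F(1), of g] by (subst has_sum_cong_neutral[of F UNIV g g]) (use F in auto)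
  then have "((\<lambda>k. f k - g k) has_sum (s - (\<Sum>k\<in>F. g k))) UNIV"
    using has_sum_add[OF f has_sum_uminusI] by fastforce
  then have lim: "(sum (\<lambda>k. f k - g k) \<longlongrightarrow> s - (\<Sum>k\<in>F. g k)) (finite_subsets_at_top UNIV)"
    by (simp add: has_sum_def)
  show ?thesis
  proof (rule tendsto_upperbound[OF tendsto_norm[OF lim]])
    show "\<forall>\<^sub>F X in finite_subsets_at_top UNIV. norm (\<Sum>k\<in>X. f k - g k) \<le> B"
      by (rule eventually_finite_subsets_at_top_weakI) (rule order_trans[OF norm_sum B])
  qed simp
qed

text \<open>Trades \<open>n\<close> gains of the small power \<open>X powr \<delta>\<close> for
  \<open>q\<close> full powers of \<open>X\<close>.\<close>

lemma powr_gap_power: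
  fixes X \<delta> :: real
  assumes "1 \<le> X" "real q \<le> \<delta> * real n" "0 < \<delta>"
  shows "X ^ q \<le> (X powr \<delta>) ^ n"
proof -
  have "X ^ q = X powr real q" using assms by (simp add: powr_realpow)
  also have "\<dots> \<le> X powr (\<delta> * real n)" using assms by (intro powr_mono) auto
  also have "\<dots> = (X powr \<delta>) powr real n" by (simp add: powr_powr)
  also have "\<dots> = (X powr \<delta>) ^ n" using assms by (intro powr_realpow) auto
  finally show ?thesis .
qed

section \<open>Transfer of mass across one dyadic scale\<close>

context fourier_potential
begin

text \<open>The approximate solution starts from the modes \<open>|j| \<le> 2 ^ p\<close> of
  \<open>b\<close>, nearly keeps their mass and never leaves \<open>|j| \<le> 2 * 2 ^ p\<close>.
  What \<open>b\<close> has beyond is thus taken from the remaining mass. When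
  \<open>m\<^sup>2\<close> is the total mass, the difference on the right is the mass beyond
  \<open>2 ^ p\<close> at time 0.\<close>

lemma one_scale:
  fixes E Q :: nat
  shows "\<exists>C p0. 0 \<le> C \<and> (\<forall>p\<ge>p0. \<forall>T b b' m Z. 0 \<le> T \<longrightarrow> T \<le> (2 ^ p) ^ E \<longrightarrow> seq_solution b b' \<longrightarrow> 0 \<le> m \<longrightarrow>
     (\<forall>X t. finite X \<longrightarrow> t \<in> {0..T} \<longrightarrow> (\<Sum>k\<in>X. (cmod (b k t))\<^sup>2) \<le> m\<^sup>2) \<longrightarrow>
     finite Z \<longrightarrow> (\<forall>j\<in>Z. 2 * 2 ^ p < norm (int_vec j)) \<longrightarrow>
     (\<Sum>j\<in>Z. (cmod (b j T))\<^sup>2) \<le> m\<^sup>2 - (\<Sum>j | norm (int_vec j) \<le> 2 ^ p. (cmod (b j 0))\<^sup>2) + C / (2 ^ p) ^ Q * m\<^sup>2)"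
proof -
  let ?D = "CARD('d)"
  define good where "good M A \<delta> \<longleftrightarrow> (\<forall>j. 7 / 4 * M \<le> norm (int_vec j :: real ^ 'd) \<longrightarrow> j \<in> A) \<and>
     (\<forall>j\<in>A. 3 / 2 * M \<le> norm (int_vec j)) \<and>
     (\<forall>j\<in>A. \<forall>k. k \<notin> A \<longrightarrow> norm (int_vec j - int_vec k) \<le> M powr \<delta> \<longrightarrow>
         M powr \<delta> < \<bar>eig W j - eig W k\<bar>)" for M \<delta> :: real and A
  obtain \<delta> M0 where \<delta>: "0 < \<delta>" and M0: "1 \<le> M0"
    and reg: "\<forall>M\<ge>M0. M powr \<delta> \<le> M / 4 \<and> (\<exists>A. good M A \<delta>)"
    using resonance_free_region[OF invW, folded good_def] by blast
  \<comment> \<open>\<open>A p\<close> is arbitrary for small \<open>p\<close>. The gap is demanded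
    by \<open>approx_solution\<close> for the one \<open>p\<close> at hand and not by the locale, so
    the symbol calculus can run over all \<open>p\<close>.\<close>
  have "\<forall>p::nat. \<exists>A. M0 \<le> 2 ^ p \<longrightarrow> good (2 ^ p) A \<delta>" using reg by blast
  then obtain A where A: "\<And>p::nat. M0 \<le> 2 ^ p \<Longrightarrow> good (2 ^ p) (A p) \<delta>" by metis
  have A1: "j \<in> A p" if "M0 \<le> 2 ^ p" "7 / 4 * 2 ^ p \<le> norm (int_vec j)" for p j using A[OF that(1)] that(2) unfolding good_def by blast
  have A2: "3 / 2 * 2 ^ p \<le> norm (int_vec j)" if "M0 \<le> 2 ^ p" "j \<in> A p" for p j using A[OF that(1)] that(2) unfolding good_def by blast
  have A3: "(2 ^ p) powr \<delta> < \<bar>eig W j - eig W k\<bar>"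
    if "M0 \<le> 2 ^ p" "j \<in> A p" "k \<notin> A p" "norm (int_vec j - int_vec k) \<le> (2 ^ p) powr \<delta>" for p j k
    using A[OF that(1)] that(2-) unfolding good_def by blast
  \<comment> \<open>\<open>E\<close> powers pay for the time and \<open>?D\<close> for the number of
    modes, \<open>Q\<close> is the desired decay, and the last power absorbs the constant
    \<open>C0\<close> in \<open>small\<close>.\<close>
  define q where "q = E + ?D + Q + 1"
  obtain n :: nat where n: "real q / \<delta> \<le> real n" using real_arch_simple by blast
  have qn: "real q \<le> \<delta> * real n" using n \<delta> by (simp add: field_simps)
  define N where "N = Suc n"
  \<comment> \<open>The approximate solution lives in \<open>|j| \<le> 2 * 2 ^ p\<close> and the
    truncated potential reaches at most \<open>2 ^ p / 4\<close> further, so the radius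
    \<open>3 * 2 ^ p\<close> contains every neighbour that matters.\<close>
  define F where "F p = {j :: int ^ 'd. norm (int_vec j) \<le> 3 * 2 ^ p}" for p :: nat
  define lam :: "nat \<Rightarrow> real" where "lam p = (2 ^ p) powr \<delta>" for p
  define ell where "ell p = lam p / 2 ^ N" for p
  define dst where "dst j k = norm (int_vec j - int_vec k :: real ^ 'd)" for j k
  define U where "U l p t j k = (of_bool (j \<in> F p \<and> k \<in> F p \<and> dst j k \<le> ell p) * v l t (j - k))" for l and p :: nat and t j k
  have finF: "finite (F p)" for p by (rule int_ball_card(1)[of _ "3 * 2 ^ p"]) (auto simp: F_def)
  have cardF: "real (card (F p)) \<le> 7 ^ ?D * (2 ^ p) ^ ?D" for p
  proof -
    have "real (card (F p)) \<le> (2 * (3 * 2 ^ p) + 1) ^ ?D"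
      by (rule int_ball_card(2)) (auto simp: F_def)
    also have "\<dots> \<le> (7 * 2 ^ p) ^ ?D"
      by (rule power_mono) auto
    finally show ?thesis by (simp add: power_mult_distrib)
  qed
  have lam1: "1 \<le> lam p" for p unfolding lam_def by (rule ge_one_powr_ge_zero) (use \<delta> in auto)
  interpret scales F lam by unfold_locales (rule finF, rule lam1)
  have bndU: "bnd l 0 (U i)" for l i
  proof (induction l arbitrary: i)
    case 0
    obtain C where C: "0 \<le> C" "\<And>t S. finite S \<Longrightarrow> (\<Sum>m\<in>S. cmod (v i t m)) \<le> C" using v_sum by blast
    have "(\<Sum>k\<in>F p. cmod (U i p t j k)) \<le> C" for p t j
    proof -
      have "(\<Sum>k\<in>F p. cmod (U i p t j k)) \<le> (\<Sum>k\<in>F p. cmod (v i t (j - k)))"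
        by (rule sum_mono) (simp add: U_def norm_mult of_bool_def)
      also have "\<dots> = (\<Sum>m\<in>(\<lambda>k. j - k) ` F p. cmod (v i t m))"
        by (subst sum.reindex) (auto simp: inj_on_def)
      also have "\<dots> \<le> C" by (rule C(2)) (simp add: finF)
      finally show ?thesis .
    qed
    then show ?case using C(1) by auto
  next
    case (Suc l)
    have "((\<lambda>t. U i p t j k) has_vector_derivative U (Suc i) p t j k) (at t)" for p t j k
      unfolding U_def using has_vector_derivative_mult[OF has_vector_derivative_const v_deriv] by simp
    with bnd_0I[OF Suc] Suc show ?case by (rule bnd_SucI)
  qed
  have ell0: "0 \<le> ell p" for p using lam1[of p] by (simp add: ell_def)
  interpret riccati F lam "eig W" A "U 0" dst ell
  proof
    show "smb 0 (U 0)" using bndU by (simp add: smb_def)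
    show "j \<in> F p \<and> k \<in> F p \<and> dst j k \<le> ell p" if "U 0 p t j k \<noteq> 0" for p t j k
      using that by (auto simp: U_def split: if_splits)
    show "dst i k \<le> dst i j + dst j k" for i j k unfolding dst_def
      using norm_triangle_ineq[of "int_vec i - int_vec j" "int_vec j - int_vec k"] by simp
    show "0 \<le> ell p" for p by (rule ell0)
  qed
  obtain CR where CR: "0 \<le> CR" "\<And>p t j. (\<Sum>k\<in>F p. cmod (Res n p t j k)) \<le> CR / lam p ^ n"
    using smb_bound[OF smb_Res[of n]] by blast
  obtain g where g: "0 \<le> g" "\<And>p t j. (\<Sum>k\<in>F p. cmod (Gs (Suc n) p t j k)) \<le> g"
    using smb_bound[OF smb_Gs[of "Suc n"]] by auto
  obtain Ct where Ct: "0 \<le> Ct" "\<And>t S R. finite S \<Longrightarrow> 0 \<le> R \<Longrightarrow> (\<forall>m\<in>S. R \<le> norm (int_vec m)) \<Longrightarrow>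
    (\<Sum>m\<in>S. cmod (v 0 t m)) \<le> Ct / (1 + R) ^ n" using v_tail[of 0 n] by blast
  \<comment> \<open>The factor \<open>(2 ^ N) ^ n\<close> undoes the division by
    \<open>2 ^ N\<close> in \<open>ell\<close>, so that the tail of the potential beyond
    \<open>ell p\<close> is also bounded by a multiple of \<open>lam p ^ - n\<close>.\<close>
  define CT where "CT = Ct * (2 ^ N) ^ n"
  have CT: "0 \<le> CT" using Ct by (simp add: CT_def)
  define C0 where "C0 = 8 * 7 ^ ?D * (CR + 1)"
  define C where "C = 7 ^ ?D * (4 * CT + 18 * (CR + 1))"
  obtain p1 where p1: "M0 + C0 < 2 ^ p1" using real_arch_pow[of 2] by auto
  have C00: "0 \<le> C0" using CR by (simp add: C0_def)
  show ?thesis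
  proof (rule exI[of _ C], rule exI[of _ p1], intro conjI allI impI)
    show "0 \<le> C" using CR CT by (simp add: C_def)
    fix p T b b' m and Z :: "(int ^ 'd) set"
    assume p: "p1 \<le> p" and T: "0 \<le> T" "T \<le> (2 ^ p) ^ E" and sol: "seq_solution b b'" and m: "0 \<le> m"
      and bm: "\<forall>X t. finite X \<longrightarrow> t \<in> {0..T} \<longrightarrow> (\<Sum>k\<in>X. (cmod (b k t))\<^sup>2) \<le> m\<^sup>2"
      and Z: "finite Z" "\<forall>j\<in>Z. 2 * 2 ^ p < norm (int_vec j)"
    define X :: real where "X = 2 ^ p"
    have X1: "1 \<le> X" by (simp add: X_def)
    have "(2::real) ^ p1 \<le> 2 ^ p" using p by (intro power_increasing) auto
    then have XM: "M0 \<le> X" "C0 \<le> X" unfolding X_def using p1 C00 M0 by linarith+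
    have lamX: "lam p = X powr \<delta>" by (simp add: lam_def X_def)
    have lam4: "lam p \<le> X / 4" using reg XM(1) by (simp add: lamX)
    have Xq: "X ^ q \<le> lam p ^ n" unfolding lamX by (rule powr_gap_power[OF X1 qn \<delta>])
    have Xq0: "0 < X ^ q" using X1 by simp
    define \<kappa> where "\<kappa> = (CR + 1) / X ^ q"
    define \<tau> where "\<tau> = CT / X ^ q"
    have \<kappa>: "0 < \<kappa>" using CR Xq0 by (simp add: \<kappa>_def)
    have \<tau>: "0 \<le> \<tau>" using CT Xq0 by (simp add: \<tau>_def)
    have TF: "T * real (card (F p)) \<le> 7 ^ ?D * X ^ (E + ?D)"
    proof -
      have "T * real (card (F p)) \<le> X ^ E * (7 ^ ?D * X ^ ?D)"
        by (rule mult_mono) (use T cardF[of p] in \<open>auto simp: X_def\<close>)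
      then show ?thesis by (simp add: power_add mult_ac)
    qed
    have Xq2: "X ^ q = X ^ (E + ?D) * (X ^ Q * X)" by (simp add: q_def power_add)
    have XQ: "1 \<le> X ^ Q" using X1 by simp
    have TFX: "T * real (card (F p)) / X ^ q \<le> 7 ^ ?D / (X ^ Q * X)"
    proof -
      have "T * real (card (F p)) / X ^ q \<le> 7 ^ ?D * X ^ (E + ?D) / X ^ q"
        using TF Xq0 by (intro divide_right_mono) auto
      also have "\<dots> = 7 ^ ?D / (X ^ Q * X)" unfolding Xq2 using X1 by simp
      finally show ?thesis .
    qed
    have small: "8 * T * real (card (F p)) * \<kappa> \<le> 1"
    proof -
      have "8 * T * real (card (F p)) * \<kappa> = 8 * (CR + 1) * (T * real (card (F p)) / X ^ q)"
        by (simp add: \<kappa>_def)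
      also have "\<dots> \<le> 8 * (CR + 1) * (7 ^ ?D / (X ^ Q * X))"
        by (rule mult_left_mono[OF TFX]) (use CR in simp)
      also have "\<dots> = C0 / (X ^ Q * X)" by (simp add: C0_def)
      also have "\<dots> \<le> X / (X ^ Q * X)" using XM(2) X1 by (intro divide_right_mono) auto
      also have "\<dots> \<le> 1" using X1 XQ by simp
      finally show ?thesis .
    qed
    have final: "T * real (card (F p)) * (4 * \<tau> + 18 * \<kappa>) \<le> C / X ^ Q"
    proof -
      have "T * real (card (F p)) * (4 * \<tau> + 18 * \<kappa>) = (4 * CT + 18 * (CR + 1)) * (T * real (card (F p)) / X ^ q)"
        by (simp add: \<kappa>_def \<tau>_def add_divide_distrib[symmetric])
      also have "\<dots> \<le> (4 * CT + 18 * (CR + 1)) * (7 ^ ?D / (X ^ Q * X))"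
        by (rule mult_left_mono[OF TFX]) (use CR CT in simp)
      also have "\<dots> = C / (X ^ Q * X)" by (simp add: C_def)
      also have "\<dots> \<le> C / X ^ Q"
        using \<open>0 \<le> C\<close> X1 XQ by (intro divide_left_mono) auto
      finally show ?thesis .
    qed
    have b0m: "(\<Sum>k\<in>Y. (cmod (b k t))\<^sup>2) \<le> m\<^sup>2" if "finite Y" "t \<in> {0..T}" for Y t using bm that by blast
    show "(\<Sum>j\<in>Z. (cmod (b j T))\<^sup>2) \<le> m\<^sup>2 - (\<Sum>j | norm (int_vec j) \<le> 2 ^ p. (cmod (b j 0))\<^sup>2) + C / (2 ^ p) ^ Q * m\<^sup>2"
    \<comment> \<open>The tolerance \<eta> of the Picard iteration is taken proportional to
      \<open>m\<close>, to fit the error term \<open>\<kappa> * m\<close> of the comparison, and it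
      has to be positive.\<close>
    proof (cases "m = 0")
      case True
      have fin: "finite {j :: int ^ 'd. norm (int_vec j) \<le> 2 ^ p}" by (rule int_ball_card(1)[of _ "2 ^ p"]) auto
      have "(\<Sum>j\<in>Z. (cmod (b j T))\<^sup>2) \<le> 0" using b0m[OF Z(1), of T] True T by simp
      moreover have "(\<Sum>j | norm (int_vec j) \<le> 2 ^ p. (cmod (b j 0))\<^sup>2) \<le> 0" using b0m[OF fin, of 0] True T by simp
      ultimately show ?thesis using True by simp
    next
      case False
      then have m0: "0 < m" using m by simp
      define \<eta> where "\<eta> = \<kappa> * m / (1 + g)"
      have \<eta>: "0 < \<eta>" using \<kappa> m0 g by (simp add: \<eta>_def)
      have \<eta>g: "(1 + g) * \<eta> = \<kappa> * m" using g by (simp add: \<eta>_def)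
      define c where "c k = (if norm (int_vec k :: real ^ 'd) \<le> X then b k 0 else 0)" for k
      have c: "k \<in> F p \<and> k \<notin> A p" if "c k \<noteq> 0" for k
      proof -
        have kX: "norm (int_vec k :: real ^ 'd) \<le> X" using that by (auto simp: c_def split: if_splits)
        then have "k \<in> F p" using X1 unfolding F_def X_def mem_Collect_eq by linarith
        moreover have "\<not> 3 / 2 * X \<le> norm (int_vec k :: real ^ 'd)" using kX X1 by linarith
        ultimately show ?thesis using A2[of p k] XM(1) unfolding X_def by blast
      qed
      have ellN: "2 ^ N * ell p = lam p" by (simp add: ell_def)
      have gap: "lam p < \<bar>eig W j - eig W k\<bar>" if "j \<in> A p" "k \<notin> A p" "dst j k \<le> 2 ^ N * ell p" for j k
        using A3[of p j k] that XM(1) by (simp add: ellN dst_def lam_def X_def)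
      have R\<kappa>: "(\<Sum>k\<in>F p. cmod (Res n p t j k)) \<le> \<kappa>" for t j
      proof -
        have "CR / lam p ^ n \<le> CR / X ^ q" using CR Xq Xq0 by (intro divide_left_mono) auto
        also have "\<dots> \<le> \<kappa>" unfolding \<kappa>_def using Xq0 by (intro divide_right_mono) auto
        finally show ?thesis by (rule order_trans[OF CR(2)])
      qed
      have "\<exists>\<phi> \<phi>' \<rho>. (\<forall>j. \<forall>t\<in>{0..T}. (\<phi> j has_vector_derivative \<phi>' j t) (at t within {0..T}) \<and>
        \<i> * \<phi>' j t = of_real (eig W j) * \<phi> j t + (\<Sum>k\<in>F p. U 0 p t j k * \<phi> k t) + \<rho> j t \<and>
        cmod (\<rho> j t) \<le> \<kappa> * sqrt (\<Sum>k\<in>F p. (cmod (\<phi> k t))\<^sup>2) + (1 + g) * \<eta>) \<and>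
        (\<forall>j t. \<phi> j t \<noteq> 0 \<longrightarrow> j \<in> F p \<and> (\<exists>k. k \<notin> A p \<and> (j = k \<or> dst j k \<le> 2 ^ N * ell p))) \<and>
        (\<forall>j. \<phi> j 0 = c j + (\<Sum>k\<in>F p. Gs (Suc n) p 0 j k * c k))"
        by (rule approx_solution[OF gap _ T(1) \<eta> c R\<kappa> g(2)]) (simp_all add: N_def)
      then obtain \<phi> \<phi>' \<rho> where ap: "\<forall>j. \<forall>t\<in>{0..T}. (\<phi> j has_vector_derivative \<phi>' j t) (at t within {0..T}) \<and>
        \<i> * \<phi>' j t = of_real (eig W j) * \<phi> j t + (\<Sum>k\<in>F p. U 0 p t j k * \<phi> k t) + \<rho> j t \<and>
        cmod (\<rho> j t) \<le> \<kappa> * sqrt (\<Sum>k\<in>F p. (cmod (\<phi> k t))\<^sup>2) + (1 + g) * \<eta>"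
       and supp: "\<forall>j t. \<phi> j t \<noteq> 0 \<longrightarrow> j \<in> F p \<and> (\<exists>k. k \<notin> A p \<and> (j = k \<or> dst j k \<le> 2 ^ N * ell p))"
       and init: "\<forall>j. \<phi> j 0 = c j + (\<Sum>k\<in>F p. Gs (Suc n) p 0 j k * c k)"
        by blast
      have init': "\<phi> j 0 = c j" for j
      proof -
        have "Gs (Suc n) p 0 j k * c k = 0" for k
        proof (rule ccontr)
          assume "Gs (Suc n) p 0 j k * c k \<noteq> 0"
          then have k: "c k \<noteq> 0" and G: "Gs (Suc n) p 0 j k \<noteq> 0" by auto
          have kX: "norm (int_vec k :: real ^ 'd) \<le> X" using k by (auto simp: c_def split: if_splits)
          have jA: "j \<in> A p" and "dst j k \<le> (2 ^ Suc n - 1) * ell p" using Gs_supp[OF G] by auto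
          then have "dst j k \<le> 2 ^ N * ell p" using ell0[of p] by (simp add: N_def algebra_simps)
          then have "dst j k \<le> X / 4" using lam4 by (simp add: ellN)
          moreover have "3 / 2 * X \<le> norm (int_vec j :: real ^ 'd)" using A2[of p j] jA XM(1) by (simp add: X_def)
          ultimately show False using kX X1 norm_triangle_ineq2[of "int_vec j" "int_vec k :: real ^ 'd"]
            unfolding dst_def by linarith
        qed
        then have "(\<Sum>k\<in>F p. Gs (Suc n) p 0 j k * c k) = 0" by (intro sum.neutral ballI)
        then show ?thesis using init by (simp del: Gs.simps)
      qed
      \<comment> \<open>A point outside \<open>A\<close> has norm below \<open>7/4 * X\<close>, and
        the graph reaches at most \<open>X / 4\<close> further, which yields
        \<open>2 * X\<close>.\<close>
      have supp2: "norm (int_vec j :: real ^ 'd) \<le> 2 * X" if nz: "\<phi> j t \<noteq> 0" for j t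
      proof -
        obtain k where k: "k \<notin> A p" "j = k \<or> dst j k \<le> lam p" using supp nz unfolding ellN by blast
        have "norm (int_vec k :: real ^ 'd) < 7 / 4 * X" using A1[of p k] k(1) XM(1) by (force simp: X_def)
        moreover have "norm (int_vec j - int_vec k :: real ^ 'd) \<le> X / 4"
          using k(2) lam4 X1 unfolding dst_def by auto
        ultimately show ?thesis using X1 norm_triangle_ineq2[of "int_vec j" "int_vec k :: real ^ 'd"]
          by linarith
      qed
      have sb: "(b j has_vector_derivative b' j t) (at t)"
        "((\<lambda>k. v 0 t (j - k) * b k t) has_sum (\<i> * b' j t - of_real (eig W j) * b j t)) UNIV" for j t
        using sol unfolding seq_solution_def by blast+
      define S where "S j t = \<i> * b' j t - of_real (eig W j) * b j t" for j t
      have Ssum: "((\<lambda>k. v 0 t (j - k) * b k t) has_sum S j t) UNIV" for j t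
        unfolding S_def by (rule sb(2))
      have bbm: "cmod (b j t) \<le> m" if "t \<in> {0..T}" for j t
        using b0m[of "{j}" t] that m by (simp add: power2_le_iff_abs_le)
      \<comment> \<open>Only rows \<open>j\<close> in the support of \<phi> occur. Their neighbours
        within distance \<open>ell p\<close> all belong to \<open>F p\<close>, where
        \<open>U 0\<close> agrees with the potential, so the error is the tail of the potential
        beyond \<open>ell p\<close>.\<close>
      have Sb: "cmod (S j t - (\<Sum>k\<in>F p. U 0 p t j k * b k t)) \<le> \<tau> * m" if t: "t \<in> {0..T}" and j: "\<phi> j t \<noteq> 0" for j t
      proof (rule has_sum_diff_norm_le[OF Ssum finF])
        show "U 0 p t j k * b k t = 0" if "k \<notin> F p" for k using that by (simp add: U_def)
      next
        fix Y :: "(int ^ 'd) set" assume Y: "finite Y"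
        let ?Y = "{k \<in> Y. ell p < dst j k}"
        have ellX: "ell p \<le> X / 4"
        proof -
          have "ell p \<le> lam p" using lam1[of p] by (simp add: ell_def divide_le_eq mult_le_cancel_left1)
          then show ?thesis using lam4 by simp
        qed
        have "(\<Sum>k\<in>Y. cmod (v 0 t (j - k) * b k t - U 0 p t j k * b k t))
            \<le> (\<Sum>k\<in>Y. if ell p < dst j k then cmod (v 0 t (j - k)) * m else 0)"
        proof (rule sum_mono)
          fix k
          show "cmod (v 0 t (j - k) * b k t - U 0 p t j k * b k t) \<le> (if ell p < dst j k then cmod (v 0 t (j - k)) * m else 0)"
          proof (cases "ell p < dst j k")
            case True
            then show ?thesis using bbm[OF t] by (simp add: U_def norm_mult mult_left_mono)
          next
            case False
            have "norm (int_vec k :: real ^ 'd) \<le> norm (int_vec j :: real ^ 'd) + dst j k"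
              unfolding dst_def using norm_triangle_ineq3[of "int_vec j" "int_vec k :: real ^ 'd"] by linarith
            then have "k \<in> F p" "j \<in> F p"
              using supp2[OF j] False ellX X1 unfolding F_def X_def mem_Collect_eq by linarith+
            then show ?thesis using False by (simp add: U_def)
          qed
        qed
        also have "\<dots> = (\<Sum>k\<in>?Y. cmod (v 0 t (j - k)) * m)"
          using Y by (simp add: sum.inter_filter)
        also have "\<dots> = (\<Sum>k\<in>?Y. cmod (v 0 t (j - k))) * m" by (simp add: sum_distrib_right)
        also have "(\<Sum>k\<in>?Y. cmod (v 0 t (j - k))) = (\<Sum>l\<in>(\<lambda>k. j - k) ` ?Y. cmod (v 0 t l))"
          by (subst sum.reindex) (auto simp: inj_on_def)
        also have "\<dots> \<le> Ct / (1 + ell p) ^ n"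
          by (rule Ct(2)) (use Y ell0[of p] in \<open>auto simp: dst_def int_vec_diff\<close>)
        also have "\<dots> \<le> \<tau>"
        proof -
          have "X ^ q / (2 ^ N) ^ n \<le> lam p ^ n / (2 ^ N) ^ n"
            by (rule divide_right_mono[OF Xq]) simp
          also have "\<dots> = ell p ^ n" by (simp add: ell_def power_divide)
          also have "\<dots> \<le> (1 + ell p) ^ n" by (rule power_mono) (use ell0[of p] in auto)
          finally have "X ^ q / (2 ^ N) ^ n \<le> (1 + ell p) ^ n" .
          then have "Ct / (1 + ell p) ^ n \<le> Ct / (X ^ q / (2 ^ N) ^ n)"
            using Ct(1) Xq0 zero_less_power[OF add_pos_nonneg[OF zero_less_one ell0], of p n]
            by (intro divide_left_mono mult_pos_pos) auto
          then show ?thesis by (simp add: \<tau>_def CT_def)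
        qed
        finally show "(\<Sum>k\<in>Y. cmod (v 0 t (j - k) * b k t - U 0 p t j k * b k t)) \<le> \<tau> * m"
          using m by (simp add: mult_right_mono)
      qed
      have "(\<Sum>j\<in>Z. (cmod (b j T))\<^sup>2) \<le> m\<^sup>2 - (\<Sum>k\<in>F p. (cmod (\<phi> k 0))\<^sup>2) + T * real (card (F p)) * (4 * \<tau> + 18 * \<kappa>) * m\<^sup>2"
      proof (rule approx_solution_compare[where \<phi>' = \<phi>' and \<rho> = \<rho> and b' = b' and S = S and mu = "eig W" and V = "\<lambda>t j k. U 0 p t j k"])
        show "(\<phi> j has_vector_derivative \<phi>' j t) (at t within {0..T})" if "t \<in> {0..T}" for j t using ap that by blast
        show "\<i> * \<phi>' j t = of_real (eig W j) * \<phi> j t + (\<Sum>k\<in>F p. U 0 p t j k * \<phi> k t) + \<rho> j t" if "t \<in> {0..T}" for j t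
          using ap that by blast
        show "cmod (\<rho> j t) \<le> \<kappa> * sqrt (\<Sum>k\<in>F p. (cmod (\<phi> k t))\<^sup>2) + \<kappa> * m" if "t \<in> {0..T}" for j t
          using ap that unfolding \<eta>g by blast
        show "cnj (U 0 p t j k) = U 0 p t k j" for t j k
          using v_sym[of t "j - k"] by (simp add: U_def dst_def norm_minus_commute conj_commute conj_left_commute)
        show "(b j has_vector_derivative b' j t) (at t within {0..T})" for j t
          by (rule has_vector_derivative_at_within[OF sb(1)])
        show "\<i> * b' j t = of_real (eig W j) * b j t + S j t" for j t by (simp add: S_def)
        show "\<phi> j 0 = 0 \<or> \<phi> j 0 = b j 0" for j unfolding init' by (simp add: c_def)
        show "\<phi> j T = 0" if "j \<in> Z" for j using supp2[of j T] Z(2) that by (force simp: X_def)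
      qed (use T \<kappa> \<tau> small m b0m Sb Z finF in auto)
      moreover have "(\<Sum>k\<in>F p. (cmod (\<phi> k 0))\<^sup>2) = (\<Sum>j | norm (int_vec j) \<le> 2 ^ p. (cmod (b j 0))\<^sup>2)"
      proof -
        have "(\<Sum>k\<in>F p. (cmod (\<phi> k 0))\<^sup>2) = (\<Sum>k\<in>F p. if norm (int_vec k :: real ^ 'd) \<le> X then (cmod (b k 0))\<^sup>2 else 0)"
          unfolding init' c_def by (intro sum.cong) auto
        also have "\<dots> = (\<Sum>k\<in>{k \<in> F p. norm (int_vec k :: real ^ 'd) \<le> X}. (cmod (b k 0))\<^sup>2)"
          using finF[of p] by (simp add: sum.inter_filter)
        also have "{k \<in> F p. norm (int_vec k :: real ^ 'd) \<le> X} = {k. norm (int_vec k :: real ^ 'd) \<le> 2 ^ p}"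
          using X1 by (auto simp: F_def X_def intro: order_trans)
        finally show ?thesis .
      qed
      moreover have "T * real (card (F p)) * (4 * \<tau> + 18 * \<kappa>) * m\<^sup>2 \<le> C / (2 ^ p) ^ Q * m\<^sup>2"
        using final by (intro mult_right_mono) (auto simp: X_def)
      ultimately show ?thesis by linarith
    qed
  qed
qed

end

section \<open>A priori bound of the mass\<close>

context fourier_potential
begin

lemma v_weighted_sum: "\<exists>C\<ge>0. \<forall>t S. finite S \<longrightarrow> (\<Sum>m\<in>S. norm (int_vec m) * cmod (v 0 t m)) \<le> C"
proof -
  obtain C where C: "\<And>t m. (1 + norm (int_vec m)) ^ (2 * CARD('d) + 1) * cmod (v 0 t m) \<le> C"
    using v_decay by blast
  have C0: "0 \<le> C" using order_trans[OF _ C[of 0 0]] by simp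
  have "(\<Sum>m\<in>S. norm (int_vec m) * cmod (v 0 t m)) \<le> C * 4 ^ CARD('d)" if S: "finite S" for t S
  proof -
    have "(\<Sum>m\<in>S. norm (int_vec m) * cmod (v 0 t m)) \<le> (\<Sum>m\<in>S. C * (1 / (1 + norm (int_vec m)) ^ (2 * CARD('d))))"
    proof (rule sum_mono)
      fix m :: "int ^ 'd"
      let ?x = "1 + norm (int_vec m)"
      have x: "0 < ?x" by (simp add: add_pos_nonneg)
      have "norm (int_vec m) * cmod (v 0 t m) \<le> ?x * cmod (v 0 t m)" by (rule mult_right_mono) auto
      also have "\<dots> \<le> C / ?x ^ (2 * CARD('d))"
        using C[where t = t and m = m] x by (simp add: pos_le_divide_eq mult_ac)
      finally show "norm (int_vec m) * cmod (v 0 t m) \<le> C * (1 / ?x ^ (2 * CARD('d)))" by simp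
    qed
    also have "\<dots> \<le> C * 4 ^ CARD('d)"
      unfolding sum_distrib_left[symmetric] by (intro mult_left_mono lattice_sum_bound S C0)
    finally show ?thesis .
  qed
  then show ?thesis using C0 by (intro exI[of _ "C * 4 ^ CARD('d)"]) auto
qed

text \<open>The cutoff \<open>\<theta> j = max 0 (1 - |j| / J)\<close> is Lipschitz with constant \<open>1 / J\<close>, so that its
  commutator with the potential is \<open>O(1 / J)\<close>.\<close>

lemma mass_bound:
  assumes sol: "seq_solution b b'" and B: "\<And>X t. finite X \<Longrightarrow> t \<in> {0..T} \<Longrightarrow> (\<Sum>k\<in>X. (cmod (b k t))\<^sup>2) \<le> B"
    and m: "\<And>X. finite X \<Longrightarrow> (\<Sum>k\<in>X. (cmod (b k 0))\<^sup>2) \<le> m"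
    and X: "finite X" and t: "t \<in> {0..T}"
  shows "(\<Sum>k\<in>X. (cmod (b k t))\<^sup>2) \<le> m"
proof -
  let ?D = "CARD('d)"
  have B0: "0 \<le> B" using B[of "{}" t] t by simp
  have T: "0 \<le> T" using t by simp
  define \<beta> where "\<beta> = sqrt B"
  have \<beta>: "0 \<le> \<beta>" "\<beta> * \<beta> = B" using B0 by (auto simp: \<beta>_def)
  have b\<beta>: "cmod (b j t) \<le> \<beta>" if "t \<in> {0..T}" for j t
    unfolding \<beta>_def by (rule real_le_rsqrt) (use B[of "{j}" t] that in simp)
  have sb: "(b j has_vector_derivative b' j t) (at t)"
    "((\<lambda>k. v 0 t (j - k) * b k t) has_sum (\<i> * b' j t - of_real (eig W j) * b j t)) UNIV" for j t
    using sol unfolding seq_solution_def by blast+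
  define S where "S j t = \<i> * b' j t - of_real (eig W j) * b j t" for j t
  have Ssum: "((\<lambda>k. v 0 t (j - k) * b k t) has_sum S j t) UNIV" for j t
    unfolding S_def by (rule sb(2))
  obtain C1 where C1: "0 \<le> C1" "\<And>t S. finite S \<Longrightarrow> (\<Sum>m\<in>S. norm (int_vec m) * cmod (v 0 t m)) \<le> C1"
    using v_weighted_sum by blast
  obtain Ct where Ct: "0 \<le> Ct" "\<And>t S R. finite S \<Longrightarrow> 0 \<le> R \<Longrightarrow> (\<forall>m\<in>S. R \<le> norm (int_vec m)) \<Longrightarrow>
    (\<Sum>m\<in>S. cmod (v 0 t m)) \<le> Ct / (1 + R) ^ (?D + 1)" using v_tail[of 0 "?D + 1"] by blast
  define K where "K = C1 * B + 2 * 4 ^ ?D * Ct * B"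
  have K: "0 \<le> K" using C1 Ct B0 by (simp add: K_def)
  obtain R where R: "0 \<le> R" "\<And>j. j \<in> X \<Longrightarrow> norm (int_vec j :: real ^ 'd) \<le> R"
  proof
    show "0 \<le> (\<Sum>j\<in>X. norm (int_vec j :: real ^ 'd))" by (rule sum_nonneg) simp
    show "norm (int_vec j :: real ^ 'd) \<le> (\<Sum>j\<in>X. norm (int_vec j :: real ^ 'd))" if "j \<in> X" for j
      by (rule member_le_sum) (use that X in auto)
  qed
  \<comment> \<open>The total mass cannot be differentiated termwise: \<open>eig\<close> is
    unbounded and \<open>b'\<close> is not known to be square summable. The cut-off mass is a finite
    sum, and its error is removed at the end by letting \<open>J\<close> grow.\<close>
  have main: "(\<Sum>k\<in>X. (cmod (b k t))\<^sup>2) \<le> m + (K * T + R * B) / J" if J: "1 \<le> J" for J :: real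
  proof -
    define \<theta> where "\<theta> j = max 0 (1 - norm (int_vec j :: real ^ 'd) / J)" for j :: "int ^ 'd"
    \<comment> \<open>The cut-off lives in \<open>|j| \<le> J\<close>. The margin up to
      \<open>2 * J\<close> makes the neglected part of the convolution
      \<open>O((1 + J) ^ - (?D + 1))\<close>, which beats the number of points of \<open>F\<close>
      by one power.\<close>
    define F where "F = {j :: int ^ 'd. norm (int_vec j) \<le> 2 * J}"
    have F: "finite F" "real (card F) \<le> 4 ^ ?D * (1 + J) ^ ?D"
    proof -
      show "finite F" by (rule int_ball_card(1)[of _ "2 * J"]) (use J in \<open>auto simp: F_def\<close>)
      have "real (card F) \<le> (2 * (2 * J) + 1) ^ ?D"
        by (rule int_ball_card(2)) (use J in \<open>auto simp: F_def\<close>)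
      also have "\<dots> \<le> (4 * (1 + J)) ^ ?D" by (rule power_mono) (use J in auto)
      finally show "real (card F) \<le> 4 ^ ?D * (1 + J) ^ ?D" unfolding power_mult_distrib .
    qed
    have \<theta>01: "0 \<le> \<theta> j" "\<theta> j \<le> 1" for j using J by (auto simp: \<theta>_def)
    have \<theta>lip: "\<bar>\<theta> j - \<theta> k\<bar> \<le> norm (int_vec (j - k) :: real ^ 'd) / J" for j k
    proof -
      have "\<bar>\<theta> j - \<theta> k\<bar> \<le> \<bar>norm (int_vec j :: real ^ 'd) / J - norm (int_vec k :: real ^ 'd) / J\<bar>"
        unfolding \<theta>_def by linarith
      also have "\<dots> = \<bar>norm (int_vec j :: real ^ 'd) - norm (int_vec k :: real ^ 'd)\<bar> / J"
        using J by (simp add: diff_divide_distrib[symmetric])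
      also have "\<dots> \<le> norm (int_vec (j - k) :: real ^ 'd) / J"
        unfolding int_vec_diff using J by (intro divide_right_mono norm_triangle_ineq3) auto
      finally show ?thesis .
    qed
    have \<theta>F: "norm (int_vec j :: real ^ 'd) \<le> J" if "\<theta> j \<noteq> 0" for j
      using that J by (auto simp: \<theta>_def max_def field_simps split: if_splits)
    define y where "y t = (\<Sum>j\<in>F. \<theta> j * (cmod (b j t))\<^sup>2)" for t
    define y' where "y' t = (\<Sum>j\<in>F. \<theta> j * (2 * Im (cnj (b j t) * S j t)))" for t
    have dy: "(y has_vector_derivative y' t) (at t within {0..T})" for t
    proof -
      have "((\<lambda>t. (cmod (b j t))\<^sup>2) has_vector_derivative 2 * Im (cnj (b j t) * S j t)) (at t within {0..T})" for j
      proof -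
        have "((\<lambda>t. Re (b j t * cnj (b j t))) has_vector_derivative
            Re (b j t * cnj (b' j t) + b' j t * cnj (b j t))) (at t within {0..T})"
          by (intro bounded_linear.has_vector_derivative[OF bounded_linear_Re] has_vector_derivative_mult
              bounded_linear.has_vector_derivative[OF bounded_linear_cnj] has_vector_derivative_at_within[OF sb(1)])
        moreover have "Re (b j t * cnj (b' j t) + b' j t * cnj (b j t)) = 2 * Im (cnj (b j t) * S j t)"
          by (simp add: S_def algebra_simps)
        ultimately show ?thesis by (simp add: complex_mult_cnj cmod_power2)
      qed
      then show ?thesis unfolding y_def[abs_def] y'_def
        by (intro has_vector_derivative_sum has_vector_derivative_mult_right)
    qed
    have y'b: "norm (y' t) \<le> K / J" if t: "t \<in> {0..T}" for t
    proof -
      define P where "P j k = cnj (b j t) * v 0 t (j - k) * b k t" for j k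
      define E where "E j = S j t - (\<Sum>k\<in>F. v 0 t (j - k) * b k t)" for j
      \<comment> \<open>By this antisymmetry the double sum can be symmetrised:
        \<open>2 * \<theta> j\<close> turns into \<open>\<theta> j - \<theta> k\<close>, which is
        small by the Lipschitz bound.\<close>
      have Pswap: "Im (P k j) = - Im (P j k)" for j k
      proof -
        have "P k j = cnj (P j k)" using v_sym[of t "j - k"] by (simp add: P_def mult_ac)
        then show ?thesis by simp
      qed
      have split: "y' t = 2 * (\<Sum>j\<in>F. \<Sum>k\<in>F. \<theta> j * Im (P j k)) + 2 * (\<Sum>j\<in>F. \<theta> j * Im (cnj (b j t) * E j))"
      proof -
        have "cnj (b j t) * S j t = (\<Sum>k\<in>F. P j k) + cnj (b j t) * E j" for j
          by (simp add: P_def E_def right_diff_distrib sum_distrib_left mult_ac)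
        then show ?thesis unfolding y'_def
          by (simp add: Im_sum sum_distrib_left sum.distrib ring_distribs mult_ac)
      qed
      have "(\<Sum>j\<in>F. \<Sum>k\<in>F. \<theta> j * Im (P j k)) = (\<Sum>j\<in>F. \<Sum>k\<in>F. - (\<theta> k * Im (P j k)))"
      proof (subst sum.swap, intro sum.cong refl)
        fix j k
        show "\<theta> k * Im (P k j) = - (\<theta> k * Im (P j k))" by (subst Pswap) simp
      qed
      then have "2 * (\<Sum>j\<in>F. \<Sum>k\<in>F. \<theta> j * Im (P j k)) = (\<Sum>j\<in>F. \<Sum>k\<in>F. (\<theta> j - \<theta> k) * Im (P j k))"
        by (simp add: left_diff_distrib sum_subtractf sum_negf)
      also have "\<bar>\<dots>\<bar> \<le> (\<Sum>j\<in>F. \<Sum>k\<in>F. norm (int_vec (j - k) :: real ^ 'd) / J * cmod (v 0 t (j - k)) * (((cmod (b j t))\<^sup>2 + (cmod (b k t))\<^sup>2) / 2))"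
      proof (intro order_trans[OF sum_abs sum_mono])
        fix j k
        have ag: "cmod (b j t) * cmod (b k t) \<le> ((cmod (b j t))\<^sup>2 + (cmod (b k t))\<^sup>2) / 2"
          using zero_le_power2[of "cmod (b j t) - cmod (b k t)"] by (simp add: power2_diff)
        have "\<bar>(\<theta> j - \<theta> k) * Im (P j k)\<bar> \<le> norm (int_vec (j - k) :: real ^ 'd) / J * cmod (P j k)"
          unfolding abs_mult by (intro mult_mono \<theta>lip abs_Im_le_cmod) (use J in auto)
        also have "cmod (P j k) = cmod (v 0 t (j - k)) * (cmod (b j t) * cmod (b k t))"
          by (simp add: P_def norm_mult)
        also have "norm (int_vec (j - k) :: real ^ 'd) / J * \<dots> \<le> norm (int_vec (j - k) :: real ^ 'd) / J * (cmod (v 0 t (j - k)) * (((cmod (b j t))\<^sup>2 + (cmod (b k t))\<^sup>2) / 2))"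
          by (intro mult_left_mono ag) (use J in auto)
        finally show "\<bar>(\<theta> j - \<theta> k) * Im (P j k)\<bar> \<le> norm (int_vec (j - k) :: real ^ 'd) / J * cmod (v 0 t (j - k)) * (((cmod (b j t))\<^sup>2 + (cmod (b k t))\<^sup>2) / 2)"
          by (simp add: mult.assoc)
      qed
      also have "\<dots> = 1 / J * ((\<Sum>j\<in>F. (cmod (b j t))\<^sup>2 * (\<Sum>k\<in>F. norm (int_vec (j - k) :: real ^ 'd) * cmod (v 0 t (j - k)))) / 2
            + (\<Sum>k\<in>F. (cmod (b k t))\<^sup>2 * (\<Sum>j\<in>F. norm (int_vec (j - k) :: real ^ 'd) * cmod (v 0 t (j - k)))) / 2)"
      proof -
        have "(\<Sum>k\<in>F. (cmod (b k t))\<^sup>2 * (\<Sum>j\<in>F. norm (int_vec (j - k) :: real ^ 'd) * cmod (v 0 t (j - k))))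
          = (\<Sum>j\<in>F. \<Sum>k\<in>F. (cmod (b k t))\<^sup>2 * (norm (int_vec (j - k) :: real ^ 'd) * cmod (v 0 t (j - k))))"
          unfolding sum_distrib_left by (rule sum.swap)
        then show ?thesis
          by (simp add: sum_distrib_left sum_divide_distrib sum.distrib[symmetric] add_divide_distrib[symmetric] field_simps)
      qed
      also have "\<dots> \<le> 1 / J * (B * C1 / 2 + B * C1 / 2)"
      proof -
        have r1: "(\<Sum>k\<in>F. norm (int_vec (j - k) :: real ^ 'd) * cmod (v 0 t (j - k))) \<le> C1" for j
        proof -
          have "(\<Sum>k\<in>F. norm (int_vec (j - k) :: real ^ 'd) * cmod (v 0 t (j - k))) = (\<Sum>l\<in>(\<lambda>k. j - k) ` F. norm (int_vec l :: real ^ 'd) * cmod (v 0 t l))"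
            by (subst sum.reindex) (auto simp: inj_on_def)
          then show ?thesis using C1(2) F(1) by simp
        qed
        have r2: "(\<Sum>j\<in>F. norm (int_vec (j - k) :: real ^ 'd) * cmod (v 0 t (j - k))) \<le> C1" for k
        proof -
          have "(\<Sum>j\<in>F. norm (int_vec (j - k) :: real ^ 'd) * cmod (v 0 t (j - k))) = (\<Sum>l\<in>(\<lambda>j. j - k) ` F. norm (int_vec l :: real ^ 'd) * cmod (v 0 t l))"
            by (subst sum.reindex) (auto simp: inj_on_def)
          then show ?thesis using C1(2) F(1) by simp
        qed
        have s: "(\<Sum>j\<in>F. (cmod (b j t))\<^sup>2 * f j) \<le> B * C1" if "\<And>j. f j \<le> C1" for f
        proof -
          have "(\<Sum>j\<in>F. (cmod (b j t))\<^sup>2 * f j) \<le> (\<Sum>j\<in>F. (cmod (b j t))\<^sup>2 * C1)"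
            by (intro sum_mono mult_left_mono that) auto
          also have "\<dots> \<le> B * C1"
            unfolding sum_distrib_right[symmetric] by (rule mult_right_mono[OF B[OF F(1) t] C1(1)])
          finally show ?thesis .
        qed
        show ?thesis by (intro mult_left_mono add_mono divide_right_mono s r1 r2) (use J in auto)
      qed
      finally have p1: "\<bar>2 * (\<Sum>j\<in>F. \<Sum>k\<in>F. \<theta> j * Im (P j k))\<bar> \<le> C1 * B / J" by (simp add: mult.commute)
      have Eb: "cmod (E j) \<le> Ct / (1 + J) ^ (?D + 1) * \<beta>" if j: "norm (int_vec j :: real ^ 'd) \<le> J" for j
      proof -
        define g where "g k = (if k \<in> F then v 0 t (j - k) * b k t else 0)" for k
        have "cmod (S j t - (\<Sum>k\<in>F. g k)) \<le> Ct / (1 + J) ^ (?D + 1) * \<beta>"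
        proof (rule has_sum_diff_norm_le[OF Ssum F(1)])
          fix Y :: "(int ^ 'd) set" assume Y: "finite Y"
          have "(\<Sum>k\<in>Y. cmod (v 0 t (j - k) * b k t - g k)) = (\<Sum>k\<in>Y - F. cmod (v 0 t (j - k) * b k t - g k))"
            by (rule sum.mono_neutral_right) (use Y in \<open>auto simp: g_def\<close>)
          also have "\<dots> \<le> (\<Sum>k\<in>Y - F. cmod (v 0 t (j - k)) * \<beta>)"
            by (rule sum_mono) (simp add: g_def norm_mult mult_left_mono b\<beta>[OF t])
          also have "\<dots> = (\<Sum>k\<in>Y - F. cmod (v 0 t (j - k))) * \<beta>" by (simp add: sum_distrib_right)
          also have "(\<Sum>k\<in>Y - F. cmod (v 0 t (j - k))) = (\<Sum>l\<in>(\<lambda>k. j - k) ` (Y - F). cmod (v 0 t l))"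
            by (subst sum.reindex) (auto simp: inj_on_def)
          also have "\<dots> \<le> Ct / (1 + J) ^ (?D + 1)"
          proof (rule Ct(2))
            show "\<forall>m\<in>(\<lambda>k. j - k) ` (Y - F). J \<le> norm (int_vec m :: real ^ 'd)"
            proof clarify
              fix k assume "k \<notin> F"
              then have "2 * J < norm (int_vec k :: real ^ 'd)" by (simp add: F_def)
              then show "J \<le> norm (int_vec (j - k) :: real ^ 'd)"
                using norm_triangle_ineq3[of "int_vec j" "int_vec k :: real ^ 'd"] j unfolding int_vec_diff by linarith
            qed
          qed (use Y J in auto)
          finally show "(\<Sum>k\<in>Y. cmod (v 0 t (j - k) * b k t - g k)) \<le> Ct / (1 + J) ^ (?D + 1) * \<beta>"
            using \<beta> by (simp add: mult_right_mono)
        qed (simp add: g_def)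
        then show ?thesis by (simp add: E_def g_def)
      qed
      have "\<bar>\<Sum>j\<in>F. \<theta> j * Im (cnj (b j t) * E j)\<bar> \<le> (\<Sum>j\<in>F. \<beta> * (Ct / (1 + J) ^ (?D + 1) * \<beta>))"
      proof (intro order_trans[OF sum_abs sum_mono])
        fix j
        show "\<bar>\<theta> j * Im (cnj (b j t) * E j)\<bar> \<le> \<beta> * (Ct / (1 + J) ^ (?D + 1) * \<beta>)"
        proof (cases "\<theta> j = 0")
          case True
          then show ?thesis using \<beta> Ct J by simp
        next
          case False
          have "\<bar>\<theta> j * Im (cnj (b j t) * E j)\<bar> \<le> 1 * cmod (cnj (b j t) * E j)"
            unfolding abs_mult by (intro mult_mono abs_Im_le_cmod) (use \<theta>01 in auto)
          also have "\<dots> \<le> \<beta> * (Ct / (1 + J) ^ (?D + 1) * \<beta>)"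
            unfolding norm_mult mult_1 complex_mod_cnj
            by (intro mult_mono b\<beta> t Eb \<theta>F False) (use \<beta> in auto)
          finally show ?thesis .
        qed
      qed
      also have "\<dots> = real (card F) * (Ct * B / (1 + J) ^ (?D + 1))" using \<beta>(2) by (simp add: mult_ac)
      also have "\<dots> \<le> (4 ^ ?D * (1 + J) ^ ?D) * (Ct * B / (1 + J) ^ (?D + 1))"
        by (rule mult_right_mono[OF F(2)]) (use Ct B0 J in simp)
      also have "\<dots> = 4 ^ ?D * Ct * B / (1 + J)" using J by (simp add: power_add)
      also have "\<dots> \<le> 4 ^ ?D * Ct * B / J" using J Ct B0 by (intro divide_left_mono) auto
      finally have p2: "\<bar>\<Sum>j\<in>F. \<theta> j * Im (cnj (b j t) * E j)\<bar> \<le> 4 ^ ?D * Ct * B / J" .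
      have "norm (y' t) \<le> C1 * B / J + 2 * (4 ^ ?D * Ct * B / J)"
        unfolding split using p1 p2 by (simp add: abs_le_iff)
      then show ?thesis by (simp add: K_def add_divide_distrib)
    qed
    have "norm (y t - y 0) \<le> K / J * t"
      by (rule vector_derivative_increment_bound[OF dy y'b t])
    also have "\<dots> \<le> K / J * T" using t K J by (intro mult_left_mono) auto
    finally have "y t \<le> y 0 + K * T / J" by simp
    also have "y 0 \<le> m"
    proof -
      have "y 0 \<le> (\<Sum>j\<in>F. (cmod (b j 0))\<^sup>2)"
        unfolding y_def by (rule sum_mono) (simp add: mult_left_le_one_le \<theta>01)
      then show ?thesis using m[OF F(1)] by simp
    qed
    finally have yt: "y t \<le> m + K * T / J" by simp
    have "(\<Sum>j\<in>X. \<theta> j * (cmod (b j t))\<^sup>2) \<le> y t"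
    proof -
      have "(\<Sum>j\<in>X. \<theta> j * (cmod (b j t))\<^sup>2) \<le> (\<Sum>j\<in>X \<union> F. \<theta> j * (cmod (b j t))\<^sup>2)"
        by (rule sum_mono2) (use X F \<theta>01 in auto)
      also have "\<dots> = y t" unfolding y_def
      proof (rule sum.mono_neutral_right)
        show "\<forall>i\<in>X \<union> F - F. \<theta> i * (cmod (b i t))\<^sup>2 = 0"
        proof
          fix i assume "i \<in> X \<union> F - F"
          then have "\<not> norm (int_vec i :: real ^ 'd) \<le> J" using J by (auto simp: F_def)
          then have "\<theta> i = 0" using \<theta>F by blast
          then show "\<theta> i * (cmod (b i t))\<^sup>2 = 0" by simp
        qed
      qed (use X F in auto)
      finally show ?thesis .
    qed
    moreover have "(\<Sum>j\<in>X. (cmod (b j t))\<^sup>2) - R / J * B \<le> (\<Sum>j\<in>X. \<theta> j * (cmod (b j t))\<^sup>2)"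
    proof -
      have "(\<Sum>j\<in>X. (cmod (b j t))\<^sup>2) - (\<Sum>j\<in>X. \<theta> j * (cmod (b j t))\<^sup>2) = (\<Sum>j\<in>X. (1 - \<theta> j) * (cmod (b j t))\<^sup>2)"
        by (simp add: left_diff_distrib sum_subtractf)
      also have "\<dots> \<le> (\<Sum>j\<in>X. R / J * (cmod (b j t))\<^sup>2)"
      proof (intro sum_mono mult_right_mono)
        fix j assume "j \<in> X"
        then have "norm (int_vec j :: real ^ 'd) / J \<le> R / J" using R J by (intro divide_right_mono) auto
        then show "1 - \<theta> j \<le> R / J" unfolding \<theta>_def by linarith
      qed auto
      also have "\<dots> \<le> R / J * B"
        unfolding sum_distrib_left[symmetric] by (rule mult_left_mono[OF B[OF X t]]) (use R J in simp)
      finally show ?thesis by linarith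
    qed
    ultimately have "(\<Sum>j\<in>X. (cmod (b j t))\<^sup>2) \<le> m + K * T / J + R / J * B" using yt by linarith
    then show ?thesis by (simp add: add_divide_distrib)
  qed
  show ?thesis
  proof (rule field_le_epsilon)
    fix e :: real assume e: "0 < e"
    let ?c = "K * T + R * B"
    have c: "0 \<le> ?c" using K T R B0 by simp
    define J where "J = 1 + ?c / e"
    have J: "1 \<le> J" using c e by (simp add: J_def)
    have "?c \<le> e * J" using e c by (simp add: J_def field_simps)
    then have "?c / J \<le> e" using J by (simp add: pos_divide_le_eq)
    then show "(\<Sum>k\<in>X. (cmod (b k t))\<^sup>2) \<le> m + e" using main[OF J] by linarith
  qed
qed

end

section \<open>Dyadic summation and growth for positive times\<close>

lemma bracket_ge_1: "1 \<le> bracket x"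
  by (simp add: bracket_def)

lemma norm_le_bracket: "norm x \<le> bracket x"
  unfolding bracket_def by (rule real_le_rsqrt) simp

lemma bracket_le: "bracket x \<le> 1 + norm x"
  unfolding bracket_def by (rule real_le_lsqrt) (auto simp: power2_eq_square algebra_simps)

lemma power2_between:
  assumes "1 \<le> (x :: real)"
  shows "\<exists>p::nat. x \<le> 2 ^ p \<and> 2 ^ p \<le> 2 * x"
proof -
  obtain n :: nat where n: "x < 2 ^ n" using real_arch_pow[of 2 x] by auto
  define p where "p = (LEAST p. x \<le> 2 ^ p)"
  have p: "x \<le> 2 ^ p" unfolding p_def by (rule LeastI[of _ n]) (use n in simp)
  have "(2::real) ^ p \<le> 2 * x"
  proof (cases p)
    case 0
    then show ?thesis using assms by simp
  next
    case (Suc q)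
    have "\<not> x \<le> 2 ^ q" using not_less_Least[of q "\<lambda>p. x \<le> 2 ^ p"] Suc by (simp add: p_def)
    then show ?thesis using Suc by simp
  qed
  with p show ?thesis by blast
qed

lemma geometric_sum_le:
  assumes "1 < (\<rho> :: real)"
  shows "(\<Sum>p\<le>s. \<rho> ^ p) \<le> \<rho> / (\<rho> - 1) * \<rho> ^ s"
proof -
  have "(\<Sum>p\<le>s. \<rho> ^ p) = (\<rho> ^ Suc s - 1) / (\<rho> - 1)"
    using assms geometric_sum[of \<rho> "Suc s"] by (simp add: lessThan_Suc_atMost)
  also have "\<dots> \<le> \<rho> ^ Suc s / (\<rho> - 1)" using assms by (intro divide_right_mono) auto
  finally show ?thesis by simp
qed

lemma half_sum_le: "(\<Sum>p\<in>{p1..P}. (1/2 :: real) ^ p) \<le> 2"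
proof -
  have "(\<Sum>p\<in>{p1..P}. (1/2 :: real) ^ p) \<le> (\<Sum>p. (1/2 :: real) ^ p)"
    by (rule sum_le_suminf) (auto intro: summable_geometric)
  then show ?thesis by (simp add: suminf_geometric)
qed

context fourier_potential
begin

text \<open>The weight is dominated by a constant on low modes plus dyadic steps
  \<open>\<rho> ^ p\<close> on \<open>2 * 2 ^ p < |j|\<close>. From level \<open>p1\<close> on,
  where \<open>2 ^ p1\<close> is about \<open>\<langle>t\<rangle>\<close> to the power
  \<open>\<epsilon> / r\<close>, each step is estimated by \<open>one_scale\<close> through the mass
  beyond \<open>2 ^ p\<close> at time 0, and the steps add up to the weight again. Below
  \<open>p1\<close> only the mass bound is used; this part is responsible for the growth.\<close>

lemma forward_growth:
  assumes r: "0 < r" and \<epsilon>: "0 < \<epsilon>"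
  shows "\<exists>C>0. \<forall>b b' H t X. seq_solution b b' \<longrightarrow> 0 \<le> t \<longrightarrow>
      (\<exists>B. \<forall>X s. finite X \<longrightarrow> s \<in> {0..t} \<longrightarrow> (\<Sum>j\<in>X. (cmod (b j s))\<^sup>2) \<le> B) \<longrightarrow>
      (\<forall>X. finite X \<longrightarrow> (\<Sum>j\<in>X. bracket (int_vec j) powr (2 * r) * (cmod (b j 0))\<^sup>2) \<le> H) \<longrightarrow> finite X \<longrightarrow>
      (\<Sum>j\<in>X. bracket (int_vec j) powr (2 * r) * (cmod (b j t))\<^sup>2) \<le> C * bracket t powr (2 * \<epsilon>) * H"
proof -
  define e where "e = \<epsilon> / r"
  have e: "0 < e" using r \<epsilon> by (simp add: e_def)
  \<comment> \<open>From level \<open>p1\<close> on \<open>2 ^ p\<close> is at least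
    \<open>bracket t powr e\<close>, so \<open>e * E \<ge> 1\<close> puts \<open>t\<close> within
    the time \<open>(2 ^ p) ^ E\<close> of \<open>one_scale\<close>. The choice of \<open>Q\<close>
    lets the error beat \<open>\<rho> ^ p\<close> by a factor \<open>2 ^ - p\<close>, which makes it
    summable over the levels.\<close>
  obtain E :: nat where E: "1 / e \<le> real E" using real_arch_simple by blast
  obtain Q :: nat where Q: "2 * r + 1 \<le> real Q" using real_arch_simple by blast
  obtain C p0 where C: "0 \<le> C" and scale: "\<And>p T b b' m Z. p0 \<le> p \<Longrightarrow> 0 \<le> T \<Longrightarrow> T \<le> (2 ^ p) ^ E \<Longrightarrow> seq_solution b b' \<Longrightarrow> 0 \<le> m \<Longrightarrow>
     (\<forall>X t. finite X \<longrightarrow> t \<in> {0..T} \<longrightarrow> (\<Sum>k\<in>X. (cmod (b k t))\<^sup>2) \<le> m\<^sup>2) \<Longrightarrow>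
     finite Z \<Longrightarrow> (\<forall>j\<in>Z. 2 * 2 ^ p < norm (int_vec j)) \<Longrightarrow>
     (\<Sum>j\<in>Z. (cmod (b j T))\<^sup>2) \<le> m\<^sup>2 - (\<Sum>j | norm (int_vec j) \<le> 2 ^ p. (cmod (b j 0))\<^sup>2) + C / (2 ^ p) ^ Q * m\<^sup>2"
    using one_scale[of E Q] by metis
  define \<rho> where "\<rho> = 2 powr (2 * r)"
  have \<rho>: "1 < \<rho>" using r by (simp add: \<rho>_def gr_one_powr)
  have \<rho>p: "(2 ^ p) powr (2 * r) = \<rho> ^ p" for p :: nat
    unfolding \<rho>_def by (simp add: powr_realpow[symmetric] powr_powr mult.commute)
  \<comment> \<open>The 5 comes from \<open>bracket x \<le> 1 + 4 * 2 ^ p \<le> 5 * 2 ^ p\<close> on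
    the shell of level \<open>p\<close>.\<close>
  define A0 where "A0 = 5 powr (2 * r)"
  define G where "G = \<rho> / (\<rho> - 1)"
  have A0: "1 \<le> A0" using r by (simp add: A0_def ge_one_powr_ge_zero)
  have G: "0 \<le> G" using \<rho> by (simp add: G_def)
  define K1 where "K1 = (2 * 2 ^ p0) powr (2 * r)"
  have K1: "0 < K1" by (simp add: K1_def)
  define wt where "wt j = bracket (int_vec j :: real ^ 'd) powr (2 * r)" for j
  have wt1: "1 \<le> wt j" for j unfolding wt_def using r bracket_ge_1 by (intro ge_one_powr_ge_zero) auto
  define C' where "C' = A0 * K1 + A0 * G + 2 * A0 * C"
  have C'0: "0 < C'" unfolding C'_def using A0 K1 G C by (intro add_pos_nonneg mult_pos_pos mult_nonneg_nonneg) auto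
  have main: "(\<Sum>j\<in>X. wt j * (cmod (b j t))\<^sup>2) \<le> C' * bracket t powr (2 * \<epsilon>) * H"
    if sol: "seq_solution b b'" and t: "0 \<le> t" and B: "\<exists>B. \<forall>X s. finite X \<longrightarrow> s \<in> {0..t} \<longrightarrow> (\<Sum>j\<in>X. (cmod (b j s))\<^sup>2) \<le> B"
      and H: "\<And>X. finite X \<Longrightarrow> (\<Sum>j\<in>X. wt j * (cmod (b j 0))\<^sup>2) \<le> H" and X: "finite X" for b b' H t X
  proof -
    have H0: "0 \<le> H" using H[of "{}"] by simp
    have fin1: "(\<Sum>j\<in>X. (cmod (b j 0))\<^sup>2) \<le> H" if "finite X" for X
    proof -
      have "(\<Sum>j\<in>X. (cmod (b j 0))\<^sup>2) \<le> (\<Sum>j\<in>X. wt j * (cmod (b j 0))\<^sup>2)"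
        by (rule sum_mono) (use mult_right_mono[OF wt1 zero_le_power2] in simp)
      then show ?thesis using H[OF that] by linarith
    qed
    have summ: "(\<lambda>j. (cmod (b j 0))\<^sup>2) summable_on UNIV"
      by (rule nonneg_bdd_above_summable_on) (use fin1 in \<open>auto intro!: bdd_aboveI2\<close>)
    define M where "M = (\<Sum>\<^sub>\<infinity>j. (cmod (b j 0))\<^sup>2)"
    have M_le: "(\<Sum>j\<in>X. (cmod (b j 0))\<^sup>2) \<le> M" if "finite X" for X
      unfolding M_def by (rule finite_sum_le_infsum[OF summ that]) auto
    have MH: "M \<le> H" unfolding M_def by (rule infsum_le_finite_sums[OF summ]) (use fin1 in auto)
    have M0: "0 \<le> M" using M_le[of "{}"] by simp
    obtain B where B: "\<And>X s. finite X \<Longrightarrow> s \<in> {0..t} \<Longrightarrow> (\<Sum>j\<in>X. (cmod (b j s))\<^sup>2) \<le> B" using B by blast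
    have mass: "(\<Sum>j\<in>X. (cmod (b j s))\<^sup>2) \<le> M" if "finite X" "s \<in> {0..t}" for X s
      by (rule mass_bound[OF sol B M_le that])
    \<comment> \<open>The factor \<open>2 ^ p0\<close> forces \<open>p0 \<le> p1\<close>, so that
      \<open>one_scale\<close> applies at every level from \<open>p1\<close> on.\<close>
    define x where "x = 2 ^ p0 * bracket t powr e"
    have bt1: "1 \<le> bracket t powr e" using e bracket_ge_1 by (intro ge_one_powr_ge_zero) auto
    have x1: "1 \<le> x" unfolding x_def using bt1 by (metis mult_mono' mult_1 one_le_power one_le_numeral zero_le_one)
    obtain p1 :: nat where p1: "x \<le> 2 ^ p1" "2 ^ p1 \<le> 2 * x" using power2_between[OF x1] by blast
    have p01: "p0 \<le> p1"
    proof -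
      have "(2::real) ^ p0 \<le> x" unfolding x_def using bt1 by simp
      then have "(2::real) ^ p0 \<le> 2 ^ p1" using p1 by linarith
      then show ?thesis by simp
    qed
    have time: "t \<le> (2 ^ p) ^ E" if p: "p1 \<le> p" for p
    proof -
      have bx: "bracket t powr e \<le> x"
        unfolding x_def using mult_right_mono[of 1 "2 ^ p0" "bracket t powr e"] bt1 by simp
      have "x \<le> 2 ^ p" by (rule order_trans[OF p1(1) power_increasing[OF p]]) simp
      then have bp: "bracket t powr e \<le> 2 ^ p" using bx by linarith
      have "t \<le> bracket t" using norm_le_bracket[of t] t by simp
      also have "\<dots> = (bracket t powr e) powr (1 / e)" using e bracket_ge_1[of t] by (simp add: powr_powr)
      also have "\<dots> \<le> (2 ^ p) powr (1 / e)" using bp e by (intro powr_mono2) auto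
      also have "\<dots> \<le> (2 ^ p) powr real E" using E by (intro powr_mono) auto
      also have "\<dots> = (2 ^ p) ^ E" by (simp add: powr_realpow)
      finally show ?thesis .
    qed
    define n where "n j = norm (int_vec j :: real ^ 'd)" for j
    obtain R where R: "\<And>j. j \<in> X \<Longrightarrow> n j \<le> R"
      using X by (metis finite_imageI finite_nat_set_iff_bounded_le imageI bdd_above_finite bdd_above_def)
    obtain P0 :: nat where P0: "R < 2 ^ P0" using real_arch_pow[of 2 R] by auto
    define P where "P = max P0 p1"
    have XP: "n j \<le> 2 * 2 ^ P" if "j \<in> X" for j
    proof -
      have "(2::real) ^ P0 \<le> 2 ^ P" by (rule power_increasing) (auto simp: P_def)
      then show ?thesis using R[OF that] P0 zero_le_power[of "2::real" P] by linarith
    qed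
    have wtb: "wt j \<le> A0 * \<rho> ^ p" if "n j \<le> 4 * 2 ^ p" for j and p :: nat
    proof -
      have "(1::real) \<le> 2 ^ p" by simp
      then have "bracket (int_vec j :: real ^ 'd) \<le> 5 * 2 ^ p"
        using bracket_le[of "int_vec j :: real ^ 'd"] that unfolding n_def by linarith
      then have "wt j \<le> (5 * 2 ^ p) powr (2 * r)"
        unfolding wt_def using r bracket_ge_1[of "int_vec j :: real ^ 'd"] by (intro powr_mono2) auto
      then show ?thesis by (simp add: powr_mult A0_def \<rho>p)
    qed
    have wdec: "wt j \<le> A0 * \<rho> ^ p1 + (\<Sum>p\<in>{p1..P}. A0 * \<rho> ^ p * of_bool (2 * 2 ^ p < n j))" if j: "j \<in> X" for j
    proof (cases "n j \<le> 2 * 2 ^ p1")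
      case True
      have "wt j \<le> A0 * \<rho> ^ p1" by (rule wtb) (use True in \<open>auto intro: order_trans\<close>)
      moreover have "0 \<le> (\<Sum>p\<in>{p1..P}. A0 * \<rho> ^ p * of_bool (2 * 2 ^ p < n j))"
        using A0 \<rho> by (intro sum_nonneg mult_nonneg_nonneg) auto
      ultimately show ?thesis by linarith
    next
      case False
      \<comment> \<open>The highest level below \<open>j\<close>. Its single step already dominates
        the weight because \<open>n j \<le> 4 * 2 ^ s\<close>; the cap \<open>P\<close> lies above
        all of the finite set \<open>X\<close>.\<close>
      define s where "s = (GREATEST p. p \<le> P \<and> 2 * 2 ^ p < n j)"
      have ex: "p1 \<le> P \<and> 2 * 2 ^ p1 < n j" using False by (simp add: P_def)
      have s: "s \<le> P \<and> 2 * 2 ^ s < n j" unfolding s_def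
        by (rule GreatestI_nat[of "\<lambda>p. p \<le> P \<and> 2 * 2 ^ p < n j", OF ex, of P]) blast
      have sp: "p1 \<le> s" unfolding s_def
        by (rule Greatest_le_nat[of "\<lambda>p. p \<le> P \<and> 2 * 2 ^ p < n j", OF ex, of P]) blast
      have "n j \<le> 4 * 2 ^ s"
      proof (rule ccontr)
        assume *: "\<not> n j \<le> 4 * 2 ^ s"
        have "s \<noteq> P"
        proof
          assume eq: "s = P"
          have "(0::real) < 2 ^ P" by simp
          then show False using XP[OF j] *[unfolded eq] by linarith
        qed
        then have "Suc s \<le> P \<and> 2 * 2 ^ Suc s < n j" using s * by simp
        then have "Suc s \<le> (GREATEST p. p \<le> P \<and> 2 * 2 ^ p < n j)"
          by (rule Greatest_le_nat[of _ _ P]) blast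
        then show False unfolding s_def[symmetric] by simp
      qed
      then have "wt j \<le> A0 * \<rho> ^ s" by (rule wtb)
      also have "\<dots> = A0 * \<rho> ^ s * of_bool (2 * 2 ^ s < n j)" using s by simp
      also have "\<dots> \<le> (\<Sum>p\<in>{p1..P}. A0 * \<rho> ^ p * of_bool (2 * 2 ^ p < n j))"
        by (rule member_le_sum) (use s sp A0 \<rho> in auto)
      also have "\<dots> \<le> A0 * \<rho> ^ p1 + \<dots>" using A0 \<rho> by simp
      finally show ?thesis .
    qed
    have Qp: "\<rho> ^ p * (C / (2 ^ p) ^ Q * M) \<le> C * M * (1/2) ^ p" for p
    proof -
      have "\<rho> \<le> 2 powr (real Q - 1)" unfolding \<rho>_def using Q by (intro powr_mono) auto
      also have "\<dots> = 2 ^ Q / 2" by (simp add: powr_diff powr_realpow)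
      finally have "\<rho> / 2 ^ Q \<le> 1/2" by (simp add: field_simps)
      then have "(\<rho> / 2 ^ Q) ^ p \<le> (1/2) ^ p" using \<rho> by (intro power_mono) auto
      then have "C * M * (\<rho> / 2 ^ Q) ^ p \<le> C * M * (1/2) ^ p" using C M0 by (intro mult_left_mono) auto
      then show ?thesis by (simp add: power_divide power_mult[symmetric] mult.commute)
    qed
    \<comment> \<open>The mass beyond \<open>2 ^ p\<close> at time 0 is a part of an infinite sum.
      It is approximated by a finite set \<open>Y\<close> at the price of the deficit
      \<open>?\<delta>\<close>, whose coefficient does not depend on \<open>Y\<close>; hence
      \<open>lim\<close> can remove it.\<close>
    have key: "(\<Sum>j\<in>X. wt j * (cmod (b j t))\<^sup>2) \<le> A0 * \<rho> ^ p1 * M + A0 * (G * H + 2 * C * M)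
        + (\<Sum>p\<in>{p1..P}. A0 * \<rho> ^ p) * (M - (\<Sum>j\<in>Y. (cmod (b j 0))\<^sup>2))" if Y: "finite Y" for Y
    proof -
      let ?\<delta> = "M - (\<Sum>j\<in>Y. (cmod (b j 0))\<^sup>2)"
      have tt: "t \<in> {0..t}" using t by simp
      have piece: "(\<Sum>j\<in>X. of_bool (2 * 2 ^ p < n j) * (cmod (b j t))\<^sup>2)
          \<le> ?\<delta> + (\<Sum>j\<in>Y. of_bool (2 ^ p < n j) * (cmod (b j 0))\<^sup>2) + C / (2 ^ p) ^ Q * M" if p: "p1 \<le> p" for p
      proof -
        have finb: "finite {j :: int ^ 'd. norm (int_vec j) \<le> 2 ^ p}" by (rule int_ball_card(1)[of _ "2 ^ p"]) auto
        have "(\<Sum>j\<in>X. of_bool (2 * 2 ^ p < n j) * (cmod (b j t))\<^sup>2) = (\<Sum>j\<in>{j\<in>X. 2 * 2 ^ p < n j}. (cmod (b j t))\<^sup>2)"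
          using X by (simp add: sum.inter_filter of_bool_def if_distrib[of "\<lambda>b. b * _"] cong: if_cong)
        also have "\<dots> \<le> (sqrt M)\<^sup>2 - (\<Sum>j | norm (int_vec j) \<le> 2 ^ p. (cmod (b j 0))\<^sup>2) + C / (2 ^ p) ^ Q * (sqrt M)\<^sup>2"
          by (rule scale[OF _ t time[OF p] sol]) (use p p01 X M0 mass in \<open>auto simp: n_def\<close>)
        also have "(sqrt M)\<^sup>2 = M" using M0 by simp
        finally have "(\<Sum>j\<in>X. of_bool (2 * 2 ^ p < n j) * (cmod (b j t))\<^sup>2)
            \<le> M - (\<Sum>j | norm (int_vec j) \<le> 2 ^ p. (cmod (b j 0))\<^sup>2) + C / (2 ^ p) ^ Q * M" .
        moreover have "(\<Sum>j | norm (int_vec j) \<le> 2 ^ p. (cmod (b j 0))\<^sup>2) \<ge> (\<Sum>j\<in>Y. (cmod (b j 0))\<^sup>2) - (\<Sum>j\<in>Y. of_bool (2 ^ p < n j) * (cmod (b j 0))\<^sup>2)"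
        proof -
          have "(\<Sum>j\<in>Y. (cmod (b j 0))\<^sup>2) - (\<Sum>j\<in>Y. of_bool (2 ^ p < n j) * (cmod (b j 0))\<^sup>2)
             = (\<Sum>j\<in>Y. if n j \<le> 2 ^ p then (cmod (b j 0))\<^sup>2 else 0)"
            unfolding sum_subtractf[symmetric] by (intro sum.cong) auto
          also have "\<dots> = (\<Sum>j\<in>{j\<in>Y. n j \<le> 2 ^ p}. (cmod (b j 0))\<^sup>2)" using Y by (simp add: sum.inter_filter)
          also have "\<dots> \<le> (\<Sum>j | norm (int_vec j) \<le> 2 ^ p. (cmod (b j 0))\<^sup>2)"
            by (rule sum_mono2[OF finb]) (auto simp: n_def)
          finally show ?thesis .
        qed
        ultimately show ?thesis by linarith
      qed
      have "(\<Sum>j\<in>X. wt j * (cmod (b j t))\<^sup>2)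
         \<le> (\<Sum>j\<in>X. (A0 * \<rho> ^ p1 + (\<Sum>p\<in>{p1..P}. A0 * \<rho> ^ p * of_bool (2 * 2 ^ p < n j))) * (cmod (b j t))\<^sup>2)"
        by (intro sum_mono mult_right_mono wdec) auto
      also have "\<dots> = A0 * \<rho> ^ p1 * (\<Sum>j\<in>X. (cmod (b j t))\<^sup>2)
          + (\<Sum>p\<in>{p1..P}. A0 * \<rho> ^ p * (\<Sum>j\<in>X. of_bool (2 * 2 ^ p < n j) * (cmod (b j t))\<^sup>2))"
        unfolding distrib_right sum.distrib sum_distrib_left sum_distrib_right
        by (subst (2) sum.swap) (simp add: mult.assoc)
      also have "\<dots> \<le> A0 * \<rho> ^ p1 * M
          + (\<Sum>p\<in>{p1..P}. A0 * \<rho> ^ p * (?\<delta> + (\<Sum>j\<in>Y. of_bool (2 ^ p < n j) * (cmod (b j 0))\<^sup>2) + C / (2 ^ p) ^ Q * M))"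
        by (intro add_mono mult_left_mono sum_mono mass[OF X tt] piece) (use A0 \<rho> in auto)
      also have "(\<Sum>p\<in>{p1..P}. A0 * \<rho> ^ p * (?\<delta> + (\<Sum>j\<in>Y. of_bool (2 ^ p < n j) * (cmod (b j 0))\<^sup>2) + C / (2 ^ p) ^ Q * M))
         = (\<Sum>p\<in>{p1..P}. A0 * \<rho> ^ p) * ?\<delta> + A0 * (\<Sum>p\<in>{p1..P}. \<rho> ^ p * (\<Sum>j\<in>Y. of_bool (2 ^ p < n j) * (cmod (b j 0))\<^sup>2))
           + A0 * (\<Sum>p\<in>{p1..P}. \<rho> ^ p * (C / (2 ^ p) ^ Q * M))"
        unfolding sum_distrib_right[of _ _ ?\<delta>] sum_distrib_left[of A0] sum.distrib[symmetric]
        by (intro sum.cong refl) (simp only: distrib_left mult.assoc)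
      also have "(\<Sum>p\<in>{p1..P}. \<rho> ^ p * (\<Sum>j\<in>Y. of_bool (2 ^ p < n j) * (cmod (b j 0))\<^sup>2)) \<le> G * H"
      proof -
        have "(\<Sum>p\<in>{p1..P}. \<rho> ^ p * (\<Sum>j\<in>Y. of_bool (2 ^ p < n j) * (cmod (b j 0))\<^sup>2))
           = (\<Sum>j\<in>Y. (\<Sum>p\<in>{p1..P}. \<rho> ^ p * of_bool (2 ^ p < n j)) * (cmod (b j 0))\<^sup>2)"
          unfolding sum_distrib_left sum_distrib_right by (subst sum.swap) (simp add: mult.assoc)
        also have "\<dots> \<le> (\<Sum>j\<in>Y. (G * wt j) * (cmod (b j 0))\<^sup>2)"
        proof (intro sum_mono mult_right_mono)
          fix j
          let ?S = "{p \<in> {p1..P}. 2 ^ p < n j}"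
          have eq: "(\<Sum>p\<in>{p1..P}. \<rho> ^ p * of_bool (2 ^ p < n j)) = (\<Sum>p\<in>?S. \<rho> ^ p)"
            by (rule sum.mono_neutral_cong_right) auto
          show "(\<Sum>p\<in>{p1..P}. \<rho> ^ p * of_bool (2 ^ p < n j)) \<le> G * wt j"
          proof (cases "?S = {}")
            case True
            then show ?thesis unfolding eq True using G wt1[of j] by simp
          next
            case False
            define s where "s = Max ?S"
            have s: "s \<in> ?S" unfolding s_def by (rule Max_in) (use False in auto)
            have "(\<Sum>p\<in>?S. \<rho> ^ p) \<le> (\<Sum>p\<le>s. \<rho> ^ p)"
              by (rule sum_mono2) (use \<rho> in \<open>auto simp: s_def\<close>)
            also have "\<dots> \<le> G * \<rho> ^ s" unfolding G_def by (rule geometric_sum_le[OF \<rho>])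
            also have "\<rho> ^ s \<le> wt j"
            proof -
              have "2 ^ s \<le> bracket (int_vec j :: real ^ 'd)"
                using s norm_le_bracket[of "int_vec j :: real ^ 'd"] by (simp add: n_def)
              then show ?thesis unfolding wt_def \<rho>p[symmetric] using r by (intro powr_mono2) auto
            qed
            finally show ?thesis unfolding eq using G by (simp add: mult_left_mono)
          qed
        qed auto
        also have "\<dots> = G * (\<Sum>j\<in>Y. wt j * (cmod (b j 0))\<^sup>2)" by (simp add: sum_distrib_left mult.assoc)
        also have "\<dots> \<le> G * H" by (rule mult_left_mono[OF H[OF Y] G])
        finally show ?thesis .
      qed
      also have "(\<Sum>p\<in>{p1..P}. \<rho> ^ p * (C / (2 ^ p) ^ Q * M)) \<le> 2 * C * M"
      proof -
        have "(\<Sum>p\<in>{p1..P}. \<rho> ^ p * (C / (2 ^ p) ^ Q * M)) \<le> C * M * (\<Sum>p\<in>{p1..P}. (1/2) ^ p)"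
          unfolding sum_distrib_left by (intro sum_mono Qp)
        also have "\<dots> \<le> C * M * 2" by (rule mult_left_mono[OF half_sum_le]) (use C M0 in simp)
        finally show ?thesis by simp
      qed
      finally show ?thesis using A0 by (simp add: algebra_simps mult_left_mono)
    qed
    have lim: "(\<Sum>j\<in>X. wt j * (cmod (b j t))\<^sup>2) \<le> A0 * \<rho> ^ p1 * M + A0 * (G * H + 2 * C * M)"
    proof (rule field_le_epsilon)
      fix d :: real assume d: "0 < d"
      let ?c = "\<Sum>p\<in>{p1..P}. A0 * \<rho> ^ p"
      have c0: "0 \<le> ?c" using A0 \<rho> by (intro sum_nonneg) auto
      have "\<exists>Y. finite Y \<and> M - d / (1 + ?c) < (\<Sum>j\<in>Y. (cmod (b j 0))\<^sup>2)"
      proof (rule ccontr)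
        assume "\<not> ?thesis"
        then have "M \<le> M - d / (1 + ?c)"
          unfolding M_def by (intro infsum_le_finite_sums[OF summ]) (auto simp: not_less M_def)
        then have "d / (1 + ?c) \<le> 0" by simp
        then show False using d c0 by (simp add: divide_le_0_iff)
      qed
      then obtain Y where Y: "finite Y" "M - (\<Sum>j\<in>Y. (cmod (b j 0))\<^sup>2) < d / (1 + ?c)" by (auto simp: algebra_simps)
      have "?c * (M - (\<Sum>j\<in>Y. (cmod (b j 0))\<^sup>2)) \<le> ?c * (d / (1 + ?c))" using Y c0 by (intro mult_left_mono) auto
      also have "\<dots> \<le> d" using c0 d by (simp add: field_simps)
      finally show "(\<Sum>j\<in>X. wt j * (cmod (b j t))\<^sup>2) \<le> A0 * \<rho> ^ p1 * M + A0 * (G * H + 2 * C * M) + d"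
        using key[OF Y(1)] by linarith
    qed
    have \<rho>p1: "\<rho> ^ p1 \<le> K1 * bracket t powr (2 * \<epsilon>)"
    proof -
      have "\<rho> ^ p1 = (2 ^ p1) powr (2 * r)" by (simp add: \<rho>p)
      also have "\<dots> \<le> (2 * 2 ^ p0 * bracket t powr e) powr (2 * r)"
        using p1(2) r by (intro powr_mono2) (auto simp: x_def)
      also have "\<dots> = K1 * bracket t powr (2 * \<epsilon>)"
      proof -
        have "e * (2 * r) = 2 * \<epsilon>" using r by (simp add: e_def)
        then have "(bracket t powr e) powr (2 * r) = bracket t powr (2 * \<epsilon>)" unfolding powr_powr by (rule arg_cong)
        then show ?thesis unfolding K1_def powr_mult[of "2 * 2 ^ p0" "bracket t powr e"] by (rule arg_cong)
      qed
      finally show ?thesis .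
    qed
    have b1: "1 \<le> bracket t powr (2 * \<epsilon>)" using \<epsilon> bracket_ge_1 by (intro ge_one_powr_ge_zero) auto
    have "A0 * \<rho> ^ p1 * M \<le> A0 * (K1 * bracket t powr (2 * \<epsilon>)) * H"
      by (intro mult_mono \<rho>p1 MH) (use A0 K1 H0 M0 \<rho> in auto)
    moreover have "A0 * (G * H + 2 * C * M) \<le> A0 * (G * H + 2 * C * H) * bracket t powr (2 * \<epsilon>)"
    proof -
      have "A0 * (G * H + 2 * C * M) \<le> A0 * (G * H + 2 * C * H)"
        using A0 C MH by (intro mult_left_mono add_left_mono) auto
      also have "\<dots> \<le> A0 * (G * H + 2 * C * H) * bracket t powr (2 * \<epsilon>)"
        using mult_left_mono[OF b1, of "A0 * (G * H + 2 * C * H)"] A0 G C H0 by simp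
      finally show ?thesis .
    qed
    ultimately show ?thesis using lim unfolding C'_def by (simp add: algebra_simps)
  qed
  show ?thesis
  proof (rule exI[of _ C'], intro conjI allI impI C'0)
    fix b b' H t and X :: "(int ^ 'd) set"
    assume "seq_solution b b'" "0 \<le> t"
      "\<exists>B. \<forall>X s. finite X \<longrightarrow> s \<in> {0..t} \<longrightarrow> (\<Sum>j\<in>X. (cmod (b j s))\<^sup>2) \<le> B"
      and H: "\<forall>X. finite X \<longrightarrow> (\<Sum>j\<in>X. bracket (int_vec j) powr (2 * r) * (cmod (b j 0))\<^sup>2) \<le> H" and "finite X"
    then show "(\<Sum>j\<in>X. bracket (int_vec j) powr (2 * r) * (cmod (b j t))\<^sup>2) \<le> C' * bracket t powr (2 * \<epsilon>) * H"
      by (intro main[unfolded wt_def]) simp_all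
  qed
qed

end

section \<open>Negative times by time reversal\<close>

context fourier_potential
begin

text \<open>These are the coefficients of the potential at time \<open>- t\<close>; each time
  derivative contributes a sign.\<close>

lemma reversed_potential: "fourier_potential W (\<lambda>l t m. (- 1) ^ l * v l (- t) m)"
proof
  show "invertible W" by (rule invW)
  show "((\<lambda>t. (- 1) ^ l * v l (- t) m) has_vector_derivative (- 1) ^ Suc l * v (Suc l) (- t) m) (at t)" for l t m
  proof -
    have "(((\<lambda>t. v l t m) \<circ> uminus) has_vector_derivative (- 1) *\<^sub>R v (Suc l) (- t) m) (at t)"
      by (rule vector_diff_chain_at) (auto intro!: derivative_eq_intros v_deriv simp: has_vector_derivative_def[of uminus])
    from has_vector_derivative_mult[OF has_vector_derivative_const[of "(- 1) ^ l"] this]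
    show ?thesis by (simp add: o_def)
  qed
  show "\<exists>C. \<forall>t m. (1 + norm (int_vec m)) ^ N * cmod ((- 1) ^ l * v l (- t) m) \<le> C" for l N
  proof -
    obtain C where "\<forall>t m. (1 + norm (int_vec m)) ^ N * cmod (v l t m) \<le> C" using v_decay by blast
    then show ?thesis by (intro exI[of _ C]) (simp add: norm_mult norm_power)
  qed
  show "(- 1) ^ 0 * v 0 (- t) (- m) = cnj ((- 1) ^ 0 * v 0 (- t) m)" for t m by (simp add: v_sym)
qed

text \<open>In terms of functions, the complex conjugate of a solution at time \<open>- t\<close>
  solves the equation with the reversed potential. Conjugation turns the coefficient at
  \<open>- j\<close> into the one at \<open>j\<close>, and \<open>eig\<close> is even.\<close>

lemma reversed_solution:
  assumes "seq_solution b b'"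
  shows "fourier_potential.seq_solution W (\<lambda>l t m. (- 1) ^ l * v l (- t) m)
     (\<lambda>j t. cnj (b (- j) (- t))) (\<lambda>j t. - cnj (b' (- j) (- t)))"
  unfolding fourier_potential.seq_solution_def[OF reversed_potential]
proof (intro allI conjI)
  fix j t
  have d: "(b (- j) has_vector_derivative b' (- j) (- t)) (at (- t))"
    and s: "((\<lambda>k. v 0 (- t) (- j - k) * b k (- t)) has_sum (\<i> * b' (- j) (- t) - of_real (eig W (- j)) * b (- j) (- t))) UNIV"
    using assms unfolding seq_solution_def by blast+
  have "((b (- j) \<circ> uminus) has_vector_derivative (- 1) *\<^sub>R b' (- j) (- t)) (at t)"
    by (rule vector_diff_chain_at) (auto intro!: derivative_eq_intros d simp: has_vector_derivative_def[of uminus])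
  from bounded_linear.has_vector_derivative[OF bounded_linear_cnj this]
  show "((\<lambda>t. cnj (b (- j) (- t))) has_vector_derivative - cnj (b' (- j) (- t))) (at t)"
    by (simp add: o_def)
  have "((\<lambda>k. cnj (v 0 (- t) (- j - k) * b k (- t))) has_sum cnj (\<i> * b' (- j) (- t) - of_real (eig W (- j)) * b (- j) (- t))) UNIV"
    by (rule has_sum_bounded_linear[OF bounded_linear_cnj s, unfolded o_def])
  moreover have "bij (uminus :: int ^ 'd \<Rightarrow> int ^ 'd)" by (rule bijI') (auto intro: exI[of _ "- _"] simp: minus_equation_iff)
  ultimately have "((\<lambda>k. cnj (v 0 (- t) (- j - (- k)) * b (- k) (- t))) has_sum cnj (\<i> * b' (- j) (- t) - of_real (eig W (- j)) * b (- j) (- t))) UNIV"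
    by (subst has_sum_reindex_bij_betw[of uminus UNIV UNIV "\<lambda>k. cnj (v 0 (- t) (- j - k) * b k (- t))"]) auto
  moreover have "eig W (- j) = eig W j"
    using linear_neg[OF matrix_vector_mul_linear, of W "int_vec j"] by (simp add: eig_def int_vec_minus)
  moreover have "cnj (v 0 (- t) (- j - (- k))) = v 0 (- t) (j - k)" for k
    using v_sym[of "- t" "- j - (- k)"] by (simp add: algebra_simps)
  ultimately show "((\<lambda>k. (- 1) ^ 0 * v 0 (- t) (j - k) * cnj (b (- k) (- t))) has_sum
      \<i> * - cnj (b' (- j) (- t)) - of_real (eig W j) * cnj (b (- j) (- t))) UNIV"
    by simp
qed

theorem sequence_growth:
  assumes r: "0 < r" and \<epsilon>: "0 < \<epsilon>"
  shows "\<exists>C>0. \<forall>b b' H t X. seq_solution b b' \<longrightarrow>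
      (\<forall>T. \<exists>B. \<forall>X s. finite X \<longrightarrow> \<bar>s\<bar> \<le> T \<longrightarrow> (\<Sum>j\<in>X. (cmod (b j s))\<^sup>2) \<le> B) \<longrightarrow>
      (\<forall>X. finite X \<longrightarrow> (\<Sum>j\<in>X. bracket (int_vec j) powr (2 * r) * (cmod (b j 0))\<^sup>2) \<le> H) \<longrightarrow> finite X \<longrightarrow>
      (\<Sum>j\<in>X. bracket (int_vec j) powr (2 * r) * (cmod (b j t))\<^sup>2) \<le> C * bracket t powr (2 * \<epsilon>) * H"
proof -
  interpret rev: fourier_potential W "\<lambda>l t m. (- 1) ^ l * v l (- t) m" by (rule reversed_potential)
  obtain C1 where C1: "0 < C1" and fw: "\<forall>b b' H t X. seq_solution b b' \<longrightarrow> 0 \<le> t \<longrightarrow>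
      (\<exists>B. \<forall>X s. finite X \<longrightarrow> s \<in> {0..t} \<longrightarrow> (\<Sum>j\<in>X. (cmod (b j s))\<^sup>2) \<le> B) \<longrightarrow>
      (\<forall>X. finite X \<longrightarrow> (\<Sum>j\<in>X. bracket (int_vec j) powr (2 * r) * (cmod (b j 0))\<^sup>2) \<le> H) \<longrightarrow> finite X \<longrightarrow>
      (\<Sum>j\<in>X. bracket (int_vec j) powr (2 * r) * (cmod (b j t))\<^sup>2) \<le> C1 * bracket t powr (2 * \<epsilon>) * H"
    using forward_growth[OF r \<epsilon>] by (elim exE conjE)
  obtain C2 where C2: "0 < C2" and bw: "\<forall>b b' H t X. rev.seq_solution b b' \<longrightarrow> 0 \<le> t \<longrightarrow>
      (\<exists>B. \<forall>X s. finite X \<longrightarrow> s \<in> {0..t} \<longrightarrow> (\<Sum>j\<in>X. (cmod (b j s))\<^sup>2) \<le> B) \<longrightarrow>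
      (\<forall>X. finite X \<longrightarrow> (\<Sum>j\<in>X. bracket (int_vec j) powr (2 * r) * (cmod (b j 0))\<^sup>2) \<le> H) \<longrightarrow> finite X \<longrightarrow>
      (\<Sum>j\<in>X. bracket (int_vec j) powr (2 * r) * (cmod (b j t))\<^sup>2) \<le> C2 * bracket t powr (2 * \<epsilon>) * H"
    using rev.forward_growth[OF r \<epsilon>] by (elim exE conjE)
  define C where "C = max C1 C2"
  have C: "0 < C" "C1 \<le> C" "C2 \<le> C" using C1 by (auto simp: C_def)
  have main: "(\<Sum>j\<in>X. bracket (int_vec j) powr (2 * r) * (cmod (b j t))\<^sup>2) \<le> C * bracket t powr (2 * \<epsilon>) * H"
    if sol: "seq_solution b b'"
      and B: "\<And>T. \<exists>B. \<forall>X s. finite X \<longrightarrow> \<bar>s\<bar> \<le> T \<longrightarrow> (\<Sum>j\<in>X. (cmod (b j s))\<^sup>2) \<le> B"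
      and H: "\<And>X. finite X \<Longrightarrow> (\<Sum>j\<in>X. bracket (int_vec j) powr (2 * r) * (cmod (b j 0))\<^sup>2) \<le> H" and X: "finite X"
    for b b' H t X
  proof -
    have H0: "0 \<le> H" using H[of "{}"] by simp
    obtain B where B: "\<And>X s. finite X \<Longrightarrow> \<bar>s\<bar> \<le> \<bar>t\<bar> \<Longrightarrow> (\<Sum>j\<in>X. (cmod (b j s))\<^sup>2) \<le> B" using B by blast
    have up: "c * bracket t powr (2 * \<epsilon>) * H \<le> C * bracket t powr (2 * \<epsilon>) * H" if "c \<le> C" for c
      by (intro mult_right_mono that H0) auto
    show ?thesis
    proof (cases "0 \<le> t")
      case True
      have "\<exists>B. \<forall>X s. finite X \<longrightarrow> s \<in> {0..t} \<longrightarrow> (\<Sum>j\<in>X. (cmod (b j s))\<^sup>2) \<le> B"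
        by (rule exI[of _ B]) (use B True in auto)
      then have "(\<Sum>j\<in>X. bracket (int_vec j) powr (2 * r) * (cmod (b j t))\<^sup>2) \<le> C1 * bracket t powr (2 * \<epsilon>) * H"
        by (rule fw[rule_format, OF sol True _ H X])
      then show ?thesis using up[OF C(2)] by linarith
    next
      case False
      let ?b = "\<lambda>j t. cnj (b (- j) (- t))"
      have neg: "(\<Sum>j\<in>Y. f (- j) * (cmod (?b j s))\<^sup>2) = (\<Sum>j\<in>uminus ` Y. f j * (cmod (b j (- s)))\<^sup>2)" for Y s and f :: "int ^ 'd \<Rightarrow> real"
        by (subst sum.reindex) (auto simp: inj_on_def)
      have wt: "bracket (int_vec (- j) :: real ^ 'd) = bracket (int_vec j :: real ^ 'd)" for j
        by (simp add: bracket_def int_vec_minus)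
      have "\<exists>B. \<forall>X s. finite X \<longrightarrow> s \<in> {0..- t} \<longrightarrow> (\<Sum>j\<in>X. (cmod (?b j s))\<^sup>2) \<le> B"
      proof (intro exI[of _ B] allI impI)
        fix Y s assume "finite (Y :: (int ^ 'd) set)" "s \<in> {0..- t}"
        then show "(\<Sum>j\<in>Y. (cmod (?b j s))\<^sup>2) \<le> B"
          using neg[where Y = Y and s = s and f = "\<lambda>_. 1"] B[of "uminus ` Y" "- s"] by simp
      qed
      moreover have "\<forall>Y. finite Y \<longrightarrow> (\<Sum>j\<in>Y. bracket (int_vec j :: real ^ 'd) powr (2 * r) * (cmod (?b j 0))\<^sup>2) \<le> H"
      proof (intro allI impI)
        fix Y :: "(int ^ 'd) set" assume "finite Y"
        then show "(\<Sum>j\<in>Y. bracket (int_vec j :: real ^ 'd) powr (2 * r) * (cmod (?b j 0))\<^sup>2) \<le> H"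
          using neg[where Y = Y and s = 0 and f = "\<lambda>j. bracket (int_vec j :: real ^ 'd) powr (2 * r)"] H[of "uminus ` Y"]
          by (simp add: wt)
      qed
      ultimately have "(\<Sum>j\<in>uminus ` X. bracket (int_vec j :: real ^ 'd) powr (2 * r) * (cmod (?b j (- t)))\<^sup>2)
          \<le> C2 * bracket (- t) powr (2 * \<epsilon>) * H"
        using False X by (intro bw[rule_format, OF reversed_solution[OF sol]]) auto
      also have "(\<Sum>j\<in>uminus ` X. bracket (int_vec j :: real ^ 'd) powr (2 * r) * (cmod (?b j (- t)))\<^sup>2)
         = (\<Sum>j\<in>X. bracket (int_vec j :: real ^ 'd) powr (2 * r) * (cmod (b j t))\<^sup>2)"
        by (subst sum.reindex) (auto simp: inj_on_def wt)
      also have "bracket (- t) = bracket t" by (simp add: bracket_def)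
      finally show ?thesis using up[OF C(3)] by linarith
    qed
  qed
  show ?thesis
  proof (rule exI[of _ C], intro conjI allI impI C(1))
    fix b b' H t and X :: "(int ^ 'd) set"
    assume "seq_solution b b'"
      and B: "\<forall>T. \<exists>B. \<forall>X s. finite X \<longrightarrow> \<bar>s\<bar> \<le> T \<longrightarrow> (\<Sum>j\<in>X. (cmod (b j s))\<^sup>2) \<le> B"
      and H: "\<forall>X. finite X \<longrightarrow> (\<Sum>j\<in>X. bracket (int_vec j) powr (2 * r) * (cmod (b j 0))\<^sup>2) \<le> H" and "finite X"
    then show "(\<Sum>j\<in>X. bracket (int_vec j) powr (2 * r) * (cmod (b j t))\<^sup>2) \<le> C * bracket t powr (2 * \<epsilon>) * H"
      by (intro main) simp_all
  qed
qed

end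

section \<open>Fourier analysis on the torus\<close>

abbreviation cell :: "(real ^ 'd::finite) set" where
  "cell \<equiv> cbox 0 (\<chi> i. 2 * pi)"

definition ech :: "int ^ 'd::finite \<Rightarrow> real ^ 'd \<Rightarrow> complex" where
  "ech m x = exp (\<i> * of_real (int_vec m \<bullet> x))"

lemma periodic_int_shift:
  assumes "periodic f"
  shows "f (x + axis i (2 * pi * of_int n)) = f x"
proof -
  have nat: "f (x + axis i (2 * pi * real k)) = f x" for k x
  proof (induction k)
    case 0
    then show ?case by (simp add: axis_def zero_vec_def[symmetric])
  next
    case (Suc k)
    have "x + axis i (2 * pi * real (Suc k)) = (x + axis i (2 * pi * real k)) + axis i (2 * pi)"
      by (simp add: vec_eq_iff axis_def algebra_simps)
    then have "f (x + axis i (2 * pi * real (Suc k))) = f (x + axis i (2 * pi * real k))"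
      using assms unfolding periodic_def by (simp only:)
    then show ?case using Suc by (simp only:)
  qed
  show ?thesis
  proof (cases "0 \<le> n")
    case True
    then show ?thesis using nat[of x "nat n"] by simp
  next
    case False
    have "(x + axis i (2 * pi * of_int n)) + axis i (2 * pi * real (nat (- n))) = x"
      using False by (simp add: vec_eq_iff axis_def)
    then show ?thesis using nat[of "x + axis i (2 * pi * of_int n)" "nat (- n)"] by (simp only:)
  qed
qed

text \<open>A shift by at most one period pushes a slab out of the cell, and periodicity moves it
  back to the other side. Translation invariance is the source of both the orthogonality of the
  characters and the integration by parts below.\<close>

lemma integral_shift_axis:
  fixes f :: "real ^ 'd::finite \<Rightarrow> complex"
  assumes per: "periodic f" and cont: "continuous_on UNIV f"
  shows "integral cell (\<lambda>x. f (x + axis i s)) = integral cell f"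
proof -
  have int: "f integrable_on cbox a b" for a b
    by (rule integrable_continuous[OF continuous_on_subset[OF cont]]) simp
  have k: "axis i 1 \<in> (Basis :: (real ^ 'd) set)" by (auto simp: Basis_vec_def)
  have small: "integral cell (\<lambda>x. f (x + axis i s)) = integral cell f" if s: "0 \<le> s" "s \<le> 2 * pi" for s
  proof -
    let ?b = "(\<chi> i. 2 * pi) :: real ^ 'd"
    have inn: "x \<bullet> axis i 1 = x $ i" for x :: "real ^ 'd" by (simp add: inner_axis)
    have all_split: "(\<forall>j. P j) \<longleftrightarrow> P i \<and> (\<forall>j. j \<noteq> i \<longrightarrow> P j)" for P by metis
    \<comment> \<open>\<open>bx u w\<close> is the cell with its side in direction \<open>i\<close>
      replaced by the interval from \<open>u\<close> to \<open>2 * pi + w\<close>.\<close>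
    define bx where "bx u w = cbox (axis i u) (?b + axis i w)" for u w
    have bx: "bx u w = {x. u \<le> x $ i \<and> x $ i \<le> 2 * pi + w \<and> (\<forall>j. j \<noteq> i \<longrightarrow> 0 \<le> x $ j \<and> x $ j \<le> 2 * pi)}" for u w
      unfolding bx_def by (rule set_eqI, unfold mem_box_cart mem_Collect_eq, subst all_split) (simp add: axis_def)
    have ax0: "axis i 0 = (0 :: real ^ 'd)" by (simp add: axis_def vec_eq_iff)
    have cell: "cell = bx 0 0" unfolding bx_def ax0 by simp
    have "integral cell (\<lambda>x. f (x + axis i s)) = integral (bx s s) f"
      using integral_shift_cbox_plus[of 0 ?b f "axis i s"] by (simp add: o_def add.commute bx_def)
    also have "\<dots> = integral (bx s s \<inter> {x. x \<bullet> axis i 1 \<le> 2 * pi}) f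
        + integral (bx s s \<inter> {x. x \<bullet> axis i 1 \<ge> 2 * pi}) f"
      unfolding bx_def by (rule integral_split[OF int k])
    also have "bx s s \<inter> {x. x \<bullet> axis i 1 \<le> 2 * pi} = bx 0 0 \<inter> {x. x \<bullet> axis i 1 \<ge> s}"
      using s unfolding bx inn by auto
    also have "bx s s \<inter> {x. x \<bullet> axis i 1 \<ge> 2 * pi} = bx (2 * pi) s"
      using s unfolding bx inn by auto
    also have "integral (bx (2 * pi) s) f = integral (bx 0 (s - 2 * pi)) f"
    proof -
      have e: "?b + axis i (s - 2 * pi) + axis i (2 * pi) = ?b + axis i s" by (simp add: vec_eq_iff axis_def)
      have "integral (bx (2 * pi) s) f = integral (bx 0 (s - 2 * pi)) (f \<circ> (+) (axis i (2 * pi)))"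
        unfolding bx_def ax0 integral_shift_cbox_plus e by simp
      also have "f \<circ> (+) (axis i (2 * pi)) = f"
        using per by (auto simp: periodic_def fun_eq_iff add.commute[of "axis i (2 * pi)"])
      finally show ?thesis .
    qed
    also have "bx 0 (s - 2 * pi) = bx 0 0 \<inter> {x. x \<bullet> axis i 1 \<le> s}"
      using s unfolding bx inn by auto
    finally have "integral cell (\<lambda>x. f (x + axis i s)) = integral (cell \<inter> {x. x \<bullet> axis i 1 \<ge> s}) f
        + integral (cell \<inter> {x. x \<bullet> axis i 1 \<le> s}) f" unfolding cell .
    also have "\<dots> = integral cell f" using integral_split[OF int[of 0 ?b] k, of s] by simp
    finally show ?thesis .
  qed
  define n where "n = \<lfloor>s / (2 * pi)\<rfloor>"
  define s' where "s' = s - 2 * pi * of_int n"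
  have "of_int n \<le> s / (2 * pi)" "s / (2 * pi) \<le> of_int n + 1" by (auto simp: n_def)
  then have s': "0 \<le> s'" "s' \<le> 2 * pi" by (auto simp: s'_def field_simps)
  have "f (x + axis i s) = f (x + axis i s')" for x
  proof -
    have "x + axis i s = (x + axis i s') + axis i (2 * pi * of_int n)"
      by (simp add: s'_def vec_eq_iff axis_def)
    then show ?thesis using periodic_int_shift[OF per, of "x + axis i s'" i n] by (simp only:)
  qed
  then show ?thesis using small[OF s'] by simp
qed

section \<open>Characters and integration by parts\<close>

lemma ech_add: "ech m (x + y) = ech m x * ech m y"
  by (simp add: ech_def inner_add_right ring_distribs exp_add)

lemma ech_mult: "ech m x * ech k x = ech (m + k) x"
  by (simp add: ech_def int_vec_add inner_add_left ring_distribs exp_add)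

lemma ech_axis: "ech m (axis i s) = exp (\<i> * of_real (of_int (m $ i) * s))"
  by (simp add: ech_def inner_axis int_vec_def)

lemma norm_ech [simp]: "cmod (ech m x) = 1"
  by (simp add: ech_def)

lemma cnj_ech: "cnj (ech m x) = ech (- m) x"
  by (simp add: ech_def int_vec_minus exp_cnj)

lemma ech_0 [simp]: "ech 0 x = 1"
  by (simp add: ech_def)

lemma continuous_ech [continuous_intros]: "continuous_on S (ech m)"
  unfolding ech_def[abs_def] by (intro continuous_intros)

lemma periodic_ech: "periodic (ech m)"
proof -
  have "ech m (axis i (2 * pi)) = 1" for i
    unfolding ech_axis using exp_integer_2pi[of "of_int (m $ i)"] by (simp add: mult_ac)
  then show ?thesis by (simp add: periodic_def ech_add)
qed

lemma periodic_mult: "periodic f \<Longrightarrow> periodic g \<Longrightarrow> periodic (\<lambda>x. f x * g x)"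
  by (simp add: periodic_def)

lemma content_cell: "measure lborel (cell :: (real ^ 'd::finite) set) = (2 * pi) ^ CARD('d)"
proof -
  have "(cell :: (real ^ 'd) set) \<noteq> {}" by (auto simp: box_ne_empty(1) inner_axis Basis_vec_def)
  then show ?thesis by (simp add: content_cbox_cart)
qed

text \<open>A shift by half a period of the character, in a direction where \<open>m\<close> is
  nonzero, changes its sign but not its integral.\<close>

lemma integral_ech: "integral cell (ech m :: real ^ 'd::finite \<Rightarrow> complex) = (if m = 0 then (2 * pi) ^ CARD('d) else 0)"
proof (cases "m = 0")
  case True
  then have "ech m = (\<lambda>x :: real ^ 'd. 1)" by (simp add: fun_eq_iff)
  then show ?thesis using True by (simp add: content_cell scaleR_conv_of_real)
next
  case False
  then obtain i where i: "m $ i \<noteq> 0" by (auto simp: vec_eq_iff)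
  define s where "s = pi / of_int (m $ i)"
  have "ech m (axis i s) = exp (\<i> * pi)" unfolding ech_axis s_def using i by simp
  then have e: "ech m (x + axis i s) = - ech m x" for x by (simp add: ech_add exp_pi_i')
  have "integral cell (ech m) = integral cell (\<lambda>x. ech m (x + axis i s))"
    by (rule integral_shift_axis[symmetric]) (auto intro: periodic_ech continuous_intros)
  also have "\<dots> = - integral cell (ech m)" unfolding e by simp
  finally show ?thesis using False by simp
qed

lemma ech_has_partial:
  "((\<lambda>h. c * ech m (x + h *\<^sub>R e)) has_vector_derivative (c * \<i> * of_real (int_vec m \<bullet> e)) * ech m x) (at 0)"
proof -
  have "((\<lambda>h. exp (\<i> * (of_real (int_vec m \<bullet> x) + of_real h * of_real (int_vec m \<bullet> e)))) has_vector_derivative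
     (\<i> * of_real (int_vec m \<bullet> e)) * exp (\<i> * of_real (int_vec m \<bullet> x))) (at 0)"
    by (rule has_vector_derivative_real_field[where f = "\<lambda>z. exp (\<i> * (of_real (int_vec m \<bullet> x) + z * of_real (int_vec m \<bullet> e)))"])
      (auto intro!: derivative_eq_intros)
  from has_vector_derivative_mult_right[OF this, of c]
  show ?thesis by (simp add: ech_def inner_add_right mult.assoc)
qed

lemma shifted_derivative:
  fixes F :: "'a::real_normed_vector \<Rightarrow> 'b::real_normed_vector"
  assumes "\<And>x. ((\<lambda>h. F (x + h *\<^sub>R e)) has_vector_derivative D x) (at 0)"
  shows "((\<lambda>s. F (x + s *\<^sub>R e)) has_vector_derivative D (x + s *\<^sub>R e)) (at s within S)"
proof -
  have "((\<lambda>h. F (x + s *\<^sub>R e + h *\<^sub>R e)) \<circ> (\<lambda>u. u - s) has_vector_derivative 1 *\<^sub>R D (x + s *\<^sub>R e)) (at s)"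
  proof (rule vector_diff_chain_at)
    show "((\<lambda>u. u - s) has_vector_derivative 1) (at s)"
      by (auto intro!: derivative_eq_intros simp: has_vector_derivative_def)
    show "((\<lambda>h. F (x + s *\<^sub>R e + h *\<^sub>R e)) has_vector_derivative D (x + s *\<^sub>R e)) (at (s - s))"
      using assms[of "x + s *\<^sub>R e"] by simp
  qed
  then have "((\<lambda>s. F (x + s *\<^sub>R e)) has_vector_derivative D (x + s *\<^sub>R e)) (at s)"
    by (simp add: o_def scaleR_left_diff_distrib)
  then show ?thesis by (rule has_vector_derivative_at_within)
qed

text \<open>The integral of the translate of \<open>F\<close> by \<open>axis i s\<close> does not
  depend on \<open>s\<close>; its derivative at \<open>s = 0\<close> is the integral of
  \<open>D\<close>.\<close>

lemma integral_partial_zero: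
  fixes F D :: "real ^ 'd::finite \<Rightarrow> complex"
  assumes per: "periodic F" and cF: "continuous_on UNIV F" and cD: "continuous_on UNIV D"
    and d: "\<And>x. ((\<lambda>h. F (x + h *\<^sub>R axis i 1)) has_vector_derivative D x) (at 0)"
  shows "integral cell D = 0"
proof -
  have ax: "s *\<^sub>R axis i 1 = (axis i s :: real ^ 'd)" for s by (simp add: vec_eq_iff axis_def)
  have c: "continuous_on S (\<lambda>x. F (x + axis i s))" for S s
    by (rule continuous_on_compose2[OF cF]) (auto intro: continuous_intros)
  have "((\<lambda>s. integral cell (\<lambda>x. F (x + axis i s))) has_vector_derivative integral cell (\<lambda>x. D (x + axis i 0))) (at 0 within UNIV)"
  proof (rule leibniz_rule_vector_derivative)
    show "((\<lambda>s. F (t + axis i s)) has_vector_derivative D (t + axis i s)) (at s within UNIV)" for s t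
      using shifted_derivative[OF d, of t s UNIV] by (simp add: ax)
    show "(\<lambda>x. F (x + axis i s)) integrable_on cell" for s by (rule integrable_continuous[OF c])
    have "continuous_on (UNIV \<times> cell) (\<lambda>p. D (snd p + fst p *\<^sub>R axis i 1))"
      by (rule continuous_on_compose2[OF cD]) (auto intro!: continuous_intros)
    then show "continuous_on (UNIV \<times> cell) (\<lambda>(s, x). D (x + axis i s))" by (simp add: ax case_prod_unfold)
  qed auto
  moreover have "(\<lambda>s. integral cell (\<lambda>x. F (x + axis i s))) = (\<lambda>s. integral cell F)"
    by (rule ext) (rule integral_shift_axis[OF per cF])
  ultimately have "((\<lambda>s::real. integral cell F) has_vector_derivative integral cell D) (at 0)"
    by (simp add: axis_def zero_vec_def[symmetric])
  then show ?thesis using has_vector_derivative_const vector_derivative_unique_at by blast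
qed

text \<open>The Fourier coefficient with the Henstock-Kurzweil \<open>integral\<close>, the form to
  which the shift argument and the Leibniz rule apply. It agrees with \<open>fourier_coeff\<close>
  on continuous functions.\<close>

definition fco :: "(real ^ 'd::finite \<Rightarrow> complex) \<Rightarrow> int ^ 'd \<Rightarrow> complex" where
  "fco f m = integral cell (\<lambda>x. f x * ech (- m) x) / (2 * pi) ^ CARD('d)"

lemma fourier_coeff_eq_LINT: "fourier_coeff f m = (LINT x|torus. f x * ech (- m) x) / (2 * pi) ^ CARD('d)"
  for f :: "real ^ 'd::finite \<Rightarrow> complex"
  by (simp add: fourier_coeff_def ech_def int_vec_minus)

lemma LINT_torus_continuous:
  fixes f :: "real ^ 'd::finite \<Rightarrow> complex"
  assumes "continuous_on UNIV f"
  shows "integrable torus f" "(LINT x|torus. f x) = integral cell f"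
proof -
  have "continuous_on cell f" using assms continuous_on_subset by blast
  then show i: "integrable torus f" unfolding torus_def by (rule continuous_imp_integrable)
  then show "(LINT x|torus. f x) = integral cell f"
    unfolding torus_def by (rule lebesgue_integral_eq_integral) simp
qed

lemma fourier_coeff_continuous:
  fixes f :: "real ^ 'd::finite \<Rightarrow> complex"
  assumes "continuous_on UNIV f"
  shows "fourier_coeff f m = fco f m"
  unfolding fourier_coeff_eq_LINT fco_def
  by (subst LINT_torus_continuous(2)) (auto intro!: continuous_intros assms)

lemma fco_partial:
  fixes f D :: "real ^ 'd::finite \<Rightarrow> complex"
  assumes per: "periodic f" and cf: "continuous_on UNIV f" and cD: "continuous_on UNIV D"
    and d: "\<And>x. ((\<lambda>h. f (x + h *\<^sub>R axis i 1)) has_vector_derivative D x) (at 0)"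
  shows "fco D m = \<i> * of_int (m $ i) * fco f m"
proof -
  have de: "((\<lambda>h. ech (- m) (x + h *\<^sub>R axis i 1)) has_vector_derivative - \<i> * of_int (m $ i) * ech (- m) x) (at 0)" for x
    using ech_has_partial[of 1 "- m" x "axis i 1"] by (simp add: int_vec_def inner_axis)
  have "integral cell (\<lambda>x. f x * (- \<i> * of_int (m $ i) * ech (- m) x) + D x * ech (- m) x) = 0"
  proof (rule integral_partial_zero[where F = "\<lambda>x. f x * ech (- m) x"])
    show "((\<lambda>h. f (x + h *\<^sub>R axis i 1) * ech (- m) (x + h *\<^sub>R axis i 1)) has_vector_derivative
        f x * (- \<i> * of_int (m $ i) * ech (- m) x) + D x * ech (- m) x) (at 0)" for x
      using has_vector_derivative_mult[OF d[of x] de[of x]] by simp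
  qed (auto intro!: continuous_intros periodic_mult periodic_ech per cf cD)
  also have "integral cell (\<lambda>x. f x * (- \<i> * of_int (m $ i) * ech (- m) x) + D x * ech (- m) x)
    = integral cell (\<lambda>x. (- \<i> * of_int (m $ i)) * (f x * ech (- m) x)) + integral cell (\<lambda>x. D x * ech (- m) x)"
    by (subst integral_add[symmetric])
      (auto intro!: integrable_continuous continuous_intros continuous_on_subset[OF cf] continuous_on_subset[OF cD] simp: mult_ac)
  also have "\<dots> = (- \<i> * of_int (m $ i)) * integral cell (\<lambda>x. f x * ech (- m) x) + integral cell (\<lambda>x. D x * ech (- m) x)"
    by simp
  finally show ?thesis by (simp add: fco_def add_eq_0_iff)
qed

section \<open>Trigonometric polynomials and uniqueness of Fourier coefficients\<close>

inductive trig_poly :: "(real ^ 'd::finite \<Rightarrow> complex) \<Rightarrow> bool" where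
  ech: "trig_poly (\<lambda>x. c * ech m x)"
| add: "trig_poly f \<Longrightarrow> trig_poly g \<Longrightarrow> trig_poly (\<lambda>x. f x + g x)"

lemma trig_poly_continuous: "trig_poly f \<Longrightarrow> continuous_on S f"
  by (induction rule: trig_poly.induct) (auto intro!: continuous_intros)

lemma trig_poly_mult_ech: "trig_poly f \<Longrightarrow> trig_poly (\<lambda>x. f x * (c * ech m x))"
proof (induction rule: trig_poly.induct)
  case (ech c' m')
  have "(\<lambda>x. c' * ech m' x * (c * ech m x)) = (\<lambda>x. (c' * c) * ech (m' + m) x)"
    by (simp add: fun_eq_iff ech_mult[symmetric] mult_ac)
  then show ?case using trig_poly.ech by metis
next
  case (add f g)
  then show ?case by (simp add: distrib_right trig_poly.add)
qed

lemma trig_poly_mult: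
  assumes "trig_poly f" and g: "trig_poly g"
  shows "trig_poly (\<lambda>x. f x * g x)"
  using g
proof (induction rule: trig_poly.induct)
  case (ech c m)
  then show ?case by (rule trig_poly_mult_ech[OF assms(1)])
next
  case (add g1 g2)
  then show ?case by (simp add: distrib_left trig_poly.add)
qed

lemma trig_poly_const: "trig_poly (\<lambda>x. c)"
  using trig_poly.ech[of c 0] by simp

lemma trig_poly_prod: "finite I \<Longrightarrow> (\<And>i. i \<in> I \<Longrightarrow> trig_poly (f i)) \<Longrightarrow> trig_poly (\<lambda>x. \<Prod>i\<in>I. f i x)"
  by (induction I rule: finite_induct) (auto intro: trig_poly_const trig_poly_mult)

lemma trig_poly_power: "trig_poly f \<Longrightarrow> trig_poly (\<lambda>x. f x ^ n)"
  by (induction n) (auto intro: trig_poly_const trig_poly_mult)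

lemma integral_trig_poly_zero:
  fixes g :: "real ^ 'd::finite \<Rightarrow> complex"
  assumes g: "continuous_on UNIV g" and z: "\<And>m. fco g m = 0" and f: "trig_poly f"
  shows "integral cell (\<lambda>x. g x * f x) = 0"
  using f
proof (induction rule: trig_poly.induct)
  case (ech c m)
  have "integral cell (\<lambda>x. g x * ech m x) = 0" using z[of "- m"] by (simp add: fco_def)
  then have "integral cell (\<lambda>x. c * (g x * ech m x)) = 0" by simp
  then show ?case by (simp add: mult_ac)
next
  case (add f1 f2)
  have "(\<lambda>x. g x * f x) integrable_on cell" if "trig_poly f" for f
    by (intro integrable_continuous continuous_intros continuous_on_subset[OF g] trig_poly_continuous that) simp
  then show ?case using add by (simp add: distrib_left integral_add)
qed

text \<open>The kernel \<open>(\<Prod>i. sin\<^sup>2 (x i / 2))\<^sup>n\<close> concentrates at the centre of the cell as \<open>n\<close> grows.\<close>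

definition kern :: "real ^ 'd::finite \<Rightarrow> real" where
  "kern x = (\<Prod>i\<in>UNIV. (sin (x $ i / 2))\<^sup>2)"

lemma trig_poly_kern: "trig_poly (\<lambda>x :: real ^ 'd::finite. of_real (kern x))"
proof -
  have "trig_poly (\<lambda>x :: real ^ 'd. complex_of_real ((sin (x $ i / 2))\<^sup>2))" for i
  proof -
    have ax: "ech (axis i k) x = exp (\<i> * of_real (of_int k * x $ i))" for k and x :: "real ^ 'd"
    proof -
      have "int_vec (axis i k) = axis i (of_int k :: real)" by (simp add: int_vec_def axis_def vec_eq_iff)
      then show ?thesis by (simp add: ech_def inner_axis')
    qed
    have "complex_of_real ((sin (x $ i / 2))\<^sup>2) = 1/2 + ((-1/4) * ech (axis i 1) x + (-1/4) * ech (axis i (-1)) x)" for x :: "real ^ 'd"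
    proof -
      have "(sin (x $ i / 2))\<^sup>2 = (1 - cos (x $ i)) / 2"
        using cos_double_sin[of "x $ i / 2"] by simp
      then have "complex_of_real ((sin (x $ i / 2))\<^sup>2) = complex_of_real ((1 - cos (x $ i)) / 2)" by (simp only:)
      also have "\<dots> = 1/2 + (-1/4) * (2 * of_real (cos (x $ i)))" by (simp add: field_simps)
      also have "2 * of_real (cos (x $ i)) = ech (axis i 1) x + ech (axis i (-1)) x"
        unfolding ax by (simp add: exp_eq_polar cis_conv_exp[symmetric] complex_eq_iff)
      finally show ?thesis by (simp only: distrib_left)
    qed
    then show ?thesis by (simp only:) (intro trig_poly.add trig_poly.ech trig_poly_const)
  qed
  then show ?thesis unfolding kern_def of_real_prod by (intro trig_poly_prod) auto
qed

lemma kern_nonneg: "0 \<le> kern x" and kern_le_1: "kern x \<le> 1"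
  unfolding kern_def by (auto intro!: prod_nonneg prod_le_1 simp: abs_square_le_1)

lemma continuous_kern [continuous_intros]: "continuous_on S kern"
  unfolding kern_def[abs_def] by (intro continuous_intros) auto

lemma kern_eq_1:
  assumes x: "x \<in> cell" and "kern x = 1"
  shows "x = (\<chi> i. pi)"
proof -
  have "x $ i = pi" for i
  proof (rule ccontr)
    assume ne: "x $ i \<noteq> pi"
    have xi: "0 \<le> x $ i" "x $ i \<le> 2 * pi" using x by (auto simp: mem_box_cart)
    have "sin (x $ i / 2) \<noteq> 1"
    proof
      assume "sin (x $ i / 2) = 1"
      then have "cos (x $ i / 2) = 0" using sin_cos_squared_add[of "x $ i / 2"] by simp
      then have "cos (x $ i / 2) = cos (pi / 2)" by simp
      then have "x $ i / 2 = pi / 2" by (rule cos_inj_pi[rotated 4]) (use xi in auto)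
      then show False using ne by simp
    qed
    moreover have "0 \<le> sin (x $ i / 2)" using xi by (intro sin_ge_zero) auto
    moreover have "sin (x $ i / 2) \<le> 1" by simp
    ultimately have "\<bar>sin (x $ i / 2)\<bar> < 1" by linarith
    then have lt: "(sin (x $ i / 2))\<^sup>2 < 1" by (simp only: abs_square_less_1)
    have "kern x = (sin (x $ i / 2))\<^sup>2 * (\<Prod>j\<in>UNIV - {i}. (sin (x $ j / 2))\<^sup>2)"
      unfolding kern_def by (rule prod.remove) auto
    also have "\<dots> \<le> (sin (x $ i / 2))\<^sup>2 * 1"
      by (intro mult_left_mono prod_le_1) (auto simp: abs_square_le_1)
    finally show False using lt assms(2) by simp
  qed
  then show ?thesis by (simp add: vec_eq_iff)
qed

text \<open>Powers of \<open>kern\<close> are trigonometric polynomials, so \<open>g\<close> is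
  orthogonal to them. If \<open>Re g\<close> were positive at the centre, the integral of
  \<open>Re g * kern ^ n\<close> would gain at least \<open>c * vS * q1 ^ n\<close> from a small
  cube and lose at most \<open>B * vC * q ^ n\<close> away from the centre. With
  \<open>q < q1\<close> this is impossible for large \<open>n\<close>.\<close>

lemma fourier_zero_at_centre:
  fixes g :: "real ^ 'd::finite \<Rightarrow> complex"
  assumes g: "continuous_on UNIV g" and z: "\<And>m. fco g m = 0"
  shows "Re (g (\<chi> i. pi)) \<le> 0"
proof (rule ccontr)
  define y :: "real ^ 'd" where "y = (\<chi> i. pi)"
  assume "\<not> Re (g (\<chi> i. pi)) \<le> 0"
  then have pos: "0 < Re (g y)" by (simp add: y_def)
  define c where "c = Re (g y) / 2"
  have c: "0 < c" using pos by (simp add: c_def)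
  define h where "h x = Re (g x)" for x
  have h: "continuous_on S h" for S unfolding h_def
    by (intro continuous_intros continuous_on_subset[OF g]) simp
  have ycell: "y \<in> cell" by (simp add: y_def mem_box_cart)
  have "isCont h y" using h[of UNIV] by (simp add: continuous_on_eq_continuous_at)
  then obtain \<eta> where \<eta>: "0 < \<eta>" "\<And>x. dist x y < \<eta> \<Longrightarrow> dist (h x) (h y) < c"
    using c unfolding continuous_at_eps_delta by blast
  have hc: "c \<le> h x" if "dist x y < \<eta>" for x
    using \<eta>(2)[OF that] unfolding dist_real_def h_def c_def abs_less_iff by linarith
  obtain B where B: "0 \<le> B" "\<And>x. x \<in> cell \<Longrightarrow> \<bar>h x\<bar> \<le> B"
  proof -
    have "bounded (h ` cell)" by (intro compact_imp_bounded compact_continuous_image h compact_cbox)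
    then show ?thesis using that by (auto simp: bounded_iff) (metis abs_ge_zero order_trans ycell)
  qed
  define K where "K = cell - ball y \<eta>"
  have K: "compact K" unfolding K_def by (rule compact_diff) auto
  obtain q where q: "0 \<le> q" "q < 1" "\<And>x. x \<in> K \<Longrightarrow> kern x \<le> q"
  proof (cases "K = {}")
    case True
    then show ?thesis using that[of 0] by auto
  next
    case False
    then obtain x0 where x0: "x0 \<in> K" "\<And>x. x \<in> K \<Longrightarrow> kern x \<le> kern x0"
      using continuous_attains_sup[OF K False continuous_kern] by blast
    have "kern x0 \<noteq> 1"
    proof
      assume "kern x0 = 1"
      then have "x0 = y" using kern_eq_1 x0(1) by (auto simp: K_def y_def)
      then show False using x0(1) \<eta>(1) by (simp add: K_def)
    qed
    then have "kern x0 < 1" using kern_le_1[of x0] by simp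
    then show ?thesis using that[of "kern x0"] x0(2) kern_nonneg by blast
  qed
  define q1 where "q1 = (1 + q) / 2"
  have q1: "q < q1" "q1 < 1" "0 < q1" using q by (auto simp: q1_def)
  have "kern y = 1" by (simp add: kern_def y_def)
  moreover have "isCont kern y" using continuous_kern[of "UNIV :: (real ^ 'd) set"] by (simp add: continuous_on_eq_continuous_at)
  ultimately obtain \<zeta> where \<zeta>: "0 < \<zeta>" "\<And>x. dist x y < \<zeta> \<Longrightarrow> dist (kern x) 1 < 1 - q1"
    using q1 unfolding continuous_at_eps_delta by (metis diff_gt_0_iff_gt)
  \<comment> \<open>Half the side of the cube \<open>S\<close>. The distance is at most the sum over
    the coordinates, so \<open>S\<close> keeps within half of each of the three radii: \<eta> for
    \<open>Re g\<close>, \<zeta> for \<open>kern\<close>, and \<pi> for the cell.\<close>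
  define \<sigma> where "\<sigma> = min (min \<eta> \<zeta>) pi / (2 * real CARD('d))"
  have \<sigma>: "0 < \<sigma>" using \<eta> \<zeta> by (simp add: \<sigma>_def)
  define S where "S = cbox (\<chi> i. pi - \<sigma>) ((\<chi> i. pi + \<sigma>) :: real ^ 'd)"
  have \<sigma>D: "real CARD('d) * \<sigma> = min (min \<eta> \<zeta>) pi / 2" by (simp add: \<sigma>_def)
  have Sd: "dist x y \<le> min (min \<eta> \<zeta>) pi / 2" if "x \<in> S" for x
  proof -
    have "norm (x - y) \<le> (\<Sum>i\<in>UNIV. \<bar>(x - y) $ i\<bar>)" by (rule norm_le_l1_cart)
    also have "\<dots> \<le> (\<Sum>i\<in>(UNIV :: 'd set). \<sigma>)"
      by (rule sum_mono) (use that in \<open>auto simp: S_def mem_box_cart y_def abs_le_iff algebra_simps\<close>)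
    finally show ?thesis using \<sigma>D by (simp add: dist_norm)
  qed
  have S1: "dist x y < \<eta>" "q1 \<le> kern x" if "x \<in> S" for x
  proof -
    show "dist x y < \<eta>" using Sd[OF that] \<eta> \<zeta> pi_gt_zero by linarith
    have "dist x y < \<zeta>" using Sd[OF that] \<eta> \<zeta> pi_gt_zero by linarith
    from \<zeta>(2)[OF this] show "q1 \<le> kern x" by (simp add: dist_real_def abs_less_iff)
  qed
  have "\<sigma> \<le> real CARD('d) * \<sigma>" using \<sigma> by (simp add: mult_le_cancel_right1 Suc_leI)
  then have \<sigma>pi: "\<sigma> \<le> pi" using \<sigma>D \<eta> \<zeta> pi_gt_zero by linarith
  have Scell: "S \<subseteq> cell"
  proof
    fix x assume "x \<in> S"
    then have "pi - \<sigma> \<le> x $ i" "x $ i \<le> pi + \<sigma>" for i by (simp_all add: S_def mem_box_cart)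
    then have "0 \<le> x $ i" "x $ i \<le> 2 * pi" for i using \<sigma>pi by (meson diff_ge_0_iff_ge order_trans, smt (verit))
    then show "x \<in> cell" by (simp add: mem_box_cart)
  qed
  define vS where "vS = measure lborel S"
  have vS: "0 < vS"
  proof -
    have "S \<noteq> {}" using \<sigma> by (auto simp: S_def interval_ne_empty_cart)
    then have "vS = (\<Prod>i\<in>(UNIV :: 'd set). 2 * \<sigma>)" unfolding vS_def S_def by (simp add: content_cbox_cart)
    then show ?thesis using \<sigma> by simp
  qed
  define vC where "vC = measure lborel (cell :: (real ^ 'd) set)"
  have low: "c * vS * q1 ^ n \<le> B * vC * q ^ n" for n
  proof -
    have intk: "(\<lambda>x. h x * kern x ^ n) integrable_on cell"
      by (intro integrable_continuous continuous_intros h)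
    have "integral cell (\<lambda>x. g x * of_real (kern x) ^ n) = 0"
      by (rule integral_trig_poly_zero[OF g z trig_poly_power[OF trig_poly_kern]])
    moreover have "(\<lambda>x. g x * of_real (kern x) ^ n) integrable_on cell"
      by (intro integrable_continuous continuous_intros continuous_on_subset[OF g]) simp
    ultimately have "integral cell (\<lambda>x. Re (g x * of_real (kern x) ^ n)) = 0"
      using integral_linear[OF _ bounded_linear_Re, of "\<lambda>x. g x * of_real (kern x) ^ n" cell] by (simp add: o_def)
    moreover have "Re (g x * of_real (kern x) ^ n) = h x * kern x ^ n" for x
      by (simp add: h_def flip: of_real_power)
    ultimately have zero: "integral cell (\<lambda>x. h x * kern x ^ n) = 0" by (simp only:)
    have "((\<lambda>x. if x \<in> S then c * q1 ^ n else 0) has_integral (vS *\<^sub>R (c * q1 ^ n))) cell"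
      unfolding has_integral_restrict[OF Scell] unfolding S_def vS_def by (rule has_integral_const)
    moreover have "((\<lambda>x :: real ^ 'd. B * q ^ n) has_integral (vC *\<^sub>R (B * q ^ n))) cell"
      unfolding vC_def by (rule has_integral_const)
    ultimately have lo: "((\<lambda>x. (if x \<in> S then c * q1 ^ n else 0) - B * q ^ n) has_integral (vS *\<^sub>R (c * q1 ^ n) - vC *\<^sub>R (B * q ^ n))) cell"
      by (rule has_integral_diff)
    have hi: "((\<lambda>x. h x * kern x ^ n) has_integral 0) cell"
      using integrable_integral[OF intk] zero by simp
    have "vS *\<^sub>R (c * q1 ^ n) - vC *\<^sub>R (B * q ^ n) \<le> 0"
    proof (rule has_integral_le[OF lo hi])
      fix x assume x: "x \<in> (cell :: (real ^ 'd) set)"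
      have Bq: "0 \<le> B * q ^ n" using B q by simp
      show "(if x \<in> S then c * q1 ^ n else 0) - B * q ^ n \<le> h x * kern x ^ n"
      proof (cases "dist x y < \<eta>")
        case True
        have "(if x \<in> S then c * q1 ^ n else 0) \<le> c * kern x ^ n"
          using S1[of x] c q1 kern_nonneg[of x] by (auto intro!: mult_left_mono power_mono)
        also have "\<dots> \<le> h x * kern x ^ n" by (rule mult_right_mono[OF hc[OF True]]) (simp add: kern_nonneg)
        finally show ?thesis using Bq by linarith
      next
        case False
        then have nS: "x \<notin> S" using S1(1) by blast
        have "x \<in> K" using False x by (simp add: K_def dist_commute)
        then have k: "kern x ^ n \<le> q ^ n" by (intro power_mono q(3) kern_nonneg)
        have "\<bar>h x * kern x ^ n\<bar> \<le> B * q ^ n"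
          unfolding abs_mult by (intro mult_mono B x) (use k kern_nonneg[of x] in \<open>auto simp: B\<close>)
        then show ?thesis using nS by (simp add: abs_le_iff)
      qed
    qed
    then show ?thesis by (simp add: mult_ac)
  qed
  have "(\<lambda>n. B * vC * (q / q1) ^ n) \<longlonglongrightarrow> B * vC * 0"
    by (intro tendsto_intros LIMSEQ_realpow_zero) (use q q1 in auto)
  moreover have "c * vS \<le> B * vC * (q / q1) ^ n" for n
    using low[of n] q1 by (simp add: power_divide field_simps)
  ultimately have "c * vS \<le> B * vC * 0"
    by (intro tendsto_lowerbound[of _ _ sequentially]) (auto intro: always_eventually)
  then show False using c vS by (simp add: mult_le_0_iff)
qed

lemma continuous_translate:
  "continuous_on UNIV f \<Longrightarrow> continuous_on S (\<lambda>x. f (x + c :: real ^ 'd::finite))"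
  by (rule continuous_on_compose2[of UNIV f]) (auto intro: continuous_intros)

lemma periodic_translate: "periodic f \<Longrightarrow> periodic (\<lambda>x. f (x + c))"
  unfolding periodic_def by (metis add.assoc add.commute)

lemma integral_translate_cell:
  fixes f :: "real ^ 'd::finite \<Rightarrow> complex"
  assumes per: "periodic f" and cont: "continuous_on UNIV f"
  shows "integral cell (\<lambda>x. f (x + c)) = integral cell f"
proof -
  have "integral cell (\<lambda>x. f (x + (\<Sum>i\<in>I. axis i (c $ i)))) = integral cell f" if "finite I" for I
    using that
  proof (induction I rule: finite_induct)
    case (insert i I)
    have "(\<lambda>x. f (x + (\<Sum>i\<in>insert i I. axis i (c $ i)))) = (\<lambda>x. f (x + axis i (c $ i) + (\<Sum>i\<in>I. axis i (c $ i))))"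
      using insert by (simp add: add.assoc)
    then show ?case
      using integral_shift_axis[OF periodic_translate[OF per, of "\<Sum>i\<in>I. axis i (c $ i)"] continuous_translate[OF cont]] insert
      by simp
  qed simp
  from this[of UNIV] have "integral cell (\<lambda>x. f (x + (\<Sum>i\<in>UNIV. axis i (c $ i)))) = integral cell f" by simp
  moreover have "(\<Sum>i\<in>UNIV. axis i (c $ i)) = c" by (simp add: vec_eq_iff axis_def)
  ultimately show ?thesis by simp
qed

text \<open>Translations preserve vanishing of all coefficients and move any point to the centre.
  Multiplication by the four units 1, -1, i, -i turns the one-sided bound on the real part into
  vanishing.\<close>

lemma fourier_uniqueness:
  fixes g :: "real ^ 'd::finite \<Rightarrow> complex"
  assumes per: "periodic g" and cont: "continuous_on UNIV g" and z: "\<And>m. fco g m = 0"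
  shows "g x = 0"
proof -
  have le: "Re (\<alpha> * g x) \<le> 0" for \<alpha>
  proof -
    define c where "c = x - (\<chi> i. pi)"
    define h where "h = (\<lambda>x. \<alpha> * g (x + c))"
    have "fco h m = 0" for m
    proof -
      have "integral cell (\<lambda>x. g (x + c) * ech (- m) (x + c)) = integral cell (\<lambda>x. g x * ech (- m) x)"
        by (rule integral_translate_cell[where f = "\<lambda>x. g x * ech (- m) x"])
          (auto intro!: periodic_mult per periodic_ech continuous_intros cont)
      also have "\<dots> = 0" using z[of m] by (simp add: fco_def)
      finally have "integral cell (\<lambda>x. (\<alpha> * ech m c) * (g (x + c) * ech (- m) (x + c))) = 0" by simp
      moreover have "(\<alpha> * ech m c) * (g (x + c) * ech (- m) (x + c)) = h x * ech (- m) x" for x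
      proof -
        have "ech m c * ech (- m) c = 1" by (simp add: ech_mult)
        then show ?thesis by (simp add: h_def ech_add mult_ac)
      qed
      ultimately show ?thesis by (simp add: fco_def)
    qed
    moreover have "continuous_on UNIV h" unfolding h_def by (intro continuous_intros continuous_translate cont)
    ultimately have "Re (h (\<chi> i. pi)) \<le> 0" by (intro fourier_zero_at_centre)
    then show ?thesis by (simp add: h_def c_def)
  qed
  from le[of 1] le[of "-1"] le[of \<i>] le[of "- \<i>"] show ?thesis by (simp add: complex_eq_iff)
qed

section \<open>Absolutely convergent Fourier series and products\<close>

lemma fco_bound:
  fixes f :: "real ^ 'd::finite \<Rightarrow> complex"
  assumes cont: "continuous_on UNIV f" and B: "\<And>x. cmod (f x) \<le> B"
  shows "cmod (fco f m) \<le> B"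
proof -
  have "cmod (integral cell (\<lambda>x. f x * ech (- m) x)) \<le> B * measure lborel (cell :: (real ^ 'd) set)"
    by (rule integrable_bound) (use B order_trans[OF norm_ge_zero B] in \<open>auto simp: norm_mult intro!: integrable_continuous continuous_intros continuous_on_subset[OF cont]\<close>)
  then show ?thesis by (simp add: fco_def content_cell norm_divide norm_power norm_mult power_mult_distrib divide_le_eq)
qed

lemma fco_diff:
  fixes f g :: "real ^ 'd::finite \<Rightarrow> complex"
  assumes "continuous_on UNIV f" "continuous_on UNIV g"
  shows "fco (\<lambda>x. f x - g x) m = fco f m - fco g m"
proof -
  have "(\<lambda>x. h x * ech (- m) x) integrable_on cell" if "continuous_on UNIV h" for h
    by (intro integrable_continuous continuous_intros continuous_on_subset[OF that]) simp
  then show ?thesis using assms by (simp add: fco_def left_diff_distrib integral_diff diff_divide_distrib)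
qed

lemma fco_trig_sum:
  fixes a :: "int ^ 'd::finite \<Rightarrow> complex"
  assumes "finite X"
  shows "fco (\<lambda>x. \<Sum>m\<in>X. a m * ech m x) k = (if k \<in> X then a k else 0)"
proof -
  have "integral cell (\<lambda>x :: real ^ 'd. (\<Sum>m\<in>X. a m * ech m x) * ech (- k) x)
     = integral cell (\<lambda>x :: real ^ 'd. \<Sum>m\<in>X. a m * ech (m - k) x)"
    by (simp add: sum_distrib_right mult.assoc ech_mult)
  also have "\<dots> = (\<Sum>m\<in>X. integral cell (\<lambda>x :: real ^ 'd. a m * ech (m - k) x))"
    by (rule integral_sum[OF assms]) (intro integrable_continuous continuous_intros)
  also have "\<dots> = (\<Sum>m\<in>X. if m = k then a k * (2 * pi) ^ CARD('d) else 0)"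
    by (intro sum.cong) (auto simp: integral_ech)
  also have "\<dots> = (if k \<in> X then a k * (2 * pi) ^ CARD('d) else 0)" using assms by simp
  finally show ?thesis by (simp add: fco_def)
qed

text \<open>Absolute summability yields a uniform limit, which is continuous and has the same
  coefficients as \<open>g\<close>; by uniqueness it is \<open>g\<close>.\<close>

lemma fourier_series_uniform:
  fixes g :: "real ^ 'd::finite \<Rightarrow> complex"
  assumes per: "periodic g" and cont: "continuous_on UNIV g" and summ: "(\<lambda>m. cmod (fco g m)) summable_on UNIV"
  shows "uniform_limit UNIV (\<lambda>X x. \<Sum>m\<in>X. fco g m * ech m x) g (finite_subsets_at_top UNIV)"
proof -
  define S where "S x = (\<Sum>\<^sub>\<infinity>m. fco g m * ech m x)" for x
  have ul: "uniform_limit UNIV (\<lambda>X x. \<Sum>m\<in>X. fco g m * ech m x) S (finite_subsets_at_top UNIV)"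
    unfolding S_def by (rule Weierstrass_m_test_general[OF _ summ]) (simp add: norm_mult)
  have cS: "continuous_on UNIV S"
    by (rule uniform_limit_theorem[OF _ ul]) (auto intro!: always_eventually continuous_intros)
  have "ech m (x + axis i (2 * pi)) = ech m x" for m i and x :: "real ^ 'd"
    using periodic_ech[of m] by (simp add: periodic_def)
  then have pS: "periodic S" unfolding S_def periodic_def by simp
  have "fco S k = fco g k" for k
  proof -
    have "cmod (fco S k - fco g k) \<le> 0 + e" if e: "0 < e" for e
    proof -
      have "\<forall>\<^sub>F X in finite_subsets_at_top UNIV. \<forall>x. dist (\<Sum>m\<in>X. fco g m * ech m x) (S x) < e"
        using uniform_limitD[OF ul e] by simp
      then obtain X0 where X0: "finite X0" "\<And>X. finite X \<Longrightarrow> X0 \<subseteq> X \<Longrightarrow> \<forall>x. dist (\<Sum>m\<in>X. fco g m * ech m x) (S x) < e"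
        unfolding eventually_finite_subsets_at_top by auto
      \<comment> \<open>With \<open>k\<close> included, the coefficient of the partial sum at
        \<open>k\<close> is exactly \<open>fco g k\<close>.\<close>
      let ?X = "insert k X0"
      have close: "dist (\<Sum>m\<in>?X. fco g m * ech m x) (S x) < e" for x using X0(2)[of ?X] X0(1) by auto
      have "fco (\<lambda>x. S x - (\<Sum>m\<in>?X. fco g m * ech m x)) k = fco S k - fco g k"
        using fco_diff[OF cS, of "\<lambda>x. \<Sum>m\<in>?X. fco g m * ech m x" k] fco_trig_sum[of ?X "fco g" k] X0(1)
        by (simp add: continuous_intros)
      moreover have "cmod (fco (\<lambda>x. S x - (\<Sum>m\<in>?X. fco g m * ech m x)) k) \<le> e"
        by (rule fco_bound) (use close in \<open>auto intro!: continuous_intros cS less_imp_le simp: dist_norm norm_minus_commute\<close>)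
      ultimately show ?thesis by simp
    qed
    then have "cmod (fco S k - fco g k) \<le> 0" by (rule field_le_epsilon)
    then show ?thesis by simp
  qed
  then have "S x - g x = 0" for x
    by (intro fourier_uniqueness[where g = "\<lambda>x. S x - g x"]) (use pS per in \<open>auto simp: fco_diff cS cont periodic_def intro!: continuous_intros cS cont\<close>)
  then have "S = g" by (simp add: fun_eq_iff)
  with ul show ?thesis by simp
qed

lemma space_torus [simp]: "space torus = cell"
  by (simp add: torus_def)

lemma integrable_torus_const: "integrable torus (\<lambda>x :: real ^ 'd::finite. c :: real)"
  using continuous_imp_integrable[OF continuous_on_const] by (simp add: torus_def)

lemma L2_integrable:
  assumes "f \<in> L2"
  shows "integrable torus f"
proof (rule Bochner_Integration.integrable_bound)
  show "integrable torus (\<lambda>x. 1 + (cmod (f x))\<^sup>2)"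
    using assms by (intro Bochner_Integration.integrable_add integrable_torus_const) (simp add: L2_def)
  show "f \<in> borel_measurable torus" using assms by (simp add: L2_def)
  have "cmod z \<le> 1 + (cmod z)\<^sup>2" for z
  proof (cases "cmod z \<le> 1")
    case False
    then have "cmod z * 1 \<le> cmod z * cmod z" by (intro mult_left_mono) auto
    then show ?thesis by (simp add: power2_eq_square)
  qed (simp add: add_increasing2)
  then show "AE x in torus. norm (f x) \<le> norm (1 + (cmod (f x))\<^sup>2)" by (intro AE_I2) (simp add: abs_of_nonneg)
qed

lemma integrable_continuous_mult:
  fixes f h :: "real ^ 'd::finite \<Rightarrow> complex"
  assumes f: "integrable torus f" and h: "continuous_on UNIV h"
  shows "integrable torus (\<lambda>x. h x * f x)"
proof -
  have "compact (h ` cell)" by (intro compact_continuous_image continuous_on_subset[OF h] compact_cbox) simp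
  then obtain B where B: "\<And>x. x \<in> cell \<Longrightarrow> cmod (h x) \<le> B"
    using compact_imp_bounded by (force simp: bounded_iff)
  show ?thesis
  proof (rule Bochner_Integration.integrable_bound)
    show "integrable torus (\<lambda>x. B * cmod (f x))" using f by simp
    show "(\<lambda>x. h x * f x) \<in> borel_measurable torus"
      using borel_measurable_integrable[OF f] borel_measurable_integrable[OF LINT_torus_continuous(1)[OF h]] by simp
    show "AE x in torus. norm (h x * f x) \<le> norm (B * cmod (f x))"
      using B by (intro AE_I2) (auto simp: norm_mult abs_mult intro!: mult_right_mono order_trans[OF B abs_ge_self])
  qed
qed

text \<open>The formula is exact for finite partial sums of the series of \<open>g\<close>. The
  remainder is bounded by its supremum norm times the integral of \<open>|f|\<close>, so uniform
  convergence suffices for merely integrable \<open>f\<close>.\<close>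

lemma fourier_coeff_product:
  fixes f g :: "real ^ 'd::finite \<Rightarrow> complex"
  assumes f: "integrable torus f" and per: "periodic g" and cont: "continuous_on UNIV g"
    and summ: "(\<lambda>m. cmod (fco g m)) summable_on UNIV"
  shows "((\<lambda>k. fco g (j - k) * fourier_coeff f k) has_sum fourier_coeff (\<lambda>x. g x * f x) j) UNIV"
proof -
  let ?c = "(2 * pi) ^ CARD('d) :: real"
  define I where "I = (LINT x|torus. cmod (f x))"
  have I0: "0 \<le> I" by (simp add: I_def)
  have ul: "uniform_limit UNIV (\<lambda>X x. \<Sum>m\<in>X. fco g m * ech m x) g (finite_subsets_at_top UNIV)"
    by (rule fourier_series_uniform[OF per cont summ])
  have int: "integrable torus (\<lambda>x. h x * f x * ech k x)" if "continuous_on UNIV h" for h k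
    using integrable_continuous_mult[OF f, of "\<lambda>x. h x * ech k x"] that by (simp add: continuous_intros mult_ac)
  have fin: "(\<Sum>m\<in>X. fco g m * fourier_coeff f (j - m)) = fourier_coeff (\<lambda>x. (\<Sum>m\<in>X. fco g m * ech m x) * f x) j"
    if "finite X" for X
  proof -
    have "(LINT x|torus. (\<Sum>m\<in>X. fco g m * ech m x) * f x * ech (- j) x)
       = (LINT x|torus. (\<Sum>m\<in>X. fco g m * (f x * ech (- (j - m)) x)))"
    proof (intro Bochner_Integration.integral_cong refl)
      fix x :: "real ^ 'd"
      have e: "ech (m - j) x = ech m x * ech (- j) x" for m by (simp add: ech_mult)
      show "(\<Sum>m\<in>X. fco g m * ech m x) * f x * ech (- j) x = (\<Sum>m\<in>X. fco g m * (f x * ech (- (j - m)) x))"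
        by (simp add: e sum_distrib_right sum_distrib_left mult_ac)
    qed
    also have "\<dots> = (\<Sum>m\<in>X. fco g m * (LINT x|torus. f x * ech (- (j - m)) x))"
      using int[of "\<lambda>x. 1"] by (subst Bochner_Integration.integral_sum) auto
    finally show ?thesis by (simp add: fourier_coeff_eq_LINT sum_divide_distrib)
  qed
  have "((\<lambda>m. fco g m * fourier_coeff f (j - m)) has_sum fourier_coeff (\<lambda>x. g x * f x) j) UNIV"
    unfolding has_sum_def
  proof (rule tendstoI)
    fix e :: real assume e: "0 < e"
    define d where "d = e * ?c / (I + 1)"
    have d: "0 < d" using e I0 by (simp add: d_def)
    have "\<forall>\<^sub>F X in finite_subsets_at_top UNIV. \<forall>x. dist (\<Sum>m\<in>X. fco g m * ech m x) (g x) < d"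
      using uniform_limitD[OF ul d] by simp
    moreover have "\<forall>\<^sub>F X in finite_subsets_at_top (UNIV :: (int ^ 'd) set). finite X"
      by (rule eventually_finite_subsets_at_top_weakI) simp
    ultimately show "\<forall>\<^sub>F X in finite_subsets_at_top UNIV. dist (\<Sum>m\<in>X. fco g m * fourier_coeff f (j - m)) (fourier_coeff (\<lambda>x. g x * f x) j) < e"
    proof eventually_elim
      case (elim X)
      let ?S = "\<lambda>x. \<Sum>m\<in>X. fco g m * ech m x"
      have cS: "continuous_on UNIV ?S" by (intro continuous_intros)
      have "(LINT x|torus. ?S x * f x * ech (- j) x) - (LINT x|torus. g x * f x * ech (- j) x)
          = (LINT x|torus. (?S x - g x) * f x * ech (- j) x)"
        by (subst Bochner_Integration.integral_diff[symmetric]) (auto intro: int cS cont simp: left_diff_distrib)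
      also have "cmod \<dots> \<le> (LINT x|torus. d * cmod (f x))"
      proof (rule Bochner_Integration.integral_norm_bound_integral)
        show "integrable torus (\<lambda>x. (?S x - g x) * f x * ech (- j) x)"
          by (rule int) (intro continuous_intros cont)
        show "integrable torus (\<lambda>x. d * cmod (f x))" using f by simp
        show "norm ((?S x - g x) * f x * ech (- j) x) \<le> d * cmod (f x)" for x
        proof -
          have "cmod (?S x - g x) \<le> d" using elim(1) by (auto simp: dist_norm less_imp_le)
          then show ?thesis by (simp add: norm_mult mult_right_mono)
        qed
      qed
      also have "\<dots> = d * I" by (simp add: I_def)
      also have "\<dots> < e * ?c" using e I0 by (simp add: d_def field_simps)
      finally have "cmod ((LINT x|torus. ?S x * f x * ech (- j) x) - (LINT x|torus. g x * f x * ech (- j) x)) < e * ?c" .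
      then have "dist (fourier_coeff (\<lambda>x. ?S x * f x) j) (fourier_coeff (\<lambda>x. g x * f x) j) < e"
        unfolding dist_norm fourier_coeff_eq_LINT diff_divide_distrib[symmetric]
        by (simp add: norm_divide norm_power norm_mult power_mult_distrib divide_less_eq)
      then show ?case by (simp only: fin[OF elim(2)])
    qed
  qed
  moreover have "bij (\<lambda>k. j - k)" by (rule bij_betw_byWitness[of _ "\<lambda>k. j - k"]) auto
  ultimately show ?thesis
    using has_sum_reindex_bij_betw[of "\<lambda>k. j - k" UNIV UNIV "\<lambda>m. fco g m * fourier_coeff f (j - m)"] by simp
qed

section \<open>Fourier coefficients of the potential and of solutions\<close>

lemma smooth_partial: "smooth f \<Longrightarrow> e \<in> Basis \<Longrightarrow> smooth (partial_deriv e f)"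
  unfolding smooth_def by (metis Ck.simps(2))

lemma smooth_partial_funpow: "smooth f \<Longrightarrow> e \<in> Basis \<Longrightarrow> smooth ((partial_deriv e ^^ n) f)"
  by (induction n) (auto intro: smooth_partial)

lemma smooth_continuous: "smooth f \<Longrightarrow> continuous_on UNIV f"
  unfolding smooth_def by (metis Ck.simps(1))

lemma smooth_has_partial:
  assumes "smooth f" "e \<in> Basis"
  shows "((\<lambda>h. f (x + h *\<^sub>R e)) has_vector_derivative partial_deriv e f x) (at 0)"
proof -
  have "Ck (Suc 0) f" using assms(1) unfolding smooth_def by blast
  then have "(\<lambda>h. f (x + h *\<^sub>R e)) differentiable (at 0)" using assms(2) by simp
  then show ?thesis unfolding partial_deriv_def by (simp add: vector_derivative_works)
qed

lemma Basis_t: "(1, 0) \<in> (Basis :: (real \<times> (real ^ 'd::finite)) set)"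
  and Basis_x: "(0, axis i 1) \<in> (Basis :: (real \<times> (real ^ 'd::finite)) set)"
  by (auto simp: Basis_prod_def Basis_vec_def)

lemma periodic_partial:
  assumes "\<And>t. periodic (\<lambda>x. f (t, x))"
  shows "periodic (\<lambda>x. partial_deriv e f (t, x))"
proof -
  have "f ((t, x + axis i (2 * pi)) + h *\<^sub>R e) = f ((t, x) + h *\<^sub>R e)" for x i h
  proof -
    have "f (t + h *\<^sub>R fst e, (x + h *\<^sub>R snd e) + axis i (2 * pi)) = f (t + h *\<^sub>R fst e, x + h *\<^sub>R snd e)"
      using assms[of "t + h *\<^sub>R fst e"] unfolding periodic_def by blast
    then show ?thesis by (cases e) (simp add: algebra_simps)
  qed
  then show ?thesis unfolding periodic_def partial_deriv_def by simp
qed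

lemma periodic_partial_funpow:
  assumes "\<And>t. periodic (\<lambda>x. f (t, x))"
  shows "periodic (\<lambda>x. (partial_deriv e ^^ n) f (t, x))"
proof (induction n arbitrary: t)
  case 0
  then show ?case by (simp add: assms)
next
  case (Suc n)
  then show ?case using periodic_partial[of "(partial_deriv e ^^ n) f" e t] by simp
qed

definition tco :: "(real \<times> (real ^ 'd::finite) \<Rightarrow> real) \<Rightarrow> real \<Rightarrow> int ^ 'd \<Rightarrow> complex" where
  "tco f t m = fco (\<lambda>x. of_real (f (t, x))) m"

lemma continuous_slice:
  fixes f :: "real \<times> (real ^ 'd::finite) \<Rightarrow> real"
  assumes "continuous_on UNIV f"
  shows "continuous_on S (\<lambda>x. complex_of_real (f (t, x)))"
  by (intro continuous_on_of_real continuous_on_compose2[OF assms]) (auto intro!: continuous_intros)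

lemma tco_deriv:
  fixes f :: "real \<times> (real ^ 'd::finite) \<Rightarrow> real"
  assumes f: "smooth f"
  shows "((\<lambda>t. tco f t m) has_vector_derivative tco (partial_deriv (1, 0) f) t m) (at t)"
proof -
  let ?D = "partial_deriv (1, 0) f"
  have D: "smooth ?D" by (rule smooth_partial[OF f Basis_t])
  have "((\<lambda>t. integral cell (\<lambda>x. of_real (f (t, x)) * ech (- m) x)) has_vector_derivative
      integral cell (\<lambda>x. of_real (?D (t, x)) * ech (- m) x)) (at t within UNIV)"
  proof (rule leibniz_rule_vector_derivative)
    show "((\<lambda>s. of_real (f (s, x)) * ech (- m) x) has_vector_derivative of_real (?D (s, x)) * ech (- m) x) (at s within UNIV)" for s x
    proof -
      have "((\<lambda>s. f ((0, x) + s *\<^sub>R (1, 0))) has_vector_derivative ?D ((0, x) + s *\<^sub>R (1, 0))) (at s)"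
        by (rule shifted_derivative) (rule smooth_has_partial[OF f Basis_t])
      then have "((\<lambda>s. f (s, x)) has_vector_derivative ?D (s, x)) (at s)" by simp
      from bounded_linear.has_vector_derivative[OF bounded_linear_of_real this]
      have "((\<lambda>s. complex_of_real (f (s, x))) has_vector_derivative complex_of_real (?D (s, x))) (at s)" .
      then show ?thesis by (intro has_vector_derivative_mult_left) simp
    qed
    show "(\<lambda>x. of_real (f (s, x)) * ech (- m) x) integrable_on cell" for s
      by (intro integrable_continuous continuous_intros continuous_slice smooth_continuous f)
    have "continuous_on (UNIV \<times> cell) (\<lambda>p. complex_of_real (?D p) * ech (- m) (snd p))"
      by (intro continuous_intros continuous_on_of_real continuous_on_subset[OF smooth_continuous[OF D]]
          continuous_on_compose2[OF continuous_ech[of UNIV "- m"]]) auto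
    then show "continuous_on (UNIV \<times> cell) (\<lambda>(s, x). complex_of_real (?D (s, x)) * ech (- m) x)"
      by (simp add: case_prod_unfold)
  qed auto
  then have "((\<lambda>t. integral cell (\<lambda>x. of_real (f (t, x)) * ech (- m) x) * (1 / (2 * pi) ^ CARD('d))) has_vector_derivative
      integral cell (\<lambda>x. of_real (?D (t, x)) * ech (- m) x) * (1 / (2 * pi) ^ CARD('d))) (at t)"
    by (intro has_vector_derivative_mult_left) simp
  then show ?thesis by (simp add: tco_def fco_def)
qed

lemma tco_partial:
  fixes f :: "real \<times> (real ^ 'd::finite) \<Rightarrow> real"
  assumes f: "smooth f" and per: "\<And>t. periodic (\<lambda>x. f (t, x))"
  shows "tco (partial_deriv (0, axis i 1) f) t m = \<i> * of_int (m $ i) * tco f t m"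
  unfolding tco_def
proof (rule fco_partial)
  show "periodic (\<lambda>x. complex_of_real (f (t, x)))" using per[of t] by (simp add: periodic_def)
  show "((\<lambda>h. complex_of_real (f (t, x + h *\<^sub>R axis i 1))) has_vector_derivative
      complex_of_real (partial_deriv (0, axis i 1) f (t, x))) (at 0)" for x
    using bounded_linear.has_vector_derivative[OF bounded_linear_of_real smooth_has_partial[OF f Basis_x[of i], of "(t, x)"]]
    by simp
qed (intro continuous_slice smooth_continuous smooth_partial f Basis_x)+

lemma tco_partial_funpow:
  fixes f :: "real \<times> (real ^ 'd::finite) \<Rightarrow> real"
  assumes f: "smooth f" and per: "\<And>t. periodic (\<lambda>x. f (t, x))"
  shows "tco ((partial_deriv (0, axis i 1) ^^ N) f) t m = (\<i> * of_int (m $ i)) ^ N * tco f t m"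
proof (induction N)
  case (Suc N)
  have "tco ((partial_deriv (0, axis i 1) ^^ Suc N) f) t m = \<i> * of_int (m $ i) * tco ((partial_deriv (0, axis i 1) ^^ N) f) t m"
    using tco_partial[OF smooth_partial_funpow[OF f Basis_x[of i]] periodic_partial_funpow[OF per]] by simp
  then show ?case using Suc by simp
qed simp

text \<open>Partial derivatives are never interchanged: once the two sides agree as functions of
  \<open>t\<close> for \<open>l\<close>, uniqueness of the time derivative gives the case
  \<open>Suc l\<close>.\<close>

lemma tco_mixed:
  fixes f :: "real \<times> (real ^ 'd::finite) \<Rightarrow> real"
  assumes f: "smooth f" and per: "\<And>t. periodic (\<lambda>x. f (t, x))"
  shows "tco ((partial_deriv (1, 0) ^^ l) ((partial_deriv (0, axis i 1) ^^ N) f)) t m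
     = (\<i> * of_int (m $ i)) ^ N * tco ((partial_deriv (1, 0) ^^ l) f) t m"
proof (induction l arbitrary: t)
  case 0
  then show ?case by (simp add: tco_partial_funpow[OF f per])
next
  case (Suc l)
  let ?g = "(partial_deriv (0, axis i 1) ^^ N) f"
  have g: "smooth ?g" by (rule smooth_partial_funpow[OF f Basis_x])
  have "((\<lambda>t. tco ((partial_deriv (1, 0) ^^ l) ?g) t m) has_vector_derivative tco ((partial_deriv (1, 0) ^^ Suc l) ?g) t m) (at t)"
    using tco_deriv[OF smooth_partial_funpow[OF g Basis_t, of l]] by simp
  moreover have "((\<lambda>t. (\<i> * of_int (m $ i)) ^ N * tco ((partial_deriv (1, 0) ^^ l) f) t m) has_vector_derivative
     (\<i> * of_int (m $ i)) ^ N * tco ((partial_deriv (1, 0) ^^ Suc l) f) t m) (at t)"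
    using has_vector_derivative_mult_right[OF tco_deriv[OF smooth_partial_funpow[OF f Basis_t, of l]]] by simp
  ultimately show ?case unfolding Suc using vector_derivative_unique_at by blast
qed

lemma foldr_single_index:
  assumes "distinct xs"
  shows "foldr (\<lambda>k. P k ^^ (if k = i then N else 0)) xs f = (if i \<in> set xs then (P i ^^ N) f else f)"
  using assms by (induction xs) auto

text \<open>With a single nonzero exponent the order in \<open>coords\<close> is immaterial.
  Derivatives of this kind are enough for the decay of the coefficients.\<close>

lemma mixed_deriv_single:
  "mixed_deriv l (\<chi> k. if k = i then N else 0) f = (partial_deriv (1, 0) ^^ l) ((partial_deriv (0, axis i 1) ^^ N) f)"
  for f :: "real \<times> (real ^ 'd::finite) \<Rightarrow> real"
proof -
  have "\<exists>is :: 'd list. distinct is \<and> set is = UNIV"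
    using finite_distinct_list[of "UNIV :: 'd set"] by auto
  then have "distinct (coords :: 'd list) \<and> set (coords :: 'd list) = UNIV" unfolding coords_def by (rule someI_ex)
  then show ?thesis unfolding mixed_deriv_def
    using foldr_single_index[where xs = coords and P = "\<lambda>i. partial_deriv (0, axis i 1)" and i = i and N = N and f = f] by simp
qed

text \<open>Derivatives in direction \<open>i\<close> bound \<open>|m i| ^ N\<close> times the
  coefficient, and for each \<open>m\<close> the direction of its largest component controls the
  norm of \<open>m\<close>.\<close>

lemma smooth_potential_coefficients:
  fixes V :: "real \<times> (real ^ 'd::finite) \<Rightarrow> real" and W :: "real ^ 'd ^ 'd"
  assumes W: "invertible W" and V: "smooth V" and per: "\<And>t. periodic (\<lambda>x. V (t, x))"
    and bd: "\<And>l \<alpha>. \<exists>C. \<forall>t x. \<bar>mixed_deriv l \<alpha> V (t, x)\<bar> \<le> C"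
  shows "fourier_potential W (\<lambda>l. tco ((partial_deriv (1, 0) ^^ l) V))"
proof
  show "invertible W" by (rule W)
  show "((\<lambda>t. tco ((partial_deriv (1, 0) ^^ l) V) t m) has_vector_derivative tco ((partial_deriv (1, 0) ^^ Suc l) V) t m) (at t)" for l t m
    using tco_deriv[OF smooth_partial_funpow[OF V Basis_t, of l]] by simp
  show "tco ((partial_deriv (1, 0) ^^ 0) V) t (- m) = cnj (tco ((partial_deriv (1, 0) ^^ 0) V) t m)" for t m
  proof -
    have i: "(\<lambda>x. complex_of_real (V (t, x)) * ech (- m) x) integrable_on cell"
      by (intro integrable_continuous continuous_intros continuous_slice smooth_continuous V)
    have "cnj (integral cell (\<lambda>x. complex_of_real (V (t, x)) * ech (- m) x)) = integral cell (\<lambda>x. complex_of_real (V (t, x)) * ech m x)"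
      using integral_linear[OF i bounded_linear_cnj] by (simp add: o_def cnj_ech)
    then show ?thesis by (simp add: tco_def fco_def)
  qed
  show "\<exists>C. \<forall>t m. (1 + norm (int_vec m)) ^ N * cmod (tco ((partial_deriv (1, 0) ^^ l) V) t m) \<le> C" for l N
  proof -
    let ?T = "tco ((partial_deriv (1, 0) ^^ l) V)"
    have one: "\<exists>C. \<forall>t m. \<bar>real_of_int (m $ i)\<bar> ^ N * cmod (?T t m) \<le> C" for i N
    proof -
      let ?g = "(partial_deriv (1, 0) ^^ l) ((partial_deriv (0, axis i 1) ^^ N) V)"
      obtain C where C: "\<And>t x. \<bar>?g (t, x)\<bar> \<le> C" using bd[of l "\<chi> k. if k = i then N else 0"] unfolding mixed_deriv_single by blast
      have g: "smooth ?g" by (intro smooth_partial_funpow V Basis_t Basis_x)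
      have "\<bar>real_of_int (m $ i)\<bar> ^ N * cmod (?T t m) \<le> C" for t m
      proof -
        have "\<bar>real_of_int (m $ i)\<bar> ^ N * cmod (?T t m) = cmod (tco ?g t m)"
          unfolding tco_mixed[OF V per] by (simp add: norm_mult norm_power)
        also have "\<dots> \<le> C" unfolding tco_def
          by (rule fco_bound[OF continuous_slice[OF smooth_continuous[OF g]]]) (use C in auto)
        finally show ?thesis .
      qed
      then show ?thesis by blast
    qed
    then obtain C where C: "\<And>i N t m. \<bar>real_of_int (m $ i)\<bar> ^ N * cmod (?T t m) \<le> C i N" by metis
    let ?D = "real CARD('d)"
    let ?B = "2 ^ N * (\<Sum>i\<in>(UNIV :: 'd set). \<bar>C i 0\<bar> + ?D ^ N * \<bar>C i N\<bar>)"
    have "(1 + norm (int_vec m)) ^ N * cmod (?T t m) \<le> ?B" for t m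
    proof -
      have "Max (range (\<lambda>i. \<bar>m $ i\<bar>)) \<in> range (\<lambda>i. \<bar>m $ i\<bar>)" by (rule Max_in) auto
      then obtain i where "Max (range (\<lambda>i. \<bar>m $ i\<bar>)) = \<bar>m $ i\<bar>" by (rule imageE)
      then have imax: "\<bar>m $ k\<bar> \<le> \<bar>m $ i\<bar>" for k
        using Max_ge[of "range (\<lambda>i. \<bar>m $ i\<bar>)" "\<bar>m $ k\<bar>"] by simp
      let ?a = "\<bar>real_of_int (m $ i)\<bar>"
      have "norm (int_vec m) \<le> (\<Sum>k\<in>UNIV. \<bar>int_vec m $ k\<bar>)" by (rule norm_le_l1_cart)
      also have "\<dots> \<le> (\<Sum>k\<in>(UNIV :: 'd set). ?a)"
        by (rule sum_mono) (use imax in \<open>simp add: int_vec_def flip: of_int_abs\<close>)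
      finally have n: "norm (int_vec m) \<le> ?D * ?a" by simp
      have "(1 + norm (int_vec m)) ^ N \<le> (2 * max 1 (?D * ?a)) ^ N" by (rule power_mono) (use n in auto)
      also have "\<dots> = 2 ^ N * max 1 (?D * ?a) ^ N" by (simp add: power_mult_distrib)
      also have "max 1 (?D * ?a) ^ N \<le> 1 + ?D ^ N * ?a ^ N"
        by (cases "1 \<le> ?D * ?a") (auto simp: max_def power_mult_distrib)
      finally have "(1 + norm (int_vec m)) ^ N * cmod (?T t m) \<le> 2 ^ N * (1 + ?D ^ N * ?a ^ N) * cmod (?T t m)"
        by (intro mult_right_mono) auto
      also have "\<dots> = 2 ^ N * (?a ^ 0 * cmod (?T t m) + ?D ^ N * (?a ^ N * cmod (?T t m)))" by (simp add: algebra_simps)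
      also have "\<dots> \<le> 2 ^ N * (\<bar>C i 0\<bar> + ?D ^ N * \<bar>C i N\<bar>)"
        by (intro mult_left_mono add_mono order_trans[OF C abs_ge_self]) auto
      also have "\<dots> \<le> ?B"
        by (intro mult_left_mono member_le_sum) auto
      finally show ?thesis .
    qed
    then show ?thesis by blast
  qed
qed

section \<open>Bessel's inequality and boundedness of continuous curves\<close>

lemma power2_add_le: "(a + b)\<^sup>2 \<le> 2 * a\<^sup>2 + 2 * (b :: real)\<^sup>2"
  using zero_le_power2[of "a - b"] by (simp add: power2_eq_square algebra_simps)

lemma L2_diff_square_integrable:
  assumes f: "f \<in> L2" and g: "g \<in> L2"
  shows "integrable torus (\<lambda>x. (cmod (f x - g x))\<^sup>2)"
proof (rule Bochner_Integration.integrable_bound)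
  show "integrable torus (\<lambda>x. 2 * (cmod (f x))\<^sup>2 + 2 * (cmod (g x))\<^sup>2)" using f g by (simp add: L2_def)
  have [measurable]: "f \<in> borel_measurable torus" "g \<in> borel_measurable torus" using f g by (auto simp: L2_def)
  show "(\<lambda>x. (cmod (f x - g x))\<^sup>2) \<in> borel_measurable torus" by measurable
  show "AE x in torus. norm ((cmod (f x - g x))\<^sup>2) \<le> norm (2 * (cmod (f x))\<^sup>2 + 2 * (cmod (g x))\<^sup>2)"
  proof (rule AE_I2)
    fix x
    have "cmod (f x - g x) \<le> cmod (f x) + cmod (g x)" by (rule norm_triangle_ineq4)
    then have "(cmod (f x - g x))\<^sup>2 \<le> (cmod (f x) + cmod (g x))\<^sup>2" by (rule power_mono) simp
    also have "\<dots> \<le> 2 * (cmod (f x))\<^sup>2 + 2 * (cmod (g x))\<^sup>2"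
      by (rule power2_add_le)
    finally show "norm ((cmod (f x - g x))\<^sup>2) \<le> norm (2 * (cmod (f x))\<^sup>2 + 2 * (cmod (g x))\<^sup>2)" by simp
  qed
qed

lemma bessel:
  fixes f :: "real ^ 'd::finite \<Rightarrow> complex"
  assumes f: "f \<in> L2" and X: "finite X"
  shows "(\<Sum>j\<in>X. (cmod (fourier_coeff f j))\<^sup>2) \<le> (LINT x|torus. (cmod (f x))\<^sup>2) / (2 * pi) ^ CARD('d)"
proof -
  let ?c = "fourier_coeff f" and ?K = "(2 * pi) ^ CARD('d) :: real"
  define S where "S x = (\<Sum>j\<in>X. ?c j * ech j x)" for x
  have cS: "continuous_on UNIV S" unfolding S_def by (intro continuous_intros)
  have cS': "continuous_on UNIV (\<lambda>x. cnj (S x))" by (intro continuous_intros cS)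
  have fi: "integrable torus f" by (rule L2_integrable[OF f])
  have i1: "integrable torus (\<lambda>x. (cmod (f x))\<^sup>2)" using f by (simp add: L2_def)
  have i2: "integrable torus (\<lambda>x. cnj (S x) * f x)" by (rule integrable_continuous_mult[OF fi cS'])
  have i3: "integrable torus (\<lambda>x. cnj (S x) * S x)"
    by (rule LINT_torus_continuous(1)) (intro continuous_intros cS)
  have pair: "(LINT x|torus. cnj (S x) * h x) = of_real (?K * (\<Sum>j\<in>X. (cmod (?c j))\<^sup>2))"
    if h: "integrable torus h" and hc: "\<And>j. j \<in> X \<Longrightarrow> fourier_coeff h j = ?c j" for h
  proof -
    have "(LINT x|torus. cnj (S x) * h x) = (LINT x|torus. (\<Sum>j\<in>X. cnj (?c j) * (ech (- j) x * h x)))"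
      by (simp add: S_def cnj_ech sum_distrib_right mult.assoc)
    also have "\<dots> = (\<Sum>j\<in>X. cnj (?c j) * (LINT x|torus. ech (- j) x * h x))"
      by (subst Bochner_Integration.integral_sum) (simp_all add: integrable_continuous_mult[OF h continuous_ech])
    also have "\<dots> = (\<Sum>j\<in>X. cnj (?c j) * (?K * ?c j))"
    proof (rule sum.cong[OF refl])
      fix j assume "j \<in> X"
      have "(LINT x|torus. ech (- j) x * h x) = (LINT x|torus. h x * ech (- j) x)" by (simp add: mult.commute)
      also have "\<dots> = ?K * fourier_coeff h j" by (simp add: fourier_coeff_eq_LINT)
      finally show "cnj (?c j) * (LINT x|torus. ech (- j) x * h x) = cnj (?c j) * (?K * ?c j)"
        using hc[OF \<open>j \<in> X\<close>] by simp
    qed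
    also have "\<dots> = (\<Sum>j\<in>X. of_real (?K * (cmod (?c j))\<^sup>2))"
      by (intro sum.cong refl) (simp add: complex_norm_square mult_ac del: of_real_power)
    finally show ?thesis by (simp only: of_real_sum[symmetric] sum_distrib_left)
  qed
  have p2: "(LINT x|torus. cnj (S x) * f x) = of_real (?K * (\<Sum>j\<in>X. (cmod (?c j))\<^sup>2))"
    by (rule pair[OF fi refl])
  have p3: "(LINT x|torus. cnj (S x) * S x) = of_real (?K * (\<Sum>j\<in>X. (cmod (?c j))\<^sup>2))"
  proof (rule pair[OF LINT_torus_continuous(1)[OF cS]])
    fix j assume "j \<in> X"
    then show "fourier_coeff S j = ?c j"
      unfolding fourier_coeff_continuous[OF cS] using fco_trig_sum[OF X, of ?c j] by (simp add: S_def[abs_def])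
  qed
  have exp: "(cmod (f x - S x))\<^sup>2 = (cmod (f x))\<^sup>2 - 2 * Re (cnj (S x) * f x) + Re (cnj (S x) * S x)" for x
    unfolding cmod_power2 by (simp add: power2_eq_square algebra_simps)
  have "0 \<le> (LINT x|torus. (cmod (f x - S x))\<^sup>2)" by simp
  also have "\<dots> = (LINT x|torus. (cmod (f x))\<^sup>2 - 2 * Re (cnj (S x) * f x) + Re (cnj (S x) * S x))"
    by (simp only: exp)
  also have "\<dots> = (LINT x|torus. (cmod (f x))\<^sup>2) - 2 * (LINT x|torus. Re (cnj (S x) * f x)) + (LINT x|torus. Re (cnj (S x) * S x))"
    using i1 integrable_bounded_linear[OF bounded_linear_Re i2] integrable_bounded_linear[OF bounded_linear_Re i3]
    by (simp del: times_complex.sel)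
  also have "\<dots> = (LINT x|torus. (cmod (f x))\<^sup>2) - 2 * Re (LINT x|torus. cnj (S x) * f x) + Re (LINT x|torus. cnj (S x) * S x)"
    unfolding integral_bounded_linear[OF bounded_linear_Re i2] integral_bounded_linear[OF bounded_linear_Re i3] ..
  also have "\<dots> = (LINT x|torus. (cmod (f x))\<^sup>2) - ?K * (\<Sum>j\<in>X. (cmod (?c j))\<^sup>2)"
    unfolding p2 p3 Re_complex_of_real by simp
  finally show ?thesis by (simp add: pos_le_divide_eq mult.commute)
qed

text \<open>Continuity bounds the norm near each time, and finitely many such neighbourhoods cover a
  compact interval. Together with Bessel's inequality this provides the a priori bound that
  \<open>mass_bound\<close> starts from.\<close>

lemma L2_curve_locally_bounded:
  fixes \<psi> :: "real \<Rightarrow> real ^ 'd::finite \<Rightarrow> complex"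
  assumes L2: "\<And>t. \<psi> t \<in> L2"
    and cont: "\<And>t. ((\<lambda>s. LINT x|torus. (cmod (\<psi> s x - \<psi> t x))\<^sup>2) \<longlongrightarrow> 0) (at t)"
  shows "\<exists>B. \<forall>s. \<bar>s\<bar> \<le> T \<longrightarrow> (LINT x|torus. (cmod (\<psi> s x))\<^sup>2) \<le> B"
proof -
  define h where "h t = (LINT x|torus. (cmod (\<psi> t x))\<^sup>2)" for t
  have sq: "integrable torus (\<lambda>x. (cmod (\<psi> t x))\<^sup>2)" for t using L2[of t] by (simp add: L2_def)
  have loc: "\<exists>U. open U \<and> t \<in> U \<and> (\<forall>s\<in>U. h s \<le> 2 + 2 * h t)" for t
  proof -
    have "\<forall>\<^sub>F s in at t. (LINT x|torus. (cmod (\<psi> s x - \<psi> t x))\<^sup>2) < 1"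
      using order_tendstoD(2)[OF cont[of t]] by simp
    then obtain U where U: "open U" "t \<in> U" "\<And>s. s \<in> U \<Longrightarrow> s \<noteq> t \<Longrightarrow> (LINT x|torus. (cmod (\<psi> s x - \<psi> t x))\<^sup>2) < 1"
      unfolding eventually_at_topological by blast
    have "h s \<le> 2 + 2 * h t" if s: "s \<in> U" for s
    proof -
      have d: "(LINT x|torus. (cmod (\<psi> s x - \<psi> t x))\<^sup>2) \<le> 1"
        by (cases "s = t") (use U(3)[OF s] in auto)
      have "h s \<le> (LINT x|torus. 2 * (cmod (\<psi> s x - \<psi> t x))\<^sup>2 + 2 * (cmod (\<psi> t x))\<^sup>2)"
        unfolding h_def
      proof (rule Bochner_Integration.integral_mono)
        show "integrable torus (\<lambda>x. 2 * (cmod (\<psi> s x - \<psi> t x))\<^sup>2 + 2 * (cmod (\<psi> t x))\<^sup>2)"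
          using sq L2_diff_square_integrable[OF L2 L2] by simp
        fix x
        have "cmod (\<psi> s x) \<le> cmod (\<psi> s x - \<psi> t x) + cmod (\<psi> t x)"
          using norm_triangle_ineq[of "\<psi> s x - \<psi> t x" "\<psi> t x"] by simp
        then have "(cmod (\<psi> s x))\<^sup>2 \<le> (cmod (\<psi> s x - \<psi> t x) + cmod (\<psi> t x))\<^sup>2" by (rule power_mono) simp
        also have "\<dots> \<le> 2 * (cmod (\<psi> s x - \<psi> t x))\<^sup>2 + 2 * (cmod (\<psi> t x))\<^sup>2"
          by (rule power2_add_le)
        finally show "(cmod (\<psi> s x))\<^sup>2 \<le> 2 * (cmod (\<psi> s x - \<psi> t x))\<^sup>2 + 2 * (cmod (\<psi> t x))\<^sup>2" .
      qed (rule sq)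
      also have "\<dots> = 2 * (LINT x|torus. (cmod (\<psi> s x - \<psi> t x))\<^sup>2) + 2 * h t"
        using sq L2_diff_square_integrable[OF L2 L2] by (simp add: h_def)
      finally show ?thesis using d by simp
    qed
    with U show ?thesis by blast
  qed
  have "\<exists>U. \<forall>t. open (U t) \<and> t \<in> U t \<and> (\<forall>s\<in>U t. h s \<le> 2 + 2 * h t)"
    by (rule choice) (intro allI loc)
  then obtain U where U: "\<And>t. open (U t)" "\<And>t. t \<in> U t" "\<And>t s. s \<in> U t \<Longrightarrow> h s \<le> 2 + 2 * h t" by blast
  have cover: "{- T..T} \<subseteq> (\<Union>c\<in>{- T..T}. U c)" using U(2) by auto
  obtain C' where C': "finite C'" "{- T..T} \<subseteq> (\<Union>c\<in>C'. U c)"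
    by (rule compactE_image[OF compact_Icc U(1) cover])
  have h0: "0 \<le> h t" for t by (simp add: h_def)
  have "h s \<le> (\<Sum>c\<in>C'. 2 + 2 * h c)" if "\<bar>s\<bar> \<le> T" for s
  proof -
    have "s \<in> {- T..T}" using that by auto
    then obtain c where c: "c \<in> C'" "s \<in> U c" using C'(2) by blast
    then have "h s \<le> 2 + 2 * h c" by (intro U(3))
    also have "\<dots> \<le> (\<Sum>c\<in>C'. 2 + 2 * h c)"
      by (rule member_le_sum[OF c(1)]) (use C'(1) h0 in auto)
    finally show ?thesis .
  qed
  then show ?thesis unfolding h_def by blast
qed

section \<open>From the Schroedinger equation to its Fourier coefficients\<close>

lemma partial_deriv_ech: "partial_deriv e (\<lambda>x. c * ech m x) = (\<lambda>x. (c * \<i> * of_real (int_vec m \<bullet> e)) * ech m x)"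
  by (rule ext) (simp add: partial_deriv_def vector_derivative_at[OF ech_has_partial])

lemma smooth_ech: "smooth (\<lambda>x. c * ech m x)"
proof -
  have "Ck n (\<lambda>x. c * ech m x)" for n
  proof (induction n arbitrary: c)
    case (Suc n)
    have "(\<lambda>h. c * ech m (x + h *\<^sub>R e)) differentiable (at 0)" for x e
      using ech_has_partial by (rule differentiableI_vector)
    then show ?case using Suc by (auto simp: partial_deriv_ech intro!: continuous_intros)
  qed (auto intro!: continuous_intros)
  then show ?thesis by (simp add: smooth_def)
qed

lemma lattice_laplacian_ech: "lattice_laplacian v (ech m) x = - of_real (eig (dual_matrix v) m) * ech m x"
proof -
  let ?W = "dual_matrix v" and ?y = "int_vec m"
  let ?A = "transpose ?W ** ?W"
  have p: "partial_deriv (axis a 1) (partial_deriv (axis b 1) (ech m)) x = - of_real (?y $ a * ?y $ b) * ech m x" for a b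
  proof -
    have e1: "partial_deriv (axis b 1) (ech m) = (\<lambda>x. (\<i> * of_real (?y \<bullet> axis b 1)) * ech m x)"
      using partial_deriv_ech[of _ 1 m] by simp
    have ii: "(\<i> * z) * \<i> * w = - (w * z)" for z w by (simp add: complex_eq_iff)
    show ?thesis unfolding e1 partial_deriv_ech ii by (simp add: inner_axis)
  qed
  have "(\<Sum>a\<in>UNIV. \<Sum>b\<in>UNIV. ?A $ a $ b * (?y $ a * ?y $ b)) = ?y \<bullet> (?A *v ?y)"
    by (simp add: inner_vec_def matrix_vector_mult_def sum_distrib_left mult_ac)
  also have "\<dots> = ?y \<bullet> ((?W *v ?y) v* ?W)" by (simp add: matrix_vector_mul_assoc[symmetric])
  also have "\<dots> = eig ?W m" by (simp add: inner_commute[of ?y] dot_lmul_matrix eig_def power2_norm_eq_inner)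
  finally have q: "(\<Sum>a\<in>UNIV. \<Sum>b\<in>UNIV. ?A $ a $ b * (?y $ a * ?y $ b)) = eig ?W m" .
  have "lattice_laplacian v (ech m) x = - (of_real (\<Sum>a\<in>UNIV. \<Sum>b\<in>UNIV. ?A $ a $ b * (?y $ a * ?y $ b)) * ech m x)"
    unfolding lattice_laplacian_def p by (simp add: scaleR_conv_of_real sum_distrib_right sum_negf mult.assoc)
  then show ?thesis unfolding q by simp
qed

lemma invertible_dual_matrix:
  fixes v :: "'d::finite \<Rightarrow> real ^ 'd"
  assumes inj: "inj v" and ind: "independent (range v)"
  shows "invertible (dual_matrix v)"
proof -
  let ?G = "gen_matrix v"
  have col: "column i ?G = v i" for i by (simp add: gen_matrix_def column_def vec_eq_iff)
  have "c i = 0" if s: "(\<Sum>i\<in>UNIV. c i *s column i ?G) = 0" for c i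
  proof -
    have "(\<Sum>b\<in>range v. c (inv v b) *\<^sub>R b) = (\<Sum>i\<in>UNIV. c i *\<^sub>R v i)"
      using inj by (subst sum.reindex) auto
    also have "\<dots> = 0" using s unfolding col by (simp add: scalar_mult_eq_scaleR)
    finally have "c (inv v (v i)) = 0" by (intro independentD[OF ind]) auto
    then show ?thesis using inj by simp
  qed
  then have "\<exists>B. B ** ?G = mat 1" unfolding matrix_left_invertible_independent_columns by blast
  then have "\<exists>B. ?G ** B = mat 1 \<and> B ** ?G = mat 1" using matrix_left_right_inverse by blast
  then have "?G ** matrix_inv ?G = mat 1 \<and> matrix_inv ?G ** ?G = mat 1" unfolding matrix_inv_def by (rule someI_ex)
  then have "invertible (matrix_inv ?G)" unfolding invertible_def by blast
  then show ?thesis unfolding dual_matrix_def by (rule transpose_invertible)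
qed

lemma schroedinger_solution_coefficients:
  fixes v :: "'d::finite \<Rightarrow> real ^ 'd" and V :: "real \<times> (real ^ 'd) \<Rightarrow> real"
  assumes pot: "fourier_potential (dual_matrix v) (\<lambda>l. tco ((partial_deriv (1, 0) ^^ l) V))"
    and V: "smooth V" and per: "\<And>t. periodic (\<lambda>x. V (t, x))"
    and sol: "schroedinger_solution v V \<psi>"
  shows "\<exists>b'. fourier_potential.seq_solution (dual_matrix v) (\<lambda>l. tco ((partial_deriv (1, 0) ^^ l) V))
     (\<lambda>j t. fourier_coeff (\<psi> t) j) b'"
proof -
  interpret fourier_potential "dual_matrix v" "\<lambda>l. tco ((partial_deriv (1, 0) ^^ l) V)" by (rule pot)
  let ?K = "(2 * pi) ^ CARD('d) :: real"
  have L2: "\<psi> t \<in> L2" for t using sol by (simp add: schroedinger_solution_def)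
  have "\<exists>D. ((\<lambda>s. fourier_coeff (\<psi> s) j) has_vector_derivative D) (at t) \<and>
     ((\<lambda>k. tco V t (j - k) * fourier_coeff (\<psi> t) k) has_sum (\<i> * D - of_real (eig (dual_matrix v) j) * fourier_coeff (\<psi> t) j)) UNIV" for j t
  proof -
    \<comment> \<open>The pairing in the weak formulation is bilinear, without conjugation, so the
      coefficient at \<open>j\<close> is obtained by testing with \<open>ech (- j)\<close>.\<close>
    have "smooth (ech (- j) :: real ^ 'd \<Rightarrow> complex)" using smooth_ech[of 1 "- j"] by simp
    then obtain D where D: "((\<lambda>s. LINT x|torus. \<psi> s x * ech (- j) x) has_vector_derivative D) (at t)"
      and eq: "\<i> * D = - (LINT x|torus. \<psi> t x * lattice_laplacian v (ech (- j)) x)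
                    + (LINT x|torus. of_real (V (t, x)) * \<psi> t x * ech (- j) x)"
      using sol periodic_ech[of "- j"] unfolding schroedinger_solution_def by blast
    have "eig (dual_matrix v) (- j) = eig (dual_matrix v) j"
      using linear_neg[OF matrix_vector_mul_linear, of "dual_matrix v" "int_vec j"] by (simp add: eig_def int_vec_minus)
    then have "\<psi> t x * lattice_laplacian v (ech (- j)) x = - of_real (eig (dual_matrix v) j) * (\<psi> t x * ech (- j) x)" for x
      by (simp add: lattice_laplacian_ech)
    then have "\<i> * D = of_real (eig (dual_matrix v) j) * (LINT x|torus. \<psi> t x * ech (- j) x)
                    + (LINT x|torus. of_real (V (t, x)) * \<psi> t x * ech (- j) x)"
      unfolding eq by simp
    then have iD: "\<i> * (D * (1 / ?K)) = of_real (eig (dual_matrix v) j) * fourier_coeff (\<psi> t) j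
        + fourier_coeff (\<lambda>x. of_real (V (t, x)) * \<psi> t x) j"
      unfolding fourier_coeff_eq_LINT by (simp add: add_divide_distrib)
    have "((\<lambda>s. (LINT x|torus. \<psi> s x * ech (- j) x) * (1 / ?K)) has_vector_derivative D * (1 / ?K)) (at t)"
      by (rule has_vector_derivative_mult_left[OF D])
    then have d: "((\<lambda>s. fourier_coeff (\<psi> s) j) has_vector_derivative D * (1 / ?K)) (at t)"
      by (simp add: fourier_coeff_eq_LINT)
    obtain C where C: "\<And>S. finite S \<Longrightarrow> (\<Sum>m\<in>S. cmod (tco V t m)) \<le> C" using v_sum[of 0] by auto
    have "(\<lambda>m. cmod (fco (\<lambda>x. complex_of_real (V (t, x))) m)) summable_on UNIV"
      by (rule nonneg_bdd_above_summable_on) (use C in \<open>auto intro!: bdd_aboveI2 simp: tco_def\<close>)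
    moreover have "periodic (\<lambda>x. complex_of_real (V (t, x)))" using per[of t] by (simp add: periodic_def)
    ultimately have "((\<lambda>k. fco (\<lambda>x. complex_of_real (V (t, x))) (j - k) * fourier_coeff (\<psi> t) k) has_sum
        fourier_coeff (\<lambda>x. of_real (V (t, x)) * \<psi> t x) j) UNIV"
      by (intro fourier_coeff_product L2_integrable L2 continuous_slice smooth_continuous V)
    then show ?thesis using d iD by (intro exI[of _ "D * (1 / ?K)"]) (simp add: tco_def)
  qed
  then have "\<forall>j. \<exists>D. \<forall>t. ((\<lambda>s. fourier_coeff (\<psi> s) j) has_vector_derivative D t) (at t) \<and>
     ((\<lambda>k. tco V t (j - k) * fourier_coeff (\<psi> t) k) has_sum (\<i> * D t - of_real (eig (dual_matrix v) j) * fourier_coeff (\<psi> t) j)) UNIV"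
    by (intro allI choice)
  then have "\<exists>b'. \<forall>j t. ((\<lambda>s. fourier_coeff (\<psi> s) j) has_vector_derivative b' j t) (at t) \<and>
     ((\<lambda>k. tco V t (j - k) * fourier_coeff (\<psi> t) k) has_sum (\<i> * b' j t - of_real (eig (dual_matrix v) j) * fourier_coeff (\<psi> t) j)) UNIV"
    by (rule choice)
  then show ?thesis unfolding seq_solution_def by simp
qed

theorem theorem1p1:
  fixes v :: "'d::finite \<Rightarrow> real ^ 'd"
    and V :: "real \<times> (real ^ 'd) \<Rightarrow> real"
    and r \<epsilon> :: real
  assumes "inj v" and "independent (range v)"
    and "smooth V" and "\<And>t. periodic (\<lambda>x. V (t, x))"
    and "\<And>l \<alpha>. \<exists>C. \<forall>t x. \<bar>mixed_deriv l \<alpha> V (t, x)\<bar> \<le> C"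
    and "r > 0" and "\<epsilon> > 0"
  shows "\<exists>C>0. \<forall>\<psi> \<psi>\<^sub>0. \<psi>\<^sub>0 \<in> sobolev r \<longrightarrow> schroedinger_solution v V \<psi> \<longrightarrow>
           (AE x in torus. \<psi> 0 x = \<psi>\<^sub>0 x) \<longrightarrow>
           (\<forall>t. \<psi> t \<in> sobolev r \<and>
                sobolev_norm r (\<psi> t) \<le> C * bracket t powr \<epsilon> * sobolev_norm r \<psi>\<^sub>0)"
proof -
  define W where "W = dual_matrix v"
  define vc where "vc = (\<lambda>l. tco ((partial_deriv (1, 0) ^^ l) V))"
  have pot: "fourier_potential W vc"
    unfolding W_def vc_def
    by (rule smooth_potential_coefficients[OF invertible_dual_matrix[OF assms(1,2)] assms(3-5)])
  interpret fourier_potential W vc by (rule pot)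
  define wt where "wt j = bracket (int_vec j :: real ^ 'd) powr (2 * r)" for j
  obtain C where C: "0 < C" and growth: "\<forall>b b' H t X. seq_solution b b' \<longrightarrow>
      (\<forall>T. \<exists>B. \<forall>X s. finite X \<longrightarrow> \<bar>s\<bar> \<le> T \<longrightarrow> (\<Sum>j\<in>X. (cmod (b j s))\<^sup>2) \<le> B) \<longrightarrow>
      (\<forall>X. finite X \<longrightarrow> (\<Sum>j\<in>X. wt j * (cmod (b j 0))\<^sup>2) \<le> H) \<longrightarrow> finite X \<longrightarrow>
      (\<Sum>j\<in>X. wt j * (cmod (b j t))\<^sup>2) \<le> C * bracket t powr (2 * \<epsilon>) * H"
    using sequence_growth[OF assms(6,7)] unfolding wt_def by (elim exE conjE)
  show ?thesis
  proof (rule exI[of _ "sqrt C"], intro conjI allI impI)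
    show "0 < sqrt C" using C by simp
  next
    fix \<psi> :: "real \<Rightarrow> real ^ 'd \<Rightarrow> complex" and \<psi>\<^sub>0 and t :: real
    assume \<psi>0: "\<psi>\<^sub>0 \<in> sobolev r" and sol: "schroedinger_solution v V \<psi>"
      and init: "AE x in torus. \<psi> 0 x = \<psi>\<^sub>0 x"
    have L2: "\<psi> t \<in> L2" for t using sol by (simp add: schroedinger_solution_def)
    obtain b' where seq: "seq_solution (\<lambda>j t. fourier_coeff (\<psi> t) j) b'"
      using schroedinger_solution_coefficients[OF pot[unfolded W_def vc_def] assms(3,4) sol] unfolding W_def vc_def by blast
    have bounded: "\<forall>T. \<exists>B. \<forall>X s. finite X \<longrightarrow> \<bar>s\<bar> \<le> T \<longrightarrow> (\<Sum>j\<in>X. (cmod (fourier_coeff (\<psi> s) j))\<^sup>2) \<le> B"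
    proof
      fix T
      have "((\<lambda>s. LINT x|torus. (cmod (\<psi> s x - \<psi> t x))\<^sup>2) \<longlongrightarrow> 0) (at t)" for t
        using sol by (simp add: schroedinger_solution_def)
      from L2_curve_locally_bounded[where \<psi> = \<psi>, OF L2 this]
      obtain B where B: "\<And>s. \<bar>s\<bar> \<le> T \<Longrightarrow> (LINT x|torus. (cmod (\<psi> s x))\<^sup>2) \<le> B" by blast
      have "(\<Sum>j\<in>X. (cmod (fourier_coeff (\<psi> s) j))\<^sup>2) \<le> B / (2 * pi) ^ CARD('d)" if "finite X" "\<bar>s\<bar> \<le> T" for X s
        using bessel[OF L2[of s] that(1)] divide_right_mono[OF B[OF that(2)], of "(2 * pi) ^ CARD('d)"] by simp
      then show "\<exists>B. \<forall>X s. finite X \<longrightarrow> \<bar>s\<bar> \<le> T \<longrightarrow> (\<Sum>j\<in>X. (cmod (fourier_coeff (\<psi> s) j))\<^sup>2) \<le> B" by blast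
    qed
    have coeff0: "fourier_coeff (\<psi> 0) j = fourier_coeff \<psi>\<^sub>0 j" for j
    proof -
      have "(LINT x|torus. \<psi> 0 x * ech (- j) x) = (LINT x|torus. \<psi>\<^sub>0 x * ech (- j) x)"
      proof (rule Bochner_Integration.integral_cong_AE)
        have e: "ech (- j) \<in> borel_measurable torus"
          by (rule borel_measurable_integrable[OF LINT_torus_continuous(1)[OF continuous_ech]])
        have "\<psi> 0 \<in> borel_measurable torus" "\<psi>\<^sub>0 \<in> borel_measurable torus"
          using L2[of 0] \<psi>0 by (auto simp: L2_def sobolev_def)
        with e show "(\<lambda>x. \<psi> 0 x * ech (- j) x) \<in> borel_measurable torus" "(\<lambda>x. \<psi>\<^sub>0 x * ech (- j) x) \<in> borel_measurable torus"
          by (auto intro: borel_measurable_times)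
        show "AE x in torus. \<psi> 0 x * ech (- j) x = \<psi>\<^sub>0 x * ech (- j) x" using init by eventually_elim simp
      qed
      then show ?thesis by (simp add: fourier_coeff_eq_LINT)
    qed
    define H where "H = (\<Sum>\<^sub>\<infinity>j. wt j * (cmod (fourier_coeff \<psi>\<^sub>0 j))\<^sup>2)"
    have summ0: "(\<lambda>j. wt j * (cmod (fourier_coeff \<psi>\<^sub>0 j))\<^sup>2) summable_on UNIV"
      using \<psi>0 by (simp add: sobolev_def wt_def)
    have wt0: "0 \<le> wt j" for j by (simp add: wt_def)
    have H: "\<forall>X. finite X \<longrightarrow> (\<Sum>j\<in>X. wt j * (cmod (fourier_coeff (\<psi> 0) j))\<^sup>2) \<le> H"
      unfolding H_def coeff0 by (intro allI impI finite_sum_le_infsum[OF summ0]) (auto simp: wt0)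
    let ?R = "C * bracket t powr (2 * \<epsilon>) * H"
    \<comment> \<open>Bounds on finite partial sums give at once that \<psi> at time
      \<open>t\<close> belongs to \<open>sobolev r\<close> and, in the limit, the estimate of its
      squared norm.\<close>
    have fin: "(\<Sum>j\<in>X. wt j * (cmod (fourier_coeff (\<psi> t) j))\<^sup>2) \<le> ?R" if "finite X" for X
      using growth seq bounded H that by blast
    have summ: "(\<lambda>j. wt j * (cmod (fourier_coeff (\<psi> t) j))\<^sup>2) summable_on UNIV"
      by (rule nonneg_bdd_above_summable_on) (use fin wt0 in \<open>auto intro!: bdd_aboveI2\<close>)
    show "\<psi> t \<in> sobolev r" using L2 summ by (simp add: sobolev_def wt_def)
    have "sobolev_norm r (\<psi> t) \<le> sqrt ?R"
      unfolding sobolev_norm_def wt_def[symmetric]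
      by (intro real_sqrt_le_mono infsum_le_finite_sums[OF summ] fin)
    also have "\<dots> = sqrt C * sqrt (bracket t powr (2 * \<epsilon>)) * sqrt H" by (simp add: real_sqrt_mult)
    also have "sqrt (bracket t powr (2 * \<epsilon>)) = bracket t powr \<epsilon>"
    proof -
      have "bracket t powr (2 * \<epsilon>) = (bracket t powr \<epsilon>)\<^sup>2" by (simp add: power2_eq_square powr_add[symmetric])
      then show ?thesis by simp
    qed
    also have "sqrt H = sobolev_norm r \<psi>\<^sub>0" by (simp add: H_def sobolev_norm_def wt_def)
    finally show "sobolev_norm r (\<psi> t) \<le> sqrt C * bracket t powr \<epsilon> * sobolev_norm r \<psi>\<^sub>0" .
  qed
qed

end
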